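(* Consider the model $y_i=x_i\beta+u_i$, $x_i=Z_{i.}'\pi+v_i$, $i=1,\dots,n$, with scalar dependent variable $y_i$, scalar endogenous regressor $x_i$ and a vector $Z_{i.}$ of $L$ instruments ($L$ fixed as $n$ grows), where $x_i$ is missing for $n_1$ of the $n$ observations. Assume: (1) $\operatorname{plim}(Z'u/n)=E[Z_{i.}u_i]=0$ and $\operatorname{plim}(Z'v/n)=E[Z_{i.}v_i]=0$; (2) $\operatorname{plim}(Z'x/n)=E[Z_{i.}x_i]=Q_{Zx}\neq 0$; (3) $\operatorname{plim}(Z'Z/n)=E[Z_{i.}Z_{i.}']=Q_{ZZ}$, with $Q_{ZZ}$ a finite and full rank matrix; (4) observations are identically and independently distributed; (5) $\widehat p=n_1/n\to p<1$ as $n\to\infty$; (6) the missing structure is ignorable, i.e. the data are either missing completely at random or missing at random; (7) $E[y_i^4]$, $E[\widetilde x_i^4]$ and $E[\Vert Z_{i.}\Vert^4]$ are finite. (Homoskedasticity is not assumed.) Let $\widehat\beta_{RI}=(\widetilde x'P_Z\widetilde x)^{-1}\widetilde x'P_Zy$ be the two-stage least squares estimator with regression imputation, let $\widehat{\widetilde u}_i=y_i-\widetilde x_i\widehat\beta_{RI}$ and $\widehat{\widetilde v}_i=\widetilde x_i-Z_{i.}'\widehat\pi_{CC}$, and let $$\widehat V_{\widehat\beta_{RI}}=\left(\widetilde x'P_Z\widetilde x\right)^{-1}\widetilde x'Z(Z'Z)^{-1}\widehat W_{RI}(Z'Z)^{-1}Z'\widetilde x\left(\widetilde x'P_Z\widetilde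 x\right)^{-1},$$ where, with $A_0=\sum_{i=1}^{n_0}Z_{i.}Z_{i.}'$, $A_1=\sum_{i=n_0+1}^{n}Z_{i.}Z_{i.}'$ and $B_0=\sum_{i=1}^{n_0}\widehat{\widetilde v}_i^2Z_{i.}Z_{i.}'$, $$\begin{aligned}\widehat W_{RI}=&\left(\sum_{i=1}^{n}\widehat{\widetilde u}_i^2Z_{i.}Z_{i.}'\right)-2\left(\sum_{i=1}^{n_0}\widehat{\widetilde u}_i\widehat{\widetilde v}_iZ_{i.}Z_{i.}'\right)A_0^{-1}A_1\widehat\beta_{RI}\\&+\left[A_1A_0^{-1}B_0A_0^{-1}A_1-\sum_{i=n_0+1}^{n}Z_{i.}Z_{i.}'A_0^{-1}B_0A_0^{-1}Z_{i.}Z_{i.}'\right]\widehat\beta_{RI}^2.\end{aligned}$$ Then $\widehat V_{\widehat\beta_{RI}}$ is a consistent estimator of the asymptotic variance $V_{\widehat\beta_{RI}}$ of $\widehat\beta_{RI}$, in the sense that $n\widehat V_{\widehat\beta_{RI}}\xrightarrow{p}V_{\widehat\beta_{RI}}$, where $$V_{\widehat\beta_{RI}}=\left(Q_{xZ}Q_{ZZ}^{-1}Q_{Zx}\right)^{-1}Q_{xZ}Q_{ZZ}^{-1}\,\Omega\,Q_{ZZ}^{-1}Q_{Zx}\left(Q_{xZ}Q_{ZZ}^{-1}Q_{Zx}\right)^{-1},$$ $$\begin{aligned}\Omega=&\,E[u_i^2Z_{i.}Z_{i.}']-2p\,E[u_{0i}v_{0i}Z_{0i.}Z_{0i.}']Q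_{Z_0Z_0}^{-1}Q_{Z_1Z_1}\beta\\&+\frac{p^2}{1-p}Q_{Z_1Z_1}Q_{Z_0Z_0}^{-1}E[v_{0i}^2Z_{0i.}Z_{0i.}']Q_{Z_0Z_0}^{-1}Q_{Z_1Z_1}\beta^2\\&+2p\,E[u_{1i}v_{1i}Z_{1i.}Z_{1i.}']\beta+p\,E[v_{1i}^2Z_{1i.}Z_{1i.}']\beta^2.\end{aligned}$$
   Context: Notation: $y,x,u,v$ are the $n$-vectors of the $y_i,x_i,u_i,v_i$, and $Z$ is the $n\times L$ matrix with rows $Z_{i.}'$. $P_Z=Z(Z'Z)^{-1}Z'$ and $Q_{xZ}=Q_{Zx}'$. Complete and incomplete observations: only $x_i$ can be missing; $y_i$ and $Z_{i.}$ are observed for all $i$. Without loss of generality the first $n_0=n-n_1$ observations are complete ($x_i$ observed) and the remaining $n_1$ are incomplete ($x_i$ missing). A subscript $0$ denotes the complete observations and a subscript $1$ the incomplete ones, so $y_0,x_0,Z_0,u_0,v_0$ are the first $n_0$ rows and $y_1,x_1,Z_1,u_1,v_1$ the last $n_1$ rows of the respective vectors and matrix. Likewise $u_{ji},v_{ji},Z_{ji.}$ with $j\in\{0,1\}$ denote the variables of a complete ($j=0$) or incomplete ($j=1$) observation, expectations with subscript $j$ are taken for such an observation, and $Q_{Z_jZ_j}$ is the probability limit of $Z_j'Z_j/n_j$. Missing at random means that the missing structure depends only on observables. Regression imputation: $\widehat\pi_{CC}=(Z_0'Z_0)^{-1}Z_0'x_0$ is the first-stage estimate from the complete observations. The imputed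 regressor $\widetilde x$ has entries $\widetilde x_i=x_i$ for complete observations and $\widetilde x_i=Z_{i.}'\widehat\pi_{CC}$ for incomplete observations. $V_{\widehat\beta_{RI}}$ is the variance of the normal limiting distribution of $\sqrt n(\widehat\beta_{RI}-\beta)$.
   Formalization: In the missing-at-random case the statement also assumes E[Z_{0i.}v_{0i}]=0 for complete observations, full rank of Q_{Z_0Z_0}, and that the expectations in Ω exist; without the first the claim fails. The fourth moment of the imputed regressor is taken at π instead of the estimate. *)

theory Defs
  imports "HOL-Probability.Probability"
begin

section \<open>Probabilistic notions\<close>

text \<open>Measurability is demanded explicitly because \<^term>\<open>measure M A\<close> is \<open>0\<close> for
  non-measurable \<open>A\<close>.\<close>

definition plim :: "'a measure \<Rightarrow> (nat \<Rightarrow> 'a \<Rightarrow> 'b::{metric_space}) \<Rightarrow> 'b \<Rightarrow> bool" where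
  "plim M X c \<longleftrightarrow>
     (\<forall>n. X n \<in> borel_measurable M) \<and>
     (\<forall>\<epsilon>>0. (\<lambda>n. measure M {\<omega> \<in> space M. dist (X n \<omega>) c > \<epsilon>}) \<longlonglongrightarrow> 0)"

text \<open>The centred normal law with variance \<open>V\<close>; for \<open>V = 0\<close> it is the point mass at \<open>0\<close>,
  which has no density.\<close>

definition normal_law :: "real \<Rightarrow> real measure" where
  "normal_law V =
     (if V = 0 then return borel 0 else density lborel (normal_density 0 (sqrt V)))"

definition asymptotic_variance :: "'a measure \<Rightarrow> (nat \<Rightarrow> 'a \<Rightarrow> real) \<Rightarrow> real \<Rightarrow> real \<Rightarrow> bool" where
  "asymptotic_variance M b \<beta> V \<longleftrightarrow>
     0 \<le> V \<and> (\<forall>n. b n \<in> borel_measurable M) \<and>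
     weak_conv_m (\<lambda>n. distr M borel (\<lambda>\<omega>. sqrt (real n) * (b n \<omega> - \<beta>))) (normal_law V)"

text \<open>Elementary conditional expectation given an event; it is \<open>0\<close> if the event is null.\<close>

definition expect_given ::
  "'a measure \<Rightarrow> ('a \<Rightarrow> bool) \<Rightarrow> ('a \<Rightarrow> 'b::{banach, second_countable_topology}) \<Rightarrow> 'b" where
  "expect_given M P f =
     (\<integral>\<omega>. indicator {\<omega> \<in> space M. P \<omega>} \<omega> *\<^sub>R f \<omega> \<partial>M) /\<^sub>R measure M {\<omega> \<in> space M. P \<omega>}"

text \<open>\<open>miss\<close> is the event that \<open>x\<close> is missing. Under missingness completely at random it is
  independent of all the data; under missingness at random its conditional probability given
  all the data depends only on the always observed \<open>y\<close> and \<open>Z\<close>.\<close>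

definition mcar ::
  "'a measure \<Rightarrow> ('a \<Rightarrow> real) \<Rightarrow> ('a \<Rightarrow> real) \<Rightarrow> ('a \<Rightarrow> real^'l) \<Rightarrow> ('a \<Rightarrow> bool) \<Rightarrow> bool" where
  "mcar M y x Z miss \<longleftrightarrow>
     prob_space.indep_set M
       (sets (vimage_algebra (space M) miss (count_space UNIV)))
       (sets (vimage_algebra (space M) (\<lambda>\<omega>. (y \<omega>, x \<omega>, Z \<omega>)) borel))"

definition mar ::
  "'a measure \<Rightarrow> ('a \<Rightarrow> real) \<Rightarrow> ('a \<Rightarrow> real) \<Rightarrow> ('a \<Rightarrow> real^'l) \<Rightarrow> ('a \<Rightarrow> bool) \<Rightarrow> bool" where
  "mar M y x Z miss \<longleftrightarrow>
     (AE \<omega> in M.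
        real_cond_exp M (vimage_algebra (space M) (\<lambda>\<omega>. (y \<omega>, x \<omega>, Z \<omega>)) borel)
          (indicator {\<omega> \<in> space M. miss \<omega>}) \<omega> =
        real_cond_exp M (vimage_algebra (space M) (\<lambda>\<omega>. (y \<omega>, Z \<omega>)) borel)
          (indicator {\<omega> \<in> space M. miss \<omega>}) \<omega>)"

section \<open>Estimators as functions of a sample\<close>

text \<open>A sample is a sequence of observations, of which the first \<open>n\<close> are used. The complete
  observations are not moved to the front: they form an index set determined by \<open>miss\<close>, and
  every sum below is invariant under reordering. Products with the \<open>n \<times> L\<close> matrix of
  instruments are written as sums over observations, so \<open>Z'Z\<close> is \<open>gram {..<n} Z\<close>.\<close>

definition obs_complete :: "nat \<Rightarrow> (nat \<Rightarrow> bool) \<Rightarrow> nat set" where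
  "obs_complete n miss = {i. i < n \<and> \<not> miss i}"

definition obs_incomplete :: "nat \<Rightarrow> (nat \<Rightarrow> bool) \<Rightarrow> nat set" where
  "obs_incomplete n miss = {i. i < n \<and> miss i}"

definition outer :: "real^'l \<Rightarrow> real^'l^'l" where
  "outer z = (\<chi> i j. z $ i * z $ j)"

definition gram :: "nat set \<Rightarrow> (nat \<Rightarrow> real^'l) \<Rightarrow> real^'l^'l" where
  "gram I Z = (\<Sum>i\<in>I. outer (Z i))"

definition cross :: "nat set \<Rightarrow> (nat \<Rightarrow> real^'l) \<Rightarrow> (nat \<Rightarrow> real) \<Rightarrow> real^'l" where
  "cross I Z a = (\<Sum>i\<in>I. a i *\<^sub>R Z i)"

text \<open>The bilinear form \<open>a'P\<^sub>Zb\<close>.\<close>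

definition proj_form :: "nat \<Rightarrow> (nat \<Rightarrow> real^'l) \<Rightarrow> (nat \<Rightarrow> real) \<Rightarrow> (nat \<Rightarrow> real) \<Rightarrow> real" where
  "proj_form n Z a b =
     cross {..<n} Z a \<bullet> (matrix_inv (gram {..<n} Z) *v cross {..<n} Z b)"

definition pi_CC ::
  "nat \<Rightarrow> (nat \<Rightarrow> real) \<Rightarrow> (nat \<Rightarrow> real^'l) \<Rightarrow> (nat \<Rightarrow> bool) \<Rightarrow> real^'l" where
  "pi_CC n x Z miss =
     matrix_inv (gram (obs_complete n miss) Z) *v cross (obs_complete n miss) Z x"

definition impute ::
  "real^'l \<Rightarrow> (nat \<Rightarrow> real) \<Rightarrow> (nat \<Rightarrow> real^'l) \<Rightarrow> (nat \<Rightarrow> bool) \<Rightarrow> nat \<Rightarrow> real" where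
  "impute c x Z miss i = (if miss i then Z i \<bullet> c else x i)"

definition x_RI ::
  "nat \<Rightarrow> (nat \<Rightarrow> real) \<Rightarrow> (nat \<Rightarrow> real^'l) \<Rightarrow> (nat \<Rightarrow> bool) \<Rightarrow> nat \<Rightarrow> real" where
  "x_RI n x Z miss = impute (pi_CC n x Z miss) x Z miss"

definition beta_RI ::
  "nat \<Rightarrow> (nat \<Rightarrow> real) \<Rightarrow> (nat \<Rightarrow> real) \<Rightarrow> (nat \<Rightarrow> real^'l) \<Rightarrow> (nat \<Rightarrow> bool) \<Rightarrow> real" where
  "beta_RI n y x Z miss =
     (let xt = x_RI n x Z miss in inverse (proj_form n Z xt xt) * proj_form n Z xt y)"

definition u_hat ::
  "nat \<Rightarrow> (nat \<Rightarrow> real) \<Rightarrow> (nat \<Rightarrow> real) \<Rightarrow> (nat \<Rightarrow> real^'l) \<Rightarrow> (nat \<Rightarrow> bool) \<Rightarrow> nat \<Rightarrow> real" where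
  "u_hat n y x Z miss i = y i - x_RI n x Z miss i * beta_RI n y x Z miss"

definition v_hat ::
  "nat \<Rightarrow> (nat \<Rightarrow> real) \<Rightarrow> (nat \<Rightarrow> real^'l) \<Rightarrow> (nat \<Rightarrow> bool) \<Rightarrow> nat \<Rightarrow> real" where
  "v_hat n x Z miss i = x_RI n x Z miss i - Z i \<bullet> pi_CC n x Z miss"

definition W_RI ::
  "nat \<Rightarrow> (nat \<Rightarrow> real) \<Rightarrow> (nat \<Rightarrow> real) \<Rightarrow> (nat \<Rightarrow> real^'l) \<Rightarrow> (nat \<Rightarrow> bool) \<Rightarrow> real^'l^'l" where
  "W_RI n y x Z miss =
     (let I0 = obs_complete n miss; I1 = obs_incomplete n miss;
          b = beta_RI n y x Z miss;
          uh = u_hat n y x Z miss; vh = v_hat n x Z miss;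
          A0i = matrix_inv (gram I0 Z); A1 = gram I1 Z;
          B0 = (\<Sum>i\<in>I0. (vh i)\<^sup>2 *\<^sub>R outer (Z i))
      in (\<Sum>i<n. (uh i)\<^sup>2 *\<^sub>R outer (Z i))
         - (2 * b) *\<^sub>R ((\<Sum>i\<in>I0. (uh i * vh i) *\<^sub>R outer (Z i)) ** A0i ** A1)
         + b\<^sup>2 *\<^sub>R (A1 ** A0i ** B0 ** A0i ** A1
                  - (\<Sum>i\<in>I1. outer (Z i) ** A0i ** B0 ** A0i ** outer (Z i))))"

definition V_RI_hat ::
  "nat \<Rightarrow> (nat \<Rightarrow> real) \<Rightarrow> (nat \<Rightarrow> real) \<Rightarrow> (nat \<Rightarrow> real^'l) \<Rightarrow> (nat \<Rightarrow> bool) \<Rightarrow> real" where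
  "V_RI_hat n y x Z miss =
     (let xt = x_RI n x Z miss;
          d = inverse (proj_form n Z xt xt);
          Gi = matrix_inv (gram {..<n} Z);
          c = cross {..<n} Z xt
      in d * (c \<bullet> (Gi *v (W_RI n y x Z miss *v (Gi *v c)))) * d)"

section \<open>The limiting variance\<close>

text \<open>\<open>u\<close>, \<open>v\<close>, \<open>Z\<close> and \<open>miss\<close> describe one generic observation.\<close>

definition Omega_RI ::
  "'a measure \<Rightarrow> ('a \<Rightarrow> real) \<Rightarrow> ('a \<Rightarrow> real) \<Rightarrow> ('a \<Rightarrow> real^'l) \<Rightarrow> ('a \<Rightarrow> bool) \<Rightarrow>
   real \<Rightarrow> real \<Rightarrow> real^'l^'l \<Rightarrow> real^'l^'l \<Rightarrow> real^'l^'l" where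
  "Omega_RI M u v Z miss p \<beta> Q0 Q1 =
     (let E0 = expect_given M (\<lambda>\<omega>. \<not> miss \<omega>); E1 = expect_given M miss
      in (\<integral>\<omega>. (u \<omega>)\<^sup>2 *\<^sub>R outer (Z \<omega>) \<partial>M)
         - (2 * p * \<beta>) *\<^sub>R (E0 (\<lambda>\<omega>. (u \<omega> * v \<omega>) *\<^sub>R outer (Z \<omega>)) ** matrix_inv Q0 ** Q1)
         + (p\<^sup>2 / (1 - p) * \<beta>\<^sup>2) *\<^sub>R
             (Q1 ** matrix_inv Q0 ** E0 (\<lambda>\<omega>. (v \<omega>)\<^sup>2 *\<^sub>R outer (Z \<omega>)) ** matrix_inv Q0 ** Q1)
         + (2 * p * \<beta>) *\<^sub>R E1 (\<lambda>\<omega>. (u \<omega> * v \<omega>) *\<^sub>R outer (Z \<omega>))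
         + (p * \<beta>\<^sup>2) *\<^sub>R E1 (\<lambda>\<omega>. (v \<omega>)\<^sup>2 *\<^sub>R outer (Z \<omega>)))"

definition V_RI :: "real^'l \<Rightarrow> real^'l^'l \<Rightarrow> real^'l^'l \<Rightarrow> real" where
  "V_RI Qzx Qzz \<Omega> =
     (let d = inverse (Qzx \<bullet> (matrix_inv Qzz *v Qzx))
      in d * (Qzx \<bullet> (matrix_inv Qzz *v (\<Omega> *v (matrix_inv Qzz *v Qzx)))) * d)"

end

theory Submission
  imports Defs "HOL-Real_Asymp.Real_Asymp"
begin

text \<open>Imputing with the true \<open>\<pi>\<close> turns the error of the outcome equation into \<open>r = u + \<beta> v\<close> on the
  incomplete and \<open>r = u\<close> on the complete observations. The estimation error of \<open>\<pi>\<close> is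
  \<open>\<delta> = A\<^sub>0\<inverse> \<Sum> s Z\<close>, where \<open>s\<close> is \<open>v\<close> on the complete observations and \<open>0\<close> on the others. Therefore
  \<open>\<surd>n (\<beta>\<^sub>R\<^sub>I - \<beta>) = a \<bullet> n\<^sup>-\<^sup>1\<^sup>/\<^sup>2 \<Sum> r Z - \<beta> (A\<^sub>0\<inverse> A\<^sub>1 a) \<bullet> n\<^sup>-\<^sup>1\<^sup>/\<^sup>2 \<Sum> s Z\<close> holds exactly for a
  random vector \<open>a\<close> that converges in probability. Since the normalized sums have bounded second
  moments, \<open>a\<close> may be replaced by its limit, and the central limit theorem for one scalar
  score applies. In terms of \<open>r\<close> and \<open>s\<close> the matrix \<open>\<Omega>\<close> consists of the three moments of
  \<open>r\<^sup>2\<close>, \<open>r s\<close> and \<open>s\<^sup>2\<close> against \<open>Z Z'\<close>. The residuals differ from \<open>r\<close> and \<open>s\<close> by a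
  null sequence times an envelope with enough moments, so the weak law of large numbers gives
  the limit of \<open>W\<^sub>R\<^sub>I / n\<close>; the last sum in \<open>W\<^sub>R\<^sub>I\<close> is of smaller order.\<close>

subsection \<open>Convergence in probability\<close>

text \<open>The regressor used in the second stage is imputed with an estimate from the same sample,
  so its rows are dependent and no limit theorem applies to them directly. All dependence is
  therefore pushed into the vector \<delta> and into random matrices that converge in probability;
  the sums that remain have i.i.d. summands.

  The second-stage residual estimates \<open>r\<close>, not \<open>u\<close>. Its squares against Z
  Z' average to E[u^2 Z Z'] plus the two expectations over incomplete observations in \<Omega>,
  which is why those two terms have no separate counterpart in \<open>W_RI\<close>.

  Since \<open>matrix_inv\<close> of a singular matrix is arbitrary, the algebraic identities are
  used only where the sample matrices are invertible. That event has probability tending to one, and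
  the filter lets it be used like any eventually true condition. Ignorability supplies the
  orthogonality of v and Z on each class of observations, the invertibility of the complete-case
  moment matrix and second moments of u and v against Z.\<close>

text \<open>Convergence in probability is convergence along this filter, which makes the general
  calculus of limits available for it.\<close>

definition in_prob :: "'a measure \<Rightarrow> (nat \<times> 'a) filter" where
  "in_prob M = Abs_filter (\<lambda>P. \<forall>\<eta>>0. \<forall>\<^sub>F n in sequentially.
     \<exists>A\<in>sets M. measure M A < \<eta> \<and> (\<forall>\<omega>\<in>space M - A. P (n, \<omega>)))"

context prob_space
begin

text \<open>The failures are only required to lie inside a measurable set of small measure, so the
  definition makes sense for arbitrary predicates. Closure under conjunction spends half of \<eta>
  on each predicate and unites the two exceptional sets.\<close>

lemma eventually_in_prob:
  "eventually P (in_prob M) \<longleftrightarrow> (\<forall>\<eta>>0. \<forall>\<^sub>F n in sequentially.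
     \<exists>A\<in>sets M. measure M A < \<eta> \<and> (\<forall>\<omega>\<in>space M - A. P (n, \<omega>)))"
  unfolding in_prob_def
proof (rule eventually_Abs_filter, rule is_filter.intro, goal_cases)
  case 1
  show ?case by (auto intro!: always_eventually bexI[of _ "{}"])
next
  case (2 P Q)
  show ?case
  proof (intro allI impI)
    fix \<eta> :: real assume "0 < \<eta>"
    then have "0 < \<eta> / 2" by simp
    with 2 have "\<forall>\<^sub>F n in sequentially. \<exists>A\<in>sets M. measure M A < \<eta> / 2 \<and> (\<forall>\<omega>\<in>space M - A. P (n, \<omega>))"
      and "\<forall>\<^sub>F n in sequentially. \<exists>A\<in>sets M. measure M A < \<eta> / 2 \<and> (\<forall>\<omega>\<in>space M - A. Q (n, \<omega>))"
      by blast+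
    then show "\<forall>\<^sub>F n in sequentially. \<exists>A\<in>sets M. measure M A < \<eta> \<and> (\<forall>\<omega>\<in>space M - A. P (n, \<omega>) \<and> Q (n, \<omega>))"
    proof eventually_elim
      case (elim n)
      then obtain A B where "A \<in> sets M" "measure M A < \<eta> / 2" "\<forall>\<omega>\<in>space M - A. P (n, \<omega>)"
        "B \<in> sets M" "measure M B < \<eta> / 2" "\<forall>\<omega>\<in>space M - B. Q (n, \<omega>)" by blast
      then show ?case using measure_Un_le[of A M B]
        by (intro bexI[of _ "A \<union> B"]) auto
    qed
  qed
next
  case (3 P Q)
  show ?case
  proof (intro allI impI)
    fix \<eta> :: real assume "0 < \<eta>"
    with 3(2) have "\<forall>\<^sub>F n in sequentially. \<exists>A\<in>sets M. measure M A < \<eta> \<and> (\<forall>\<omega>\<in>space M - A. P (n, \<omega>))"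
      by blast
    then show "\<forall>\<^sub>F n in sequentially. \<exists>A\<in>sets M. measure M A < \<eta> \<and> (\<forall>\<omega>\<in>space M - A. Q (n, \<omega>))"
      using 3(1) by (auto elim!: eventually_mono)
  qed
qed

lemma eventually_in_probE:
  assumes "eventually P (in_prob M)" "0 < \<eta>"
  shows "\<forall>\<^sub>F n in sequentially. \<exists>A\<in>sets M. measure M A < \<eta> \<and> (\<forall>\<omega>\<in>space M - A. P (n, \<omega>))"
  using assms by (simp add: eventually_in_prob)

lemma eventually_in_prob_fst:
  assumes "eventually P sequentially"
  shows "\<forall>\<^sub>F w in in_prob M. P (fst w)"
  unfolding eventually_in_prob
proof (intro allI impI)
  fix \<eta> :: real assume "0 < \<eta>"
  then show "\<forall>\<^sub>F n in sequentially. \<exists>A\<in>sets M. measure M A < \<eta> \<and> (\<forall>\<omega>\<in>space M - A. P (fst (n, \<omega>)))"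
    using assms by (auto elim!: eventually_mono intro!: bexI[of _ "{}"])
qed

lemma tendsto_in_prob_fst:
  fixes f :: "nat \<Rightarrow> 'b :: metric_space"
  assumes "f \<longlonglongrightarrow> c" shows "((\<lambda>w. f (fst w)) \<longlongrightarrow> c) (in_prob M)"
  using assms by (auto intro!: tendstoI eventually_in_prob_fst dest: tendstoD)

text \<open>Needed for uniqueness of limits, by which assumed probability limits are later
  identified with expectations. A set of measure below 1 cannot cover the whole space.\<close>

lemma in_prob_neq_bot: "in_prob M \<noteq> bot"
proof
  assume "in_prob M = bot"
  then have "eventually (\<lambda>_. False) (in_prob M)" by simp
  from eventually_in_probE[OF this, of 1]
  have "\<forall>\<^sub>F n in sequentially. \<exists>A\<in>sets M. measure M A < 1 \<and> (\<forall>\<omega>\<in>space M - A. False)" by simp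
  then have "\<forall>\<^sub>F n in sequentially. False"
  proof (rule eventually_mono)
    fix n :: nat assume "\<exists>A\<in>sets M. measure M A < 1 \<and> (\<forall>\<omega>\<in>space M - A. False)"
    then obtain A where A: "A \<in> sets M" "measure M A < 1" "space M \<subseteq> A" by blast
    then have "A = space M" using sets.sets_into_space by blast
    then show False using A prob_space by simp
  qed
  then show False by simp
qed

lemma eventually_in_probI:
  assumes "\<And>n. A n \<in> sets M" "(\<lambda>n. measure M (A n)) \<longlonglongrightarrow> 0"
    and "\<And>n \<omega>. \<omega> \<in> space M \<Longrightarrow> \<omega> \<notin> A n \<Longrightarrow> P (n, \<omega>)"
  shows "eventually P (in_prob M)"
  unfolding eventually_in_prob
proof (intro allI impI)
  fix \<eta> :: real assume "0 < \<eta>"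
  then have "\<forall>\<^sub>F n in sequentially. measure M (A n) < \<eta>" using order_tendstoD(2)[OF assms(2)] by auto
  then show "\<forall>\<^sub>F n in sequentially. \<exists>A\<in>sets M. measure M A < \<eta> \<and> (\<forall>\<omega>\<in>space M - A. P (n, \<omega>))"
    using assms(1,3) by (auto elim!: eventually_mono)
qed

lemma plim_iff_tendsto:
  fixes X :: "nat \<Rightarrow> 'a \<Rightarrow> 'b :: {metric_space, second_countable_topology}"
  shows "plim M X c \<longleftrightarrow>
    (\<forall>n. X n \<in> borel_measurable M) \<and> ((\<lambda>w. X (fst w) (snd w)) \<longlongrightarrow> c) (in_prob M)"
proof (cases "\<forall>n. X n \<in> borel_measurable M")
  case True
  then have [measurable]: "X n \<in> borel_measurable M" for n by blast
  have "(\<forall>\<epsilon>>0. (\<lambda>n. measure M {\<omega> \<in> space M. dist (X n \<omega>) c > \<epsilon>}) \<longlonglongrightarrow> 0) \<longleftrightarrow>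
     ((\<lambda>w. X (fst w) (snd w)) \<longlongrightarrow> c) (in_prob M)"
  proof safe
    assume *: "\<forall>\<epsilon>>0. (\<lambda>n. measure M {\<omega> \<in> space M. dist (X n \<omega>) c > \<epsilon>}) \<longlonglongrightarrow> 0"
    show "((\<lambda>w. X (fst w) (snd w)) \<longlongrightarrow> c) (in_prob M)"
    proof (rule tendstoI)
      fix e :: real assume "0 < e"
      \<comment> \<open>\<open>plim\<close> controls the event that the distance exceeds its bound,
        while the goal is a strict inequality off that event; halving \<open>e\<close> bridges the
        gap.\<close>
      then show "\<forall>\<^sub>F w in in_prob M. dist (X (fst w) (snd w)) c < e"
        using *[rule_format, of "e / 2"]
        by (intro eventually_in_probI[where A="\<lambda>n. {\<omega> \<in> space M. dist (X n \<omega>) c > e / 2}"]) auto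
    qed
  next
    fix e :: real
    assume *: "((\<lambda>w. X (fst w) (snd w)) \<longlongrightarrow> c) (in_prob M)" and "0 < e"
    show "(\<lambda>n. measure M {\<omega> \<in> space M. dist (X n \<omega>) c > e}) \<longlonglongrightarrow> 0"
    proof (rule tendstoI)
      fix \<eta> :: real assume "0 < \<eta>"
      from eventually_in_probE[OF tendstoD[OF * \<open>0 < e\<close>] this]
      show "\<forall>\<^sub>F n in sequentially. dist (measure M {\<omega> \<in> space M. dist (X n \<omega>) c > e}) 0 < \<eta>"
      proof eventually_elim
        case (elim n)
        then obtain A where A: "A \<in> sets M" "measure M A < \<eta>" "\<forall>\<omega>\<in>space M - A. dist (X n \<omega>) c < e"
          by auto
        then have "measure M {\<omega> \<in> space M. dist (X n \<omega>) c > e} \<le> measure M A"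
          by (intro finite_measure_mono) force+
        then show ?case using A by simp
      qed
    qed
  qed
  then show ?thesis using True by (simp add: plim_def)
qed (auto simp: plim_def)

text \<open>A null sequence times one that is bounded in probability, the bound coming from
  Chebyshev's inequality. This is what discards the error of random coefficients in front of root-n
  sums.\<close>

lemma tendsto_zero_bounded_second_moment:
  fixes X Y :: "nat \<Rightarrow> 'a \<Rightarrow> real"
  assumes X: "((\<lambda>w. X (fst w) (snd w)) \<longlongrightarrow> 0) (in_prob M)"
    and [measurable]: "\<And>n. Y n \<in> borel_measurable M"
    and int: "\<And>n. integrable M (\<lambda>\<omega>. (Y n \<omega>)\<^sup>2)" and bound: "\<And>n. expectation (\<lambda>\<omega>. (Y n \<omega>)\<^sup>2) \<le> C"
  shows "((\<lambda>w. X (fst w) (snd w) * Y (fst w) (snd w)) \<longlongrightarrow> 0) (in_prob M)"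
proof (rule tendstoI)
  fix e :: real assume "0 < e"
  show "\<forall>\<^sub>F w in in_prob M. dist (X (fst w) (snd w) * Y (fst w) (snd w)) 0 < e"
    unfolding eventually_in_prob
  proof (intro allI impI)
    fix \<eta> :: real assume "0 < \<eta>"
    \<comment> \<open>\<open>K\<close> is chosen to give C / K^2 < \<eta> / 2: it exceeds 2 |C| /
      \<eta>, and the lower bound 1 ensures K \<le> K^2.\<close>
    define K where "K = max 1 (2 * \<bar>C\<bar> / \<eta> + 1)"
    have K: "1 \<le> K" "2 * \<bar>C\<bar> / \<eta> + 1 \<le> K" by (auto simp: K_def)
    have "2 * \<bar>C\<bar> / \<eta> < K\<^sup>2"
      using K by (smt (verit) power2_eq_square mult_mono mult_cancel_left2)
    then have "\<bar>C\<bar> < \<eta> / 2 * K\<^sup>2" using \<open>0 < \<eta>\<close> by (simp add: field_simps)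
    then have "C < \<eta> / 2 * K\<^sup>2" by linarith
    then have CK: "C / K\<^sup>2 < \<eta> / 2" using K by (subst pos_divide_less_eq) auto
    have "0 < e / K" using K \<open>0 < e\<close> by simp
    have "0 < \<eta> / 2" using \<open>0 < \<eta>\<close> by simp
    from eventually_in_probE[OF tendstoD[OF X \<open>0 < e / K\<close>] this]
    show "\<forall>\<^sub>F n in sequentially. \<exists>A\<in>sets M. measure M A < \<eta> \<and>
        (\<forall>\<omega>\<in>space M - A. dist (X (fst (n, \<omega>)) (snd (n, \<omega>)) * Y (fst (n, \<omega>)) (snd (n, \<omega>))) 0 < e)"
    proof (rule eventually_mono)
      fix n
      assume "\<exists>A\<in>sets M. measure M A < \<eta> / 2 \<and>
        (\<forall>\<omega>\<in>space M - A. dist (X (fst (n, \<omega>)) (snd (n, \<omega>))) 0 < e / K)"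
      then obtain A where [measurable]: "A \<in> sets M" and A: "measure M A < \<eta> / 2"
        "\<And>\<omega>. \<omega> \<in> space M \<Longrightarrow> \<omega> \<notin> A \<Longrightarrow> \<bar>X n \<omega>\<bar> < e / K" by auto
      let ?B = "{\<omega> \<in> space M. \<bar>Y n \<omega>\<bar> \<ge> K}"
      have "measure M ?B \<le> expectation (\<lambda>\<omega>. (Y n \<omega>)\<^sup>2) / K\<^sup>2"
        using K int by (intro second_moment_method) auto
      also have "\<dots> \<le> C / K\<^sup>2" using bound K by (intro divide_right_mono) auto
      finally have B: "measure M ?B < \<eta> / 2" using CK by linarith
      have "\<bar>X n \<omega> * Y n \<omega>\<bar> < e" if "\<omega> \<in> space M - (A \<union> ?B)" for \<omega>
      proof -
        have "\<bar>X n \<omega>\<bar> < e / K" "\<bar>Y n \<omega>\<bar> < K" using A(2)[of \<omega>] that by auto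
        then have "\<bar>X n \<omega>\<bar> * \<bar>Y n \<omega>\<bar> < e / K * K"
          using K by (intro mult_strict_mono') auto
        then show ?thesis using K by (simp add: abs_mult)
      qed
      moreover have "measure M (A \<union> ?B) < \<eta>"
        using measure_Un_le[of A M ?B] A B by simp
      ultimately show "\<exists>A\<in>sets M. measure M A < \<eta> \<and>
        (\<forall>\<omega>\<in>space M - A. dist (X (fst (n, \<omega>)) (snd (n, \<omega>)) * Y (fst (n, \<omega>)) (snd (n, \<omega>))) 0 < e)"
        by (intro bexI[of _ "A \<union> ?B"]) auto
    qed
  qed
qed

text \<open>Since exp(itX) has modulus 1, the two integrands differ in norm by |exp(itD) - 1|. This
  is below e/4 off a set of measure less than e/8 and at most 2 on that set, so the expectations
  differ by less than e.\<close>

lemma char_plus_negligible: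
  fixes X D :: "nat \<Rightarrow> 'a \<Rightarrow> real"
  assumes [measurable]: "\<And>n. X n \<in> borel_measurable M" "\<And>n. D n \<in> borel_measurable M"
    and D: "((\<lambda>w. D (fst w) (snd w)) \<longlongrightarrow> 0) (in_prob M)"
    and char: "(\<lambda>n. char (distr M borel (X n)) t) \<longlonglongrightarrow> \<phi>"
  shows "(\<lambda>n. char (distr M borel (\<lambda>\<omega>. X n \<omega> + D n \<omega>)) t) \<longlonglongrightarrow> \<phi>"
proof -
  have "(\<lambda>n. char (distr M borel (\<lambda>\<omega>. X n \<omega> + D n \<omega>)) t - char (distr M borel (X n)) t) \<longlonglongrightarrow> 0"
  proof (rule tendstoI)
    fix e :: real assume "0 < e"
    have "((\<lambda>w. norm (iexp (t * D (fst w) (snd w)) - 1)) \<longlongrightarrow> norm (iexp (t * 0) - 1)) (in_prob M)"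
      by (intro tendsto_intros D)
    then have "\<forall>\<^sub>F w in in_prob M. norm (iexp (t * D (fst w) (snd w)) - 1) < e / 4"
      using \<open>0 < e\<close> by (intro order_tendstoD(2)) auto
    moreover have "0 < e / 8" using \<open>0 < e\<close> by simp
    ultimately have "\<forall>\<^sub>F n in sequentially. \<exists>A\<in>sets M. measure M A < e / 8 \<and>
        (\<forall>\<omega>\<in>space M - A. norm (iexp (t * D (fst (n, \<omega>)) (snd (n, \<omega>))) - 1) < e / 4)"
      by (rule eventually_in_probE)
    then show "\<forall>\<^sub>F n in sequentially. dist (char (distr M borel (\<lambda>\<omega>. X n \<omega> + D n \<omega>)) t
        - char (distr M borel (X n)) t) 0 < e"
    proof (rule eventually_mono)
      fix n
      assume "\<exists>A\<in>sets M. measure M A < e / 8 \<and>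
        (\<forall>\<omega>\<in>space M - A. norm (iexp (t * D (fst (n, \<omega>)) (snd (n, \<omega>))) - 1) < e / 4)"
      then obtain A where [measurable]: "A \<in> sets M" and A: "measure M A < e / 8"
        "\<And>\<omega>. \<omega> \<in> space M \<Longrightarrow> \<omega> \<notin> A \<Longrightarrow> norm (iexp (t * D n \<omega>) - 1) < e / 4" by auto
      have int: "complex_integrable M (\<lambda>\<omega>. iexp (t * (X n \<omega> + D n \<omega>)))" "complex_integrable M (\<lambda>\<omega>. iexp (t * X n \<omega>))"
        by (auto intro!: integrable_iexp)
      have "char (distr M borel (\<lambda>\<omega>. X n \<omega> + D n \<omega>)) t - char (distr M borel (X n)) t
         = (CLINT \<omega>|M. iexp (t * (X n \<omega> + D n \<omega>)) - iexp (t * X n \<omega>))"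
        using int by (simp add: char_def integral_distr del: of_real_add)
      also have "norm \<dots> \<le> (LINT \<omega>|M. norm (iexp (t * (X n \<omega> + D n \<omega>)) - iexp (t * X n \<omega>)))"
        by (rule integral_norm_bound)
      also have "\<dots> \<le> (LINT \<omega>|M. e / 4 + 2 * indicator A \<omega>)"
      proof (rule integral_mono)
        show "integrable M (\<lambda>\<omega>. norm (iexp (t * (X n \<omega> + D n \<omega>)) - iexp (t * X n \<omega>)))"
          using int by (intro integrable_norm Bochner_Integration.integrable_diff)
        fix \<omega> assume \<omega>: "\<omega> \<in> space M"
        have "iexp (t * (X n \<omega> + D n \<omega>)) - iexp (t * X n \<omega>) = iexp (t * X n \<omega>) * (iexp (t * D n \<omega>) - 1)"
          by (simp add: algebra_simps exp_add)
        then have "norm (iexp (t * (X n \<omega> + D n \<omega>)) - iexp (t * X n \<omega>)) = norm (iexp (t * D n \<omega>) - 1)"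
          by (simp add: norm_mult)
        moreover have "norm (iexp (t * D n \<omega>) - 1) \<le> 2"
          using norm_triangle_ineq4[of "iexp (t * D n \<omega>)" 1] by simp
        ultimately show "norm (iexp (t * (X n \<omega> + D n \<omega>)) - iexp (t * X n \<omega>)) \<le> e / 4 + 2 * indicator A \<omega>"
          using A(2)[OF \<omega>] \<open>0 < e\<close> by (cases "\<omega> \<in> A") auto
      qed (auto intro!: Bochner_Integration.integrable_add integrable_real_indicator simp: emeasure_eq_measure)
      also have "\<dots> = e / 4 + 2 * measure M A"
        using prob_space by (subst Bochner_Integration.integral_add)
          (auto intro!: integrable_real_indicator simp: emeasure_eq_measure)
      also have "\<dots> < e" using A(1) \<open>0 < e\<close> by simp
      finally show "dist (char (distr M borel (\<lambda>\<omega>. X n \<omega> + D n \<omega>)) t - char (distr M borel (X n)) t) 0 < e"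
        by simp
    qed
  qed
  from tendsto_add[OF this char] show ?thesis by simp
qed

end

subsection \<open>Limit theorems for identically distributed samples\<close>

lemma real_distribution_normal_law:
  assumes "0 \<le> V" shows "real_distribution (normal_law V)"
  using assms unfolding normal_law_def real_distribution_def real_distribution_axioms_def
  by (auto intro!: prob_space_return prob_space_normal_density)

text \<open>A positive variance is reduced to the standard normal law by rescaling; for V = 0 the
  point mass has constant characteristic function 1, which is what the formula gives.\<close>

lemma char_normal_law:
  assumes "0 \<le> V" shows "char (normal_law V) t = complex_of_real (exp (- (V * t\<^sup>2) / 2))"
proof (cases "V = 0")
  case True
  then show ?thesis by (simp add: normal_law_def char_def integral_return)
next
  case False
  with assms have V: "0 < V" by simp
  interpret N: real_distribution std_normal_distribution by (rule real_dist_normal_dist)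
  have "distributed std_normal_distribution lborel (\<lambda>x. x) (normal_density 0 1)"
    by (auto simp: distributed_def distr_id2)
  from N.normal_density_affine[OF this, of "sqrt V" 0] V
  have "distributed std_normal_distribution lborel (\<lambda>x. sqrt V * x) (normal_density 0 (sqrt V))"
    by simp
  then have "normal_law V = distr std_normal_distribution lborel (\<lambda>x. sqrt V * x)"
    using V by (simp add: normal_law_def distributed_def)
  then have "char (normal_law V) t = char std_normal_distribution (sqrt V * t)"
    by (simp add: char_def integral_distr algebra_simps)
  then show ?thesis using V by (simp add: char_std_normal_distribution power_mult_distrib)
qed

text \<open>A whole observation is a single random element, so independence and equality of laws
  transfer at once to every measurable function of it.\<close>

locale iid_sample = prob_space M for M :: "'a measure" +
  fixes N :: "'b measure" and W :: "nat \<Rightarrow> 'a \<Rightarrow> 'b"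
  assumes indep: "indep_vars (\<lambda>_. N) W UNIV"
    and ident: "distr M N (W i) = distr M N (W 0)"
begin

lemma measurable_W [measurable]: "W i \<in> measurable M N"
  using indep by (simp add: indep_vars_def)

lemma expectation_W:
  fixes f :: "'b \<Rightarrow> 'c :: {banach, second_countable_topology}"
  assumes [measurable]: "f \<in> borel_measurable N"
  shows "(\<integral>\<omega>. f (W i \<omega>) \<partial>M) = (\<integral>\<omega>. f (W 0 \<omega>) \<partial>M)"
  using integral_distr[OF measurable_W assms, of i] integral_distr[OF measurable_W assms, of 0]
  by (simp add: ident[of i])

lemma integrable_W:
  fixes f :: "'b \<Rightarrow> 'c :: {banach, second_countable_topology}"
  assumes [measurable]: "f \<in> borel_measurable N" and "integrable M (\<lambda>\<omega>. f (W 0 \<omega>))"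
  shows "integrable M (\<lambda>\<omega>. f (W i \<omega>))"
  using assms(2) integrable_distr_eq[OF measurable_W assms(1), of i] integrable_distr_eq[OF measurable_W assms(1), of 0]
  by (simp add: ident[of i])

text \<open>The new summand is independent of the preceding partial sum and centred, so the cross
  term of the square has mean zero and each induction step adds one second moment.\<close>

lemma second_moment_sum:
  fixes f :: "'b \<Rightarrow> real"
  assumes f [measurable]: "f \<in> borel_measurable N" and int: "integrable M (\<lambda>\<omega>. (f (W 0 \<omega>))\<^sup>2)"
    and mean: "(\<integral>\<omega>. f (W 0 \<omega>) \<partial>M) = 0"
  shows "integrable M (\<lambda>\<omega>. (\<Sum>i<n. f (W i \<omega>))\<^sup>2)"
    and "(\<integral>\<omega>. (\<Sum>i<n. f (W i \<omega>))\<^sup>2 \<partial>M) = real n * (\<integral>\<omega>. (f (W 0 \<omega>))\<^sup>2 \<partial>M)"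
proof -
  have sq: "integrable M (\<lambda>\<omega>. (f (W i \<omega>))\<^sup>2)" for i
    using integrable_W[of "\<lambda>w. (f w)\<^sup>2"] int by simp
  have E2: "(\<integral>\<omega>. (f (W i \<omega>))\<^sup>2 \<partial>M) = (\<integral>\<omega>. (f (W 0 \<omega>))\<^sup>2 \<partial>M)" for i
    by (rule expectation_W[of "\<lambda>w. (f w)\<^sup>2"]) simp
  have fint: "integrable M (\<lambda>\<omega>. f (W i \<omega>))" for i
    by (rule square_integrable_imp_integrable[OF _ sq]) simp
  have "integrable M (\<lambda>\<omega>. (\<Sum>i<n. f (W i \<omega>))\<^sup>2) \<and>
    (\<integral>\<omega>. (\<Sum>i<n. f (W i \<omega>))\<^sup>2 \<partial>M) = real n * (\<integral>\<omega>. (f (W 0 \<omega>))\<^sup>2 \<partial>M)"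
  proof (induction n)
    case (Suc n)
    have "indep_vars (\<lambda>_. borel) (\<lambda>i \<omega>. f (W i \<omega>)) UNIV"
      by (rule indep_vars_compose2[OF indep]) simp
    then have "indep_vars (\<lambda>_. borel) (\<lambda>i \<omega>. f (W i \<omega>)) (insert n {..<n})"
      by (rule indep_vars_subset) simp
    then have ind: "indep_var borel (\<lambda>\<omega>. f (W n \<omega>)) borel (\<lambda>\<omega>. \<Sum>i<n. f (W i \<omega>))"
      by (intro indep_vars_sum) auto
    have sumint: "integrable M (\<lambda>\<omega>. \<Sum>i<n. f (W i \<omega>))" using fint by simp
    have prodint: "integrable M (\<lambda>\<omega>. f (W n \<omega>) * (\<Sum>i<n. f (W i \<omega>)))"
      by (rule indep_var_integrable[OF ind fint sumint])
    have prod0: "(\<integral>\<omega>. f (W n \<omega>) * (\<Sum>i<n. f (W i \<omega>)) \<partial>M) = 0"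
      using expectation_W[OF f, of n] mean by (simp add: indep_var_lebesgue_integral[OF ind fint sumint])
    have eq: "(\<Sum>i<Suc n. f (W i \<omega>))\<^sup>2 = (\<Sum>i<n. f (W i \<omega>))\<^sup>2 + (f (W n \<omega>))\<^sup>2 + 2 * (f (W n \<omega>) * (\<Sum>i<n. f (W i \<omega>)))" for \<omega>
      by (simp add: power2_eq_square algebra_simps)
    have "integrable M (\<lambda>\<omega>. (\<Sum>i<n. f (W i \<omega>))\<^sup>2)" using Suc by simp
    with sq prodint show ?case
      unfolding eq by (simp add: prod0 E2[of n] Suc distrib_right)
  qed simp
  then show "integrable M (\<lambda>\<omega>. (\<Sum>i<n. f (W i \<omega>))\<^sup>2)"
    and "(\<integral>\<omega>. (\<Sum>i<n. f (W i \<omega>))\<^sup>2 \<partial>M) = real n * (\<integral>\<omega>. (f (W 0 \<omega>))\<^sup>2 \<partial>M)" by auto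
qed

text \<open>An inequality, because at \<open>n = 0\<close> the quotient is 0 by convention.\<close>

lemma second_moment_root_n:
  fixes f :: "'b \<Rightarrow> real"
  assumes "f \<in> borel_measurable N" "integrable M (\<lambda>\<omega>. (f (W 0 \<omega>))\<^sup>2)" "(\<integral>\<omega>. f (W 0 \<omega>) \<partial>M) = 0"
  shows "integrable M (\<lambda>\<omega>. ((\<Sum>i<n. f (W i \<omega>)) / sqrt (real n))\<^sup>2)"
    and "(\<integral>\<omega>. ((\<Sum>i<n. f (W i \<omega>)) / sqrt (real n))\<^sup>2 \<partial>M) \<le> (\<integral>\<omega>. (f (W 0 \<omega>))\<^sup>2 \<partial>M)"
  using second_moment_sum[OF assms, of n] by (auto simp: power_divide)

lemma weak_law_square_integrable:
  fixes f :: "'b \<Rightarrow> real"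
  assumes [measurable]: "f \<in> borel_measurable N" and int: "integrable M (\<lambda>\<omega>. (f (W 0 \<omega>))\<^sup>2)"
    and mean: "(\<integral>\<omega>. f (W 0 \<omega>) \<partial>M) = 0"
  shows "((\<lambda>w. (\<Sum>i<fst w. f (W i (snd w))) / real (fst w)) \<longlongrightarrow> 0) (in_prob M)"
proof -
  \<comment> \<open>The average is 1 / sqrt n times the root-n sum, whose second moments are
    bounded.\<close>
  have "((\<lambda>w. 1 / sqrt (real (fst w))) \<longlongrightarrow> 0) (in_prob M)"
    by (rule tendsto_in_prob_fst) real_asymp
  from tendsto_zero_bounded_second_moment[where X="\<lambda>n _. 1 / sqrt (real n)" and
      Y="\<lambda>n \<omega>. (\<Sum>i<n. f (W i \<omega>)) / sqrt (real n)", OF this _ second_moment_root_n[OF _ int mean]]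
  show ?thesis by (simp add: real_sqrt_mult[symmetric])
qed

text \<open>Khinchin's law by truncation. It is stated for first moments because it is applied to
  products such as r^2 Z Z', for which the fourth-moment conditions yield no more than
  integrability. The truncated part is bounded and falls under the square-integrable case; the tail
  is small in mean and is handled by Markov's inequality.\<close>

theorem weak_law_real:
  fixes f :: "'b \<Rightarrow> real"
  assumes [measurable]: "f \<in> borel_measurable N" and int: "integrable M (\<lambda>\<omega>. f (W 0 \<omega>))"
  shows "((\<lambda>w. (\<Sum>i<fst w. f (W i (snd w))) / real (fst w)) \<longlongrightarrow> (\<integral>\<omega>. f (W 0 \<omega>) \<partial>M)) (in_prob M)"
proof (rule tendstoI)
  fix e :: real assume e: "0 < e"
  define g where "g K w = (if \<bar>f w\<bar> \<le> real K then f w else 0)" for K w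
  define h where "h K w = f w - g K w" for K w
  have [measurable]: "g K \<in> borel_measurable N" "h K \<in> borel_measurable N" for K
    unfolding g_def[abs_def] h_def[abs_def] by measurable
  have gint: "integrable M (\<lambda>\<omega>. g K (W 0 \<omega>))" for K
    by (rule Bochner_Integration.integrable_bound[OF int]) (auto simp: g_def)
  have hint: "integrable M (\<lambda>\<omega>. h K (W 0 \<omega>))" for K
    unfolding h_def by (intro Bochner_Integration.integrable_diff int gint)
  have "(\<lambda>K. \<integral>\<omega>. \<bar>h K (W 0 \<omega>)\<bar> \<partial>M) \<longlonglongrightarrow> (\<integral>\<omega>. 0 \<partial>M)"
  proof (rule integral_dominated_convergence[where w="\<lambda>\<omega>. \<bar>f (W 0 \<omega>)\<bar>"])
    show "AE \<omega> in M. (\<lambda>K. \<bar>h K (W 0 \<omega>)\<bar>) \<longlonglongrightarrow> 0"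
    proof (intro AE_I2 tendsto_eventually)
      fix \<omega>
      obtain K0 :: nat where "\<bar>f (W 0 \<omega>)\<bar> \<le> real K0" using real_arch_simple by blast
      then show "\<forall>\<^sub>F K in sequentially. \<bar>h K (W 0 \<omega>)\<bar> = 0"
        by (auto simp: h_def g_def eventually_sequentially intro!: exI[of _ K0])
    qed
  qed (use int in \<open>auto simp: h_def g_def\<close>)
  then have hlim: "(\<lambda>K. \<integral>\<omega>. \<bar>h K (W 0 \<omega>)\<bar> \<partial>M) \<longlonglongrightarrow> 0" by simp
  show "\<forall>\<^sub>F w in in_prob M. dist ((\<Sum>i<fst w. f (W i (snd w))) / real (fst w)) (\<integral>\<omega>. f (W 0 \<omega>) \<partial>M) < e"
    unfolding eventually_in_prob
  proof (intro allI impI)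
    fix \<eta> :: real assume \<eta>: "0 < \<eta>"
    \<comment> \<open>The bound e/3 controls the error in the mean; \<eta> e / 6 divided by the
      Markov level e/3 leaves the probability \<eta> / 2. The last third of e is spent on the
      truncated average.\<close>
    from order_tendstoD(2)[OF hlim, of "min (e / 3) (\<eta> * e / 6)"] e \<eta>
    obtain K where K: "(\<integral>\<omega>. \<bar>h K (W 0 \<omega>)\<bar> \<partial>M) < min (e / 3) (\<eta> * e / 6)"
      by (auto simp: eventually_sequentially)
    define \<mu> where "\<mu> = (\<integral>\<omega>. g K (W 0 \<omega>) \<partial>M)"
    have "integrable M (\<lambda>\<omega>. (g K (W 0 \<omega>) - \<mu>)\<^sup>2)"
    proof (rule integrable_const_bound[where B="(real K + \<bar>\<mu>\<bar>)\<^sup>2"])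
      have "\<bar>g K (W 0 \<omega>) - \<mu>\<bar>\<^sup>2 \<le> (real K + \<bar>\<mu>\<bar>)\<^sup>2" for \<omega>
        by (intro power_mono) (auto simp: g_def)
      then show "AE \<omega> in M. norm ((g K (W 0 \<omega>) - \<mu>)\<^sup>2) \<le> (real K + \<bar>\<mu>\<bar>)\<^sup>2" by simp
    qed simp
    moreover have "(\<integral>\<omega>. g K (W 0 \<omega>) - \<mu> \<partial>M) = 0"
      using gint prob_space by (simp add: \<mu>_def)
    ultimately have "((\<lambda>w. (\<Sum>i<fst w. g K (W i (snd w)) - \<mu>) / real (fst w)) \<longlongrightarrow> 0) (in_prob M)"
      by (intro weak_law_square_integrable[where f="\<lambda>w. g K w - \<mu>"]) auto
    then have "\<forall>\<^sub>F w in in_prob M. dist ((\<Sum>i<fst w. g K (W i (snd w)) - \<mu>) / real (fst w)) 0 < e / 3"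
      by (rule tendstoD) (use e in simp)
    moreover have "0 < \<eta> / 2" using \<eta> by simp
    ultimately have "\<forall>\<^sub>F n in sequentially. \<exists>A\<in>sets M. measure M A < \<eta> / 2 \<and>
         (\<forall>\<omega>\<in>space M - A. dist ((\<Sum>i<fst (n, \<omega>). g K (W i (snd (n, \<omega>))) - \<mu>) / real (fst (n, \<omega>))) 0 < e / 3)"
      by (rule eventually_in_probE)
    from this eventually_gt_at_top[of 0]
    show "\<forall>\<^sub>F n in sequentially. \<exists>A\<in>sets M. measure M A < \<eta> \<and>
      (\<forall>\<omega>\<in>space M - A. dist ((\<Sum>i<fst (n, \<omega>). f (W i (snd (n, \<omega>)))) / real (fst (n, \<omega>))) (\<integral>\<omega>. f (W 0 \<omega>) \<partial>M) < e)"
    proof (rule eventually_elim2)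
      fix n :: nat
      assume n: "0 < n" and "\<exists>A\<in>sets M. measure M A < \<eta> / 2 \<and>
         (\<forall>\<omega>\<in>space M - A. dist ((\<Sum>i<fst (n, \<omega>). g K (W i (snd (n, \<omega>))) - \<mu>) / real (fst (n, \<omega>))) 0 < e / 3)"
      then obtain A where [measurable]: "A \<in> sets M" and A: "measure M A < \<eta> / 2"
        "\<And>\<omega>. \<omega> \<in> space M \<Longrightarrow> \<omega> \<notin> A \<Longrightarrow> \<bar>(\<Sum>i<n. g K (W i \<omega>) - \<mu>) / real n\<bar> < e / 3" by auto
      let ?H = "\<lambda>\<omega>. (\<Sum>i<n. \<bar>h K (W i \<omega>)\<bar>) / real n"
      let ?B = "{\<omega> \<in> space M. ?H \<omega> \<ge> e / 3}"
      have hi: "integrable M (\<lambda>\<omega>. \<bar>h K (W i \<omega>)\<bar>)" for i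
        using integrable_W[of "h K"] hint by auto
      have "(\<integral>\<omega>. ?H \<omega> \<partial>M) = (\<Sum>i<n. \<integral>\<omega>. \<bar>h K (W i \<omega>)\<bar> \<partial>M) / real n"
        using hi by simp
      also have "(\<Sum>i<n. \<integral>\<omega>. \<bar>h K (W i \<omega>)\<bar> \<partial>M) = (\<Sum>i<n. \<integral>\<omega>. \<bar>h K (W 0 \<omega>)\<bar> \<partial>M)"
        by (intro sum.cong refl expectation_W[of "\<lambda>w. \<bar>h K w\<bar>"]) simp
      also have "\<dots> / real n = (\<integral>\<omega>. \<bar>h K (W 0 \<omega>)\<bar> \<partial>M)" using n by simp
      finally have EH: "(\<integral>\<omega>. ?H \<omega> \<partial>M) = (\<integral>\<omega>. \<bar>h K (W 0 \<omega>)\<bar> \<partial>M)" .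
      have "measure M ?B \<le> (\<integral>\<omega>. ?H \<omega> \<partial>M) / (e / 3)"
        using e hi by (intro integral_Markov_inequality_measure[where A="{}"]) (auto intro!: sum_nonneg)
      also have "\<dots> < \<eta> / 2" using K e unfolding EH by (simp add: field_simps)
      finally have B: "measure M ?B < \<eta> / 2" .
      have "\<bar>(\<Sum>i<n. f (W i \<omega>)) / real n - (\<integral>\<omega>. f (W 0 \<omega>) \<partial>M)\<bar> < e" if \<omega>: "\<omega> \<in> space M - (A \<union> ?B)" for \<omega>
      proof -
        have "(\<integral>\<omega>. f (W 0 \<omega>) \<partial>M) = \<mu> + (\<integral>\<omega>. h K (W 0 \<omega>) \<partial>M)"
          using gint int by (simp add: \<mu>_def h_def)
        moreover have "\<bar>\<integral>\<omega>. h K (W 0 \<omega>) \<partial>M\<bar> < e / 3"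
          using K integral_abs_bound[of M "\<lambda>\<omega>. h K (W 0 \<omega>)"] by linarith
        moreover have "(\<Sum>i<n. f (W i \<omega>)) / real n - \<mu> = (\<Sum>i<n. g K (W i \<omega>) - \<mu>) / real n + (\<Sum>i<n. h K (W i \<omega>)) / real n"
          using n by (simp add: h_def sum_subtractf field_simps)
        moreover have "\<bar>(\<Sum>i<n. h K (W i \<omega>)) / real n\<bar> < e / 3"
        proof -
          have "\<bar>(\<Sum>i<n. h K (W i \<omega>)) / real n\<bar> \<le> ?H \<omega>"
            by (simp add: divide_right_mono)
          also have "\<dots> < e / 3" using \<omega> by force
          finally show ?thesis .
        qed
        moreover have "\<bar>(\<Sum>i<n. g K (W i \<omega>) - \<mu>) / real n\<bar> < e / 3" using A(2) \<omega> by auto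
        ultimately show ?thesis by linarith
      qed
      moreover have "measure M (A \<union> ?B) < \<eta>"
        using measure_Un_le[of A M ?B] A B by simp
      ultimately show "\<exists>A\<in>sets M. measure M A < \<eta> \<and>
      (\<forall>\<omega>\<in>space M - A. dist ((\<Sum>i<fst (n, \<omega>). f (W i (snd (n, \<omega>)))) / real (fst (n, \<omega>))) (\<integral>\<omega>. f (W 0 \<omega>) \<partial>M) < e)"
        by (intro bexI[of _ "A \<union> ?B"]) (auto simp: dist_real_def)
    qed
  qed
qed

theorem weak_law:
  fixes f :: "'b \<Rightarrow> 'c :: euclidean_space"
  assumes [measurable]: "f \<in> borel_measurable N" and int: "integrable M (\<lambda>\<omega>. f (W 0 \<omega>))"
  shows "((\<lambda>w. (\<Sum>i<fst w. f (W i (snd w))) /\<^sub>R real (fst w)) \<longlongrightarrow> (\<integral>\<omega>. f (W 0 \<omega>) \<partial>M)) (in_prob M)"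
proof (subst tendsto_componentwise_iff, rule ballI)
  fix b :: 'c
  have "((\<lambda>w. (\<Sum>i<fst w. f (W i (snd w)) \<bullet> b) / real (fst w)) \<longlongrightarrow> (\<integral>\<omega>. f (W 0 \<omega>) \<bullet> b \<partial>M)) (in_prob M)"
    using int by (intro weak_law_real[where f="\<lambda>w. f w \<bullet> b"]) auto
  then show "((\<lambda>w. ((\<Sum>i<fst w. f (W i (snd w))) /\<^sub>R real (fst w)) \<bullet> b) \<longlongrightarrow> (\<integral>\<omega>. f (W 0 \<omega>) \<partial>M) \<bullet> b) (in_prob M)"
    using int by (simp add: inner_sum_left divide_inverse mult.commute)
qed

text \<open>The central limit theorem needs a positive variance. If V = 0, the second moment of each
  partial sum is 0 and the sum vanishes almost surely. Characteristic functions express both cases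
  by one formula.\<close>

lemma char_root_n_sum:
  fixes f :: "'b \<Rightarrow> real"
  assumes [measurable]: "f \<in> borel_measurable N" and int: "integrable M (\<lambda>\<omega>. (f (W 0 \<omega>))\<^sup>2)"
    and mean: "(\<integral>\<omega>. f (W 0 \<omega>) \<partial>M) = 0" and V: "(\<integral>\<omega>. (f (W 0 \<omega>))\<^sup>2 \<partial>M) = V"
  shows "(\<lambda>n. char (distr M borel (\<lambda>\<omega>. (\<Sum>i<n. f (W i \<omega>)) / sqrt (real n))) t)
           \<longlonglongrightarrow> complex_of_real (exp (- (V * t\<^sup>2) / 2))"
proof (cases "V = 0")
  case True
  have "char (distr M borel (\<lambda>\<omega>. (\<Sum>i<n. f (W i \<omega>)) / sqrt (real n))) t = 1" for n
  proof -
    have "AE \<omega> in M. (\<Sum>i<n. f (W i \<omega>))\<^sup>2 = 0"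
      using second_moment_sum[OF _ int mean, of n] V True
      by (subst integral_nonneg_eq_0_iff_AE[symmetric]) auto
    then have "AE \<omega> in M. iexp (t * ((\<Sum>i<n. f (W i \<omega>)) / sqrt (real n))) = 1"
      by eventually_elim (simp del: of_real_sum)
    then have "(CLINT \<omega>|M. iexp (t * ((\<Sum>i<n. f (W i \<omega>)) / sqrt (real n)))) = (CLINT \<omega>|M. 1)"
      by (intro integral_cong_AE) auto
    then show ?thesis using prob_space by (simp add: char_def integral_distr)
  qed
  then show ?thesis using True by simp
next
  case False
  moreover have "0 \<le> V" unfolding V[symmetric] by simp
  ultimately have Vpos: "0 < V" by simp
  have "indep_vars (\<lambda>_. borel) (\<lambda>i \<omega>. f (W i \<omega>)) UNIV"
    by (rule indep_vars_compose2[OF indep]) simp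
  moreover have "distr M borel (\<lambda>\<omega>. f (W i \<omega>)) = distr (distr M N (W 0)) borel f" for i
    by (subst ident[symmetric, of i]) (simp add: distr_distr comp_def)
  moreover have "expectation (\<lambda>\<omega>. f (W i \<omega>)) = 0" for i
    using expectation_W[of f i] mean by simp
  moreover have "expectation (\<lambda>\<omega>. (f (W i \<omega>))\<^sup>2) = V" for i
    using expectation_W[of "\<lambda>w. (f w)\<^sup>2" i] V by simp
  moreover have "integrable M (\<lambda>\<omega>. (f (W i \<omega>))\<^sup>2)" for i
    using integrable_W[of "\<lambda>w. (f w)\<^sup>2"] int by simp
  ultimately have "weak_conv_m (\<lambda>n. distr M borel (\<lambda>\<omega>. (\<Sum>i<n. f (W i \<omega>) - 0) / sqrt (n * (sqrt V)\<^sup>2))) std_normal_distribution"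
    using Vpos
    by (intro central_limit_theorem[where X="\<lambda>i \<omega>. f (W i \<omega>)" and m=0 and \<sigma>="sqrt V" and \<mu>="distr (distr M N (W 0)) borel f"]) auto
  \<comment> \<open>Evaluation at \<open>sqrt V * t\<close> undoes the division by the standard
    deviation.\<close>
  then have "(\<lambda>n. char (distr M borel (\<lambda>\<omega>. (\<Sum>i<n. f (W i \<omega>) - 0) / sqrt (n * (sqrt V)\<^sup>2))) (sqrt V * t))
      \<longlonglongrightarrow> char std_normal_distribution (sqrt V * t)"
    by (intro levy_continuity1 real_dist_normal_dist) auto
  moreover have "char (distr M borel (\<lambda>\<omega>. (\<Sum>i<n. f (W i \<omega>) - 0) / sqrt (n * (sqrt V)\<^sup>2))) (sqrt V * t)
      = char (distr M borel (\<lambda>\<omega>. (\<Sum>i<n. f (W i \<omega>)) / sqrt (real n))) t" for n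
  proof -
    have "sqrt V * t * ((\<Sum>i<n. f (W i \<omega>) - 0) / sqrt (n * (sqrt V)\<^sup>2))
        = t * ((\<Sum>i<n. f (W i \<omega>)) / sqrt (real n))" for \<omega>
      using Vpos by (simp add: real_sqrt_mult)
    then show ?thesis by (simp only: char_def integral_distr) (subst (1 2) integral_distr; simp)
  qed
  ultimately have "(\<lambda>n. char (distr M borel (\<lambda>\<omega>. (\<Sum>i<n. f (W i \<omega>)) / sqrt (real n))) t)
      \<longlonglongrightarrow> char std_normal_distribution (sqrt V * t)"
    by (simp only:)
  then show ?thesis
    using Vpos by (simp add: char_std_normal_distribution power_mult_distrib)
qed

text \<open>Slutsky's lemma on top of the central limit theorem, through characteristic functions.\<close>

theorem asymptotic_varianceI:
  fixes f :: "'b \<Rightarrow> real"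
  assumes f [measurable]: "f \<in> borel_measurable N" and int: "integrable M (\<lambda>\<omega>. (f (W 0 \<omega>))\<^sup>2)"
    and mean: "(\<integral>\<omega>. f (W 0 \<omega>) \<partial>M) = 0" and V: "(\<integral>\<omega>. (f (W 0 \<omega>))\<^sup>2 \<partial>M) = V"
    and b [measurable]: "\<And>n. b n \<in> borel_measurable M"
    and D: "((\<lambda>w. sqrt (real (fst w)) * (b (fst w) (snd w) - \<beta>)
              - (\<Sum>i<fst w. f (W i (snd w))) / sqrt (real (fst w))) \<longlongrightarrow> 0) (in_prob M)"
  shows "asymptotic_variance M b \<beta> V"
proof -
  have V0: "0 \<le> V" unfolding V[symmetric] by simp
  have "weak_conv_m (\<lambda>n. distr M borel (\<lambda>\<omega>. sqrt (real n) * (b n \<omega> - \<beta>))) (normal_law V)"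
  proof (rule levy_continuity)
    fix t
    have "(\<lambda>n. char (distr M borel (\<lambda>\<omega>. (\<Sum>i<n. f (W i \<omega>)) / sqrt (real n)
         + (sqrt (real n) * (b n \<omega> - \<beta>) - (\<Sum>i<n. f (W i \<omega>)) / sqrt (real n)))) t) \<longlonglongrightarrow> char (normal_law V) t"
      unfolding char_normal_law[OF V0]
      by (rule char_plus_negligible[OF _ _ D char_root_n_sum[OF f int mean V]]) measurable
    then show "(\<lambda>n. char (distr M borel (\<lambda>\<omega>. sqrt (real n) * (b n \<omega> - \<beta>))) t) \<longlonglongrightarrow> char (normal_law V) t"
      by simp
  qed (use V0 in \<open>auto intro: real_distribution_normal_law\<close>)
  then show ?thesis unfolding asymptotic_variance_def using V0 b by blast
qed

end

subsection \<open>Matrices\<close>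

lemma matrix_inv_unique:
  fixes A B :: "real^'n^'n"
  assumes "A ** B = mat 1"
  shows "matrix_inv A = B"
proof -
  have BA: "B ** A = mat 1" using assms matrix_left_right_inverse by blast
  have "A ** matrix_inv A = mat 1 \<and> matrix_inv A ** A = mat 1"
    unfolding matrix_inv_def by (rule someI[of _ B]) (use assms BA in simp)
  then have "matrix_inv A = (B ** A) ** matrix_inv A" by (simp add: BA)
  also have "\<dots> = B" using \<open>A ** matrix_inv A = mat 1 \<and> _\<close> by (simp add: matrix_mul_assoc[symmetric])
  finally show ?thesis .
qed

lemma matrix_inv_cancel:
  fixes A :: "real^'n^'n"
  assumes "invertible A"
  shows "A ** matrix_inv A = mat 1" "matrix_inv A ** A = mat 1"
    "A *v (matrix_inv A *v x) = x" "matrix_inv A *v (A *v x) = x"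
proof -
  obtain B where "A ** B = mat 1" "B ** A = mat 1" using assms by (auto simp: invertible_def)
  then show "A ** matrix_inv A = mat 1" "matrix_inv A ** A = mat 1"
    using matrix_inv_unique by metis+
  then show "A *v (matrix_inv A *v x) = x" "matrix_inv A *v (A *v x) = x"
    by (auto simp: matrix_vector_mul_assoc)
qed

lemma scaleR_matrix_mult:
  fixes A :: "real^'n^'m"
  shows "(c *\<^sub>R A) ** B = c *\<^sub>R (A ** B)"
  by (rule scalar_matrix_assoc[symmetric])

lemma matrix_mult_scaleR:
  fixes A :: "real^'n^'m"
  shows "A ** (c *\<^sub>R B) = c *\<^sub>R (A ** B)"
  by (simp add: matrix_scalar_ac scaleR_matrix_mult)

lemma scaleR_matrix_vector_mult:
  fixes A :: "real^'n^'m"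
  shows "(c *\<^sub>R A) *v x = c *\<^sub>R (A *v x)"
  by (rule scaleR_matrix_vector_assoc[symmetric])

lemma matrix_add_rdistrib:
  fixes A :: "real^'n^'m"
  shows "(A + B) ** C = A ** C + B ** C"
  by (simp add: matrix_matrix_mult_def vec_eq_iff distrib_right sum.distrib)

lemma invertible_scaleR:
  fixes A :: "real^'n^'n"
  assumes "invertible A" "c \<noteq> 0"
  shows "invertible (c *\<^sub>R A)"
proof -
  have "(c *\<^sub>R A) ** ((1 / c) *\<^sub>R matrix_inv A) = mat 1"
    using assms by (simp add: scaleR_matrix_mult matrix_mult_scaleR matrix_inv_cancel)
  then show ?thesis unfolding invertible_right_inverse by blast
qed

lemma matrix_inv_scaleR:
  fixes A :: "real^'n^'n"
  assumes "invertible A" "c \<noteq> 0"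
  shows "matrix_inv (c *\<^sub>R A) = (1 / c) *\<^sub>R matrix_inv A"
  using assms
  by (intro matrix_inv_unique) (simp add: scaleR_matrix_mult matrix_mult_scaleR matrix_inv_cancel)

lemma inner_matrix_vector_symmetric:
  fixes A :: "real^'n^'n"
  assumes "transpose A = A"
  shows "(A *v x) \<bullet> y = x \<bullet> (A *v y)"
  using dot_lmul_matrix[of x A y] vector_transpose_matrix[of x A] assms by simp

lemma transpose_matrix_inv:
  fixes A :: "real^'n^'n"
  assumes "transpose A = A" "invertible A"
  shows "transpose (matrix_inv A) = matrix_inv A"
proof -
  have "A ** transpose (matrix_inv A) = transpose (matrix_inv A ** A)"
    using assms(1) by (simp add: matrix_transpose_mul)
  also have "\<dots> = mat 1" using assms(2) by (simp add: matrix_inv_cancel transpose_mat)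
  finally show ?thesis by (rule matrix_inv_unique[symmetric])
qed

text \<open>Bilinearity in finite dimension supplies both the limit rules and, through continuity,
  the measurability of matrix products.\<close>

lemma bounded_bilinear_matrix_vector_mult: "bounded_bilinear ((*v) :: real^'n^'m \<Rightarrow> _)"
  by (intro bilinear_conv_bounded_bilinear[THEN iffD1])
    (auto simp: bilinear_def linear_iff matrix_vector_mult_add_rdistrib matrix_vector_right_distrib
      scaleR_matrix_vector_mult matrix_vector_mult_scaleR)

lemma bounded_bilinear_matrix_matrix_mult:
  "bounded_bilinear ((**) :: real^'n^'m \<Rightarrow> real^'k^'n \<Rightarrow> real^'k^'m)"
  by (intro bilinear_conv_bounded_bilinear[THEN iffD1])
    (auto simp: bilinear_def linear_iff matrix_add_ldistrib matrix_add_rdistrib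
      scaleR_matrix_mult matrix_mult_scaleR)

lemmas tendsto_matrix_vector_mult [tendsto_intros] =
  bounded_bilinear.tendsto[OF bounded_bilinear_matrix_vector_mult]

lemmas tendsto_matrix_matrix_mult [tendsto_intros] =
  bounded_bilinear.tendsto[OF bounded_bilinear_matrix_matrix_mult]

lemma borel_measurable_matrix_vector_mult [measurable (raw)]:
  fixes A :: "'a \<Rightarrow> real^'n^'m"
  assumes "A \<in> borel_measurable M" "x \<in> borel_measurable M"
  shows "(\<lambda>w. A w *v x w) \<in> borel_measurable M"
  using assms
  by (rule borel_measurable_continuous_Pair[where H="(*v)"])
    (auto intro!: bounded_bilinear.continuous_on[OF bounded_bilinear_matrix_vector_mult] continuous_intros)

lemma borel_measurable_matrix_matrix_mult [measurable (raw)]: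
  fixes A :: "'a \<Rightarrow> real^'n^'m" and B :: "'a \<Rightarrow> real^'k^'n"
  assumes "A \<in> borel_measurable M" "B \<in> borel_measurable M"
  shows "(\<lambda>w. A w ** B w) \<in> borel_measurable M"
  using assms
  by (rule borel_measurable_continuous_Pair[where H="(**)"])
    (auto intro!: bounded_bilinear.continuous_on[OF bounded_bilinear_matrix_matrix_mult] continuous_intros)

lemma borel_measurable_vec_nth [measurable (raw)]:
  fixes f :: "'a \<Rightarrow> ('b :: euclidean_space)^'n"
  assumes "f \<in> borel_measurable M"
  shows "(\<lambda>w. f w $ i) \<in> borel_measurable M"
  by (rule borel_measurable_continuous_on[where f="\<lambda>v. v $ i", OF _ assms]) (intro continuous_intros)

lemma borel_measurable_vec_lambda [measurable (raw)]:
  fixes f :: "'a \<Rightarrow> 'n::finite \<Rightarrow> 'b :: euclidean_space"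
  assumes "\<And>i. (\<lambda>w. f w i) \<in> borel_measurable M"
  shows "(\<lambda>w. \<chi> i. f w i) \<in> borel_measurable M"
proof (subst borel_measurable_euclidean_space, rule ballI)
  fix b :: "'b^'n" assume "b \<in> Basis"
  then obtain i u where "b = axis i u" by (auto simp: Basis_vec_def)
  then show "(\<lambda>w. (\<chi> i. f w i) \<bullet> b) \<in> borel_measurable M"
    using assms by (simp add: inner_axis)
qed

section \<open>Continuity and measurability of determinant and inverse\<close>

lemma tendsto_det [tendsto_intros]:
  fixes A :: "'a \<Rightarrow> real^'n^'n"
  assumes "(A \<longlongrightarrow> L) F" shows "((\<lambda>w. det (A w)) \<longlongrightarrow> det L) F"
  unfolding det_def by (intro tendsto_sum tendsto_mult tendsto_const tendsto_prod tendsto_vec_nth assms)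

lemma borel_measurable_det [measurable (raw)]:
  fixes A :: "'a \<Rightarrow> real^'n^'n"
  assumes [measurable]: "A \<in> borel_measurable M" shows "(\<lambda>w. det (A w)) \<in> borel_measurable M"
  unfolding det_def by measurable

text \<open>Cramer's rule makes the inverse a quotient of polynomials in the entries, which yields
  its continuity at invertible matrices and its Borel measurability.\<close>

lemma matrix_inv_cramer:
  fixes A :: "real^'n^'n"
  assumes "det A \<noteq> 0"
  shows "matrix_inv A = (\<chi> k l. det (\<chi> i j. if j = k then axis l 1 $ i else A $ i $ j) / det A)"
proof (rule matrix_inv_unique)
  let ?B = "\<chi> k l. det (\<chi> i j. if j = k then axis l 1 $ i else A $ i $ j) / det A"
  have "A *v column l ?B = axis l 1" for l
    using cramer[OF assms, of "column l ?B" "axis l 1"] by (simp add: column_def)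
  then have "column l (A ** ?B) = column l (mat 1)" for l
    by (simp add: column_def matrix_matrix_mult_def matrix_vector_mult_def mat_def axis_def vec_eq_iff)
  then show "A ** ?B = mat 1" by (simp add: column_def vec_eq_iff)
qed

lemma tendsto_matrix_inv [tendsto_intros]:
  fixes A :: "'a \<Rightarrow> real^'n^'n"
  assumes A: "(A \<longlongrightarrow> L) F" and L: "invertible L"
  shows "((\<lambda>w. matrix_inv (A w)) \<longlongrightarrow> matrix_inv L) F"
proof -
  have L': "det L \<noteq> 0" using L by (simp add: invertible_det_nz)
  have "((\<lambda>w. \<chi> k l. det (\<chi> i j. if j = k then axis l 1 $ i else A w $ i $ j) / det (A w)) \<longlongrightarrow>
    (\<chi> k l. det (\<chi> i j. if j = k then axis l 1 $ i else L $ i $ j) / det L)) F"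
    by (intro tendsto_intros L' A) (auto intro!: tendsto_intros A)
  moreover have "\<forall>\<^sub>F w in F. (\<chi> k l. det (\<chi> i j. if j = k then axis l 1 $ i else A w $ i $ j) / det (A w))
      = matrix_inv (A w)"
    using tendsto_imp_eventually_ne[OF tendsto_det[OF A] L'] by eventually_elim (simp add: matrix_inv_cramer)
  ultimately show ?thesis
    unfolding matrix_inv_cramer[OF L'] by (rule Lim_transform_eventually)
qed

lemma eventually_invertible:
  fixes A :: "'a \<Rightarrow> real^'n^'n"
  assumes A: "(A \<longlongrightarrow> L) F" and L: "invertible L"
  shows "\<forall>\<^sub>F w in F. invertible (A w)"
  using tendsto_imp_eventually_ne[OF tendsto_det[OF A], of 0] L by (simp add: invertible_det_nz)

text \<open>On singular matrices \<^const>\<open>matrix_inv\<close> is one fixed arbitrary value.\<close>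

lemma borel_measurable_matrix_inv [measurable (raw)]:
  fixes A :: "'a \<Rightarrow> real^'n^'n"
  assumes [measurable]: "A \<in> borel_measurable M"
  shows "(\<lambda>w. matrix_inv (A w)) \<in> borel_measurable M"
proof -
  define c :: "real^'n^'n" where "c = (SOME _. False)"
  have "matrix_inv B = c" if "det B = 0" for B :: "real^'n^'n"
  proof -
    have "\<not> (B ** B' = mat 1 \<and> B' ** B = mat 1)" for B'
      using that invertible_det_nz[of B] by (auto simp: invertible_def)
    then have "(\<lambda>B'. B ** B' = mat 1 \<and> B' ** B = mat 1) = (\<lambda>_. False)" by blast
    then show ?thesis unfolding matrix_inv_def c_def by (rule arg_cong)
  qed
  then have "(\<lambda>w. matrix_inv (A w)) = (\<lambda>w. if det (A w) = 0 then c else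
      (\<chi> k l. det (\<chi> i j. if j = k then axis l 1 $ i else A w $ i $ j) / det (A w)))"
    using matrix_inv_cramer by fastforce
  also have "\<dots> \<in> borel_measurable M" by measurable
  finally show ?thesis .
qed

section \<open>Outer products and sums over the two classes of observations\<close>

lemma outer_mult_vector: "outer z *v w = (z \<bullet> w) *\<^sub>R z"
  by (simp add: outer_def matrix_vector_mult_def vec_eq_iff inner_vec_def sum_distrib_left
      sum_distrib_right mult_ac)

lemma transpose_outer: "transpose (outer z) = outer z"
  by (simp add: outer_def transpose_def vec_eq_iff mult.commute)

text \<open>The norm is the Frobenius norm, and row \<open>i\<close> of \<open>outer z\<close> is
  \<open>z\<close> scaled by its entry \<open>i\<close>. This turns matrix integrability into scalar
  conditions weighted by the squared norm of Z.\<close>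

lemma norm_outer: "norm (outer z) = (norm z)\<^sup>2"
proof -
  have "norm (outer z) = L2_set (\<lambda>i. norm (z $ i) * norm z) UNIV"
    unfolding norm_vec_def[of "outer z"]
    by (intro L2_set_cong refl) (simp add: outer_def norm_scaleR[symmetric] scaleR_vec_def del: norm_scaleR)
  also have "\<dots> = norm z * norm z"
    by (simp add: L2_set_left_distrib[symmetric] norm_vec_def[of z])
  finally show ?thesis by (simp add: power2_eq_square)
qed

lemma borel_measurable_outer [measurable (raw)]:
  assumes [measurable]: "f \<in> borel_measurable M"
  shows "(\<lambda>w. outer (f w)) \<in> borel_measurable M"
  unfolding outer_def by measurable

text \<open>The index set varies with the sample. With an indicator as weight the sum runs over a
  fixed range and becomes a sum of i.i.d. terms, to which the weak law applies.\<close>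

lemma sum_obs_complete:
  fixes f :: "nat \<Rightarrow> 'b :: real_vector"
  shows "(\<Sum>i\<in>obs_complete n miss. f i) = (\<Sum>i<n. of_bool (\<not> miss i) *\<^sub>R f i)"
  unfolding obs_complete_def by (rule sum.mono_neutral_cong_left) auto

lemma sum_obs_incomplete:
  fixes f :: "nat \<Rightarrow> 'b :: real_vector"
  shows "(\<Sum>i\<in>obs_incomplete n miss. f i) = (\<Sum>i<n. of_bool (miss i) *\<^sub>R f i)"
  unfolding obs_incomplete_def by (rule sum.mono_neutral_cong_left) auto

lemma transpose_sum: "transpose (\<Sum>i\<in>I. A i) = (\<Sum>i\<in>I. transpose (A i))"
  by (simp add: transpose_def vec_eq_iff)

lemma transpose_scaleR: "transpose (c *\<^sub>R A) = c *\<^sub>R transpose (A :: real^'n^'m)"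
  by (simp add: transpose_def vec_eq_iff)

lemma transpose_gram: "transpose (gram I Z) = gram I Z"
  by (simp add: gram_def transpose_sum transpose_outer)

lemma gram_mult_vector: "gram I Z *v w = cross I Z (\<lambda>i. Z i \<bullet> w)"
  by (induction I rule: infinite_finite_induct)
    (simp_all add: gram_def cross_def matrix_vector_mult_add_rdistrib outer_mult_vector)

lemma cross_add: "cross I Z (\<lambda>i. a i + b i) = cross I Z a + cross I Z b"
  by (simp add: cross_def scaleR_add_left sum.distrib)

lemma cross_cmult: "cross I Z (\<lambda>i. c * a i) = c *\<^sub>R cross I Z a"
  by (simp add: cross_def scaleR_sum_right)

subsection \<open>Algebra of the estimators in a fixed sample\<close>

text \<open>One realization of the sample together with the true parameters; exact identities are
  thereby kept apart from limits.\<close>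

locale imputed_sample =
  fixes n :: nat and y x :: "nat \<Rightarrow> real" and Z :: "nat \<Rightarrow> real^'l" and miss :: "nat \<Rightarrow> bool"
    and \<beta> :: real and \<pi> :: "real^'l"
begin

definition xp :: "nat \<Rightarrow> real" where "xp = impute \<pi> x Z miss"
definition r :: "nat \<Rightarrow> real" where "r i = y i - xp i * \<beta>"
definition s :: "nat \<Rightarrow> real" where "s i = of_bool (\<not> miss i) * (x i - Z i \<bullet> \<pi>)"

definition G :: "real^'l^'l" where "G = gram {..<n} Z /\<^sub>R real n"
definition A0 :: "real^'l^'l" where "A0 = gram (obs_complete n miss) Z /\<^sub>R real n"
definition A1 :: "real^'l^'l" where "A1 = gram (obs_incomplete n miss) Z /\<^sub>R real n"

definition \<delta> :: "real^'l" where "\<delta> = matrix_inv A0 *v (cross {..<n} Z s /\<^sub>R real n)"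
text \<open>On invertible samples this is Z'x/n for the regressor imputed with the estimate: only
  the incomplete rows contain \<delta>, hence the factor \<open>A1\<close>.\<close>

definition xz :: "real^'l" where "xz = cross {..<n} Z xp /\<^sub>R real n + A1 *v \<delta>"
definition D :: real where "D = xz \<bullet> (matrix_inv G *v xz)"

text \<open>The sum may run over all observations, because \<open>v_hat\<close> vanishes wherever x
  is imputed.\<close>

definition uv_hat :: "real^'l^'l"
  where "uv_hat = (\<Sum>i<n. (u_hat n y x Z miss i * v_hat n x Z miss i) *\<^sub>R outer (Z i)) /\<^sub>R real n"

definition uu_hat :: "real^'l^'l"
  where "uu_hat = (\<Sum>i<n. (u_hat n y x Z miss i * u_hat n y x Z miss i) *\<^sub>R outer (Z i)) /\<^sub>R real n"

definition vv_hat :: "real^'l^'l"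
  where "vv_hat = (\<Sum>i<n. (v_hat n x Z miss i * v_hat n x Z miss i) *\<^sub>R outer (Z i)) /\<^sub>R real n"

text \<open>The correction sum at the end of \<open>W_RI\<close>: two factors 1/n from the inverses
  and one factor n from \<open>B0\<close> turn it into an average of terms of fourth order in
  Z.\<close>

definition rem_hat :: "real^'l^'l"
  where "rem_hat = (\<Sum>i<n. of_bool (miss i) *\<^sub>R
    (outer (Z i) ** (matrix_inv A0 ** vv_hat ** matrix_inv A0) ** outer (Z i))) /\<^sub>R real n"

context
  assumes n: "0 < n" and G_inv: "invertible G" and A0_inv: "invertible A0"
begin

lemma gram_eq: "gram {..<n} Z = real n *\<^sub>R G" "gram (obs_complete n miss) Z = real n *\<^sub>R A0"
  "gram (obs_incomplete n miss) Z = real n *\<^sub>R A1"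
  using n by (simp_all add: G_def A0_def A1_def)

lemma matrix_inv_gram: "matrix_inv (gram {..<n} Z) = (1 / real n) *\<^sub>R matrix_inv G"
    "matrix_inv (gram (obs_complete n miss) Z) = (1 / real n) *\<^sub>R matrix_inv A0"
  using n G_inv A0_inv by (simp_all add: gram_eq matrix_inv_scaleR)

text \<open>On the complete observations x is the true fit plus \<open>s\<close>; least squares
  reproduces \<pi> from the fit and maps \<open>s\<close> to \<delta>.\<close>

lemma pi_CC_eq: "pi_CC n x Z miss = \<pi> + \<delta>"
proof -
  have "cross (obs_complete n miss) Z x = cross (obs_complete n miss) Z (\<lambda>i. Z i \<bullet> \<pi>)
      + cross (obs_complete n miss) Z (\<lambda>i. x i - Z i \<bullet> \<pi>)"
    by (simp add: cross_add[symmetric])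
  also have "cross (obs_complete n miss) Z (\<lambda>i. x i - Z i \<bullet> \<pi>) = cross {..<n} Z s"
    by (simp add: cross_def sum_obs_complete s_def)
  also have "cross (obs_complete n miss) Z (\<lambda>i. Z i \<bullet> \<pi>) = real n *\<^sub>R (A0 *v \<pi>)"
    by (simp add: gram_mult_vector[symmetric] gram_eq scaleR_matrix_vector_mult)
  finally show ?thesis
    using n A0_inv unfolding pi_CC_def matrix_inv_gram
    by (simp add: scaleR_matrix_vector_mult matrix_vector_right_distrib matrix_vector_mult_scaleR
        matrix_inv_cancel \<delta>_def scaleR_add_right divide_inverse)
qed

lemma x_RI_eq: "x_RI n x Z miss i = xp i + of_bool (miss i) * (Z i \<bullet> \<delta>)"
  by (simp add: x_RI_def xp_def pi_CC_eq impute_def inner_add_right)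

lemma cross_x_RI: "cross {..<n} Z (x_RI n x Z miss) = real n *\<^sub>R xz"
proof -
  have "cross {..<n} Z (x_RI n x Z miss)
      = cross {..<n} Z xp + cross (obs_incomplete n miss) Z (\<lambda>i. Z i \<bullet> \<delta>)"
    by (simp add: x_RI_eq[abs_def] cross_add cross_def[of "obs_incomplete n miss"] sum_obs_incomplete
        cross_def[of _ _ "\<lambda>i. of_bool (miss i) * (Z i \<bullet> \<delta>)"])
  then show ?thesis using n
    by (simp add: gram_mult_vector[symmetric] gram_eq scaleR_matrix_vector_mult xz_def scaleR_add_right)
qed

text \<open>The outcome is expanded around \<open>xz\<close>, the regressor actually used, and not
  around \<open>xp\<close>. Projection on \<open>xz\<close> then returns \<beta> exactly, and the
  inner bracket carries the whole estimation error.\<close>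

lemma cross_y: "cross {..<n} Z y
    = real n *\<^sub>R (\<beta> *\<^sub>R xz + (cross {..<n} Z r /\<^sub>R real n - \<beta> *\<^sub>R (A1 *v \<delta>)))"
proof -
  have "y = (\<lambda>i. \<beta> * xp i + r i)" by (simp add: r_def fun_eq_iff)
  then have "cross {..<n} Z y = cross {..<n} Z (\<lambda>i. \<beta> * xp i + r i)" by (rule arg_cong)
  also have "\<dots> = \<beta> *\<^sub>R cross {..<n} Z xp + cross {..<n} Z r"
    by (simp only: cross_add cross_cmult)
  finally have "cross {..<n} Z y = \<beta> *\<^sub>R cross {..<n} Z xp + cross {..<n} Z r" .
  then show ?thesis using n by (simp add: xz_def algebra_simps)
qed

lemma proj_form_eq:
  assumes "cross {..<n} Z a = real n *\<^sub>R a'" "cross {..<n} Z b = real n *\<^sub>R b'"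
  shows "proj_form n Z a b = real n * (a' \<bullet> (matrix_inv G *v b'))"
  using n by (simp add: proj_form_def assms matrix_inv_gram scaleR_matrix_vector_mult matrix_vector_mult_scaleR)

lemma beta_RI_eq:
  assumes "D \<noteq> 0"
  shows "beta_RI n y x Z miss - \<beta>
    = (xz \<bullet> (matrix_inv G *v (cross {..<n} Z r /\<^sub>R real n - \<beta> *\<^sub>R (A1 *v \<delta>)))) / D"
proof -
  have "beta_RI n y x Z miss = inverse (real n * D) * (real n * (xz \<bullet> (matrix_inv G *v
      (\<beta> *\<^sub>R xz + (cross {..<n} Z r /\<^sub>R real n - \<beta> *\<^sub>R (A1 *v \<delta>))))))"
    unfolding beta_RI_def Let_def
    by (simp only: proj_form_eq[OF cross_x_RI cross_x_RI] proj_form_eq[OF cross_x_RI cross_y] D_def)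
  also have "\<dots> = \<beta> + (xz \<bullet> (matrix_inv G *v (cross {..<n} Z r /\<^sub>R real n - \<beta> *\<^sub>R (A1 *v \<delta>)))) / D"
    using n assms
    by (simp only: matrix_vector_right_distrib matrix_vector_mult_scaleR inner_add_right inner_scaleR_right
        D_def[symmetric]) (simp add: field_simps)
  finally show ?thesis by simp
qed

lemma u_hat_eq: "u_hat n y x Z miss i - r i =
    - (xp i * (beta_RI n y x Z miss - \<beta>)) - of_bool (miss i) * (Z i \<bullet> \<delta>) * beta_RI n y x Z miss"
  by (simp add: u_hat_def r_def x_RI_eq algebra_simps)

lemma v_hat_eq: "v_hat n x Z miss i = of_bool (\<not> miss i) * (x i - Z i \<bullet> \<pi> - Z i \<bullet> \<delta>)"
  by (simp add: v_hat_def x_RI_eq pi_CC_eq xp_def impute_def inner_add_right)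

text \<open>Counting powers of n: \<open>A0i\<close> contributes 1/n, \<open>A1\<close> and
  \<open>B0\<close> contribute n each. The three main terms are thus n times normalized matrices,
  while the correction sum carries no factor n and is divided by n.\<close>

lemma W_RI_eq:
  assumes "b = beta_RI n y x Z miss"
  shows "W_RI n y x Z miss /\<^sub>R real n = uu_hat - (2 * b) *\<^sub>R (uv_hat ** matrix_inv A0 ** A1)
    + b\<^sup>2 *\<^sub>R (A1 ** matrix_inv A0 ** vv_hat ** matrix_inv A0 ** A1 - rem_hat /\<^sub>R real n)"
proof -
  have uv: "(\<Sum>i\<in>obs_complete n miss. (u_hat n y x Z miss i * v_hat n x Z miss i) *\<^sub>R outer (Z i)) = real n *\<^sub>R uv_hat"
    using n by (auto simp: sum_obs_complete uv_hat_def v_hat_eq intro!: sum.cong)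
  have vv: "(\<Sum>i\<in>obs_complete n miss. (v_hat n x Z miss i)\<^sup>2 *\<^sub>R outer (Z i)) = real n *\<^sub>R vv_hat"
    using n by (auto simp: sum_obs_complete vv_hat_def v_hat_eq power2_eq_square intro!: sum.cong)
  have uu: "(\<Sum>i<n. (u_hat n y x Z miss i)\<^sup>2 *\<^sub>R outer (Z i)) = real n *\<^sub>R uu_hat"
    using n by (simp add: uu_hat_def power2_eq_square)
  have rem: "(\<Sum>i\<in>obs_incomplete n miss. outer (Z i) ** ((1 / real n) *\<^sub>R matrix_inv A0) ** (real n *\<^sub>R vv_hat)
      ** ((1 / real n) *\<^sub>R matrix_inv A0) ** outer (Z i)) = rem_hat"
    using n by (simp add: sum_obs_incomplete rem_hat_def scaleR_matrix_mult matrix_mult_scaleR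
        matrix_mul_assoc scaleR_sum_right mult.commute divide_inverse)
  have c: "inverse (real n) * (d * real n) = d" for d using n by simp
  show ?thesis
    unfolding W_RI_def Let_def assms[symmetric] uv vv uu matrix_inv_gram rem
    unfolding gram_eq
    using n by (simp add: scaleR_matrix_mult matrix_mult_scaleR scaleR_add_right scaleR_diff_right c
        mult.commute[of "inverse (real n)" "b\<^sup>2"])
qed

text \<open>The remaining powers of n cancel, so the scaled estimator is a plug-in version of
  \<open>V_RI\<close> and its limit follows by continuity.\<close>

lemma V_RI_hat_eq: "real n * V_RI_hat n y x Z miss = V_RI xz G (W_RI n y x Z miss /\<^sub>R real n)"
  using n unfolding V_RI_hat_def V_RI_def Let_def proj_form_eq[OF cross_x_RI cross_x_RI] cross_x_RI matrix_inv_gram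
  by (simp add: scaleR_matrix_vector_mult matrix_vector_mult_scaleR field_simps)

lemma transpose_G: "transpose G = G" "transpose (matrix_inv G) = matrix_inv G"
  using G_inv by (simp_all add: G_def transpose_scaleR transpose_gram transpose_matrix_inv)

lemma transpose_A: "transpose A0 = A0" "transpose (matrix_inv A0) = matrix_inv A0" "transpose A1 = A1"
  using A0_inv by (simp_all add: A0_def A1_def transpose_scaleR transpose_gram transpose_matrix_inv)

text \<open>Symmetry moves all random matrices to the left factor of each inner product. This
  separates convergent coefficients from root-n sums whose summands are i.i.d.\<close>

lemma beta_RI_linear:
  assumes "D \<noteq> 0" and "a = (1 / D) *\<^sub>R (matrix_inv G *v xz)"
  shows "sqrt (real n) * (beta_RI n y x Z miss - \<beta>)
    = a \<bullet> (cross {..<n} Z r /\<^sub>R sqrt (real n))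
      - \<beta> * ((matrix_inv A0 *v (A1 *v a)) \<bullet> (cross {..<n} Z s /\<^sub>R sqrt (real n)))"
proof -
  let ?cr = "cross {..<n} Z r" and ?cs = "cross {..<n} Z s"
  have "beta_RI n y x Z miss - \<beta> = a \<bullet> (?cr /\<^sub>R real n) - \<beta> * (a \<bullet> (A1 *v \<delta>))"
    using inner_matrix_vector_symmetric[OF transpose_G(2)] assms
    by (simp add: beta_RI_eq inner_diff_right algebra_simps diff_divide_distrib)
  also have "a \<bullet> (A1 *v \<delta>) = (matrix_inv A0 *v (A1 *v a)) \<bullet> (?cs /\<^sub>R real n)"
    unfolding \<delta>_def
    by (simp only: inner_matrix_vector_symmetric[OF transpose_A(3), symmetric]
        inner_matrix_vector_symmetric[OF transpose_A(2), symmetric])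
  finally have "sqrt (real n) * (beta_RI n y x Z miss - \<beta>)
      = (sqrt (real n) / real n) * (a \<bullet> ?cr - \<beta> * ((matrix_inv A0 *v (A1 *v a)) \<bullet> ?cs))"
    by (simp add: right_diff_distrib divide_inverse mult_ac)
  also have "sqrt (real n) / real n = 1 / sqrt (real n)"
    using n by (simp add: field_simps)
  finally show ?thesis by (simp add: diff_divide_distrib divide_inverse mult_ac right_diff_distrib)
qed

end

end

subsection \<open>Measurability of the estimators\<close>

context
  fixes M :: "'a measure" and y x :: "nat \<Rightarrow> 'a \<Rightarrow> real" and Z :: "nat \<Rightarrow> 'a \<Rightarrow> real^'l"
    and miss :: "nat \<Rightarrow> 'a \<Rightarrow> bool"
  assumes y [measurable]: "\<And>i. y i \<in> borel_measurable M"
    and x [measurable]: "\<And>i. x i \<in> borel_measurable M"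
    and Z [measurable]: "\<And>i. Z i \<in> borel_measurable M"
    and miss [measurable]: "\<And>i. miss i \<in> measurable M (count_space UNIV)"
begin

lemma borel_measurable_gram [measurable]:
  "(\<lambda>\<omega>. gram {..<n} (\<lambda>i. Z i \<omega>)) \<in> borel_measurable M"
  "(\<lambda>\<omega>. gram (obs_complete n (\<lambda>i. miss i \<omega>)) (\<lambda>i. Z i \<omega>)) \<in> borel_measurable M"
  "(\<lambda>\<omega>. gram (obs_incomplete n (\<lambda>i. miss i \<omega>)) (\<lambda>i. Z i \<omega>)) \<in> borel_measurable M"
  unfolding gram_def sum_obs_complete sum_obs_incomplete by measurable

lemma borel_measurable_pi_CC [measurable]:
  "(\<lambda>\<omega>. pi_CC n (\<lambda>i. x i \<omega>) (\<lambda>i. Z i \<omega>) (\<lambda>i. miss i \<omega>)) \<in> borel_measurable M"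
  unfolding pi_CC_def cross_def sum_obs_complete by measurable

lemma borel_measurable_x_RI [measurable]:
  "(\<lambda>\<omega>. x_RI n (\<lambda>i. x i \<omega>) (\<lambda>i. Z i \<omega>) (\<lambda>i. miss i \<omega>) j) \<in> borel_measurable M"
  unfolding x_RI_def impute_def by measurable

lemma borel_measurable_beta_RI [measurable]:
  "(\<lambda>\<omega>. beta_RI n (\<lambda>i. y i \<omega>) (\<lambda>i. x i \<omega>) (\<lambda>i. Z i \<omega>) (\<lambda>i. miss i \<omega>)) \<in> borel_measurable M"
  unfolding beta_RI_def proj_form_def cross_def Let_def by measurable

lemma borel_measurable_W_RI [measurable]:
  "(\<lambda>\<omega>. W_RI n (\<lambda>i. y i \<omega>) (\<lambda>i. x i \<omega>) (\<lambda>i. Z i \<omega>) (\<lambda>i. miss i \<omega>)) \<in> borel_measurable M"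
  unfolding W_RI_def u_hat_def v_hat_def sum_obs_complete sum_obs_incomplete Let_def by measurable

lemma borel_measurable_V_RI_hat:
  "(\<lambda>\<omega>. V_RI_hat n (\<lambda>i. y i \<omega>) (\<lambda>i. x i \<omega>) (\<lambda>i. Z i \<omega>) (\<lambda>i. miss i \<omega>)) \<in> borel_measurable M"
  unfolding V_RI_hat_def proj_form_def cross_def Let_def by measurable

end

lemma tendsto_V_RI:
  assumes "(c \<longlongrightarrow> c') F" "(A \<longlongrightarrow> A') F" "(B \<longlongrightarrow> B') F"
    and "invertible A'" "c' \<bullet> (matrix_inv A' *v c') \<noteq> 0"
  shows "((\<lambda>w. V_RI (c w) (A w) (B w)) \<longlongrightarrow> V_RI c' A' B') F"
  unfolding V_RI_def Let_def
  by (intro tendsto_mult tendsto_inverse tendsto_inner tendsto_matrix_vector_mult tendsto_matrix_inv assms)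

subsection \<open>Averages of products of residuals\<close>

lemma abs_mult_le_sum_squares: "\<bar>a * b\<bar> \<le> a\<^sup>2 + b\<^sup>2" for a b :: real
proof -
  have "2 * (\<bar>a\<bar> * \<bar>b\<bar>) \<le> a\<^sup>2 + b\<^sup>2"
    using sum_squares_bound[of "\<bar>a\<bar>" "\<bar>b\<bar>"] by (simp add: mult.assoc)
  moreover have "0 \<le> \<bar>a\<bar> * \<bar>b\<bar>" by simp
  ultimately show ?thesis unfolding abs_mult by linarith
qed

context iid_sample
begin

text \<open>The argument \<open>t\<close> pairs a sample size with an outcome. It is a point of the
  space that carries \<open>in_prob M\<close>, so an average is a function with a limit along that
  filter.\<close>

definition avg :: "('b \<Rightarrow> 'c :: real_vector) \<Rightarrow> nat \<times> 'a \<Rightarrow> 'c" where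
  "avg f t = (\<Sum>i<fst t. f (W i (snd t))) /\<^sub>R real (fst t)"

definition root_sum :: "('b \<Rightarrow> 'c :: real_vector) \<Rightarrow> nat \<times> 'a \<Rightarrow> 'c" where
  "root_sum f t = (\<Sum>i<fst t. f (W i (snd t))) /\<^sub>R sqrt (real (fst t))"

lemma tendsto_avg:
  fixes f :: "'b \<Rightarrow> 'c :: euclidean_space"
  assumes "f \<in> borel_measurable N" "integrable M (\<lambda>\<omega>. f (W 0 \<omega>))"
  shows "(avg f \<longlongrightarrow> (\<integral>\<omega>. f (W 0 \<omega>) \<partial>M)) (in_prob M)"
  using weak_law[OF assms] by (simp add: avg_def[abs_def])

text \<open>In each coordinate a null coefficient meets a centred sum with bounded second
  moments.\<close>

lemma tendsto_inner_root_sum: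
  fixes f :: "'b \<Rightarrow> 'c :: euclidean_space"
  assumes a: "(a \<longlongrightarrow> 0) (in_prob M)"
    and [measurable]: "f \<in> borel_measurable N" and int: "integrable M (\<lambda>\<omega>. (norm (f (W 0 \<omega>)))\<^sup>2)"
    and mean: "(\<integral>\<omega>. f (W 0 \<omega>) \<partial>M) = 0"
  shows "((\<lambda>t. a t \<bullet> root_sum f t) \<longlongrightarrow> 0) (in_prob M)"
proof -
  have "((\<lambda>t. \<Sum>b\<in>Basis. (a t \<bullet> b) * (root_sum f t \<bullet> b)) \<longlongrightarrow> (\<Sum>b\<in>(Basis :: 'c set). 0)) (in_prob M)"
  proof (rule tendsto_sum)
    fix b :: 'c assume b: "b \<in> Basis"
    have le: "(f w \<bullet> b)\<^sup>2 \<le> (norm (f w))\<^sup>2" for w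
      using Basis_le_norm[OF b, of "f w"] by (metis abs_norm_cancel power2_le_iff_abs_le norm_ge_zero power2_abs)
    have sq: "integrable M (\<lambda>\<omega>. (f (W 0 \<omega>) \<bullet> b)\<^sup>2)"
      by (rule Bochner_Integration.integrable_bound[OF int]) (auto simp: le)
    have "integrable M (\<lambda>\<omega>. norm (f (W 0 \<omega>)))"
      by (rule square_integrable_imp_integrable[OF _ int]) simp
    then have "integrable M (\<lambda>\<omega>. f (W 0 \<omega>))" by (subst integrable_norm_iff[symmetric]) auto
    then have mean_b: "(\<integral>\<omega>. f (W 0 \<omega>) \<bullet> b \<partial>M) = 0" using mean by simp
    have "((\<lambda>t. a (fst t, snd t) \<bullet> b) \<longlongrightarrow> 0) (in_prob M)"
      using tendsto_inner[OF a tendsto_const[of b]] by simp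
    from tendsto_zero_bounded_second_moment[where X="\<lambda>n \<omega>. a (n, \<omega>) \<bullet> b" and
        Y="\<lambda>n \<omega>. (\<Sum>i<n. f (W i \<omega>) \<bullet> b) / sqrt (real n)", OF this _
        second_moment_root_n[of "\<lambda>w. f w \<bullet> b", OF _ sq mean_b]]
    show "((\<lambda>t. (a t \<bullet> b) * (root_sum f t \<bullet> b)) \<longlongrightarrow> 0) (in_prob M)"
      by (simp add: root_sum_def inner_sum_left divide_inverse mult.commute)
  qed
  then show ?thesis by (simp add: euclidean_inner[symmetric])
qed

text \<open>Here \<open>f\<close> and \<open>g\<close> are errors at the true parameters,
  \<open>a\<close> and \<open>b\<close> their estimates, and \<open>q\<close> is the weight Z Z'.
  The estimates need not be uniformly close over the observations. Their deviation is therefore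
  split into a null factor \<tau> common to all observations and an envelope \<open>h\<close> whose
  weighted averages converge.\<close>

lemma tendsto_avg_products:
  fixes f g h :: "'b \<Rightarrow> real" and q :: "'b \<Rightarrow> 'c :: euclidean_space"
  assumes [measurable]: "f \<in> borel_measurable N" "g \<in> borel_measurable N" "h \<in> borel_measurable N"
      "q \<in> borel_measurable N"
    and f2: "integrable M (\<lambda>\<omega>. (f (W 0 \<omega>))\<^sup>2 * norm (q (W 0 \<omega>)))"
    and g2: "integrable M (\<lambda>\<omega>. (g (W 0 \<omega>))\<^sup>2 * norm (q (W 0 \<omega>)))"
    and h2: "integrable M (\<lambda>\<omega>. (h (W 0 \<omega>))\<^sup>2 * norm (q (W 0 \<omega>)))"
    and h: "\<And>w. 0 \<le> h w" and \<tau>: "(\<tau> \<longlongrightarrow> 0) (in_prob M)"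
    and a: "\<forall>\<^sub>F t in in_prob M. \<forall>i<fst t. \<bar>a t i - f (W i (snd t))\<bar> \<le> \<tau> t * h (W i (snd t))"
    and b: "\<forall>\<^sub>F t in in_prob M. \<forall>i<fst t. \<bar>b t i - g (W i (snd t))\<bar> \<le> \<tau> t * h (W i (snd t))"
  shows "((\<lambda>t. (\<Sum>i<fst t. (a t i * b t i) *\<^sub>R q (W i (snd t))) /\<^sub>R real (fst t))
    \<longlongrightarrow> (\<integral>\<omega>. (f (W 0 \<omega>) * g (W 0 \<omega>)) *\<^sub>R q (W 0 \<omega>) \<partial>M)) (in_prob M)"
proof -
  have prod_int: "integrable M (\<lambda>\<omega>. (u (W 0 \<omega>) * v (W 0 \<omega>)) *\<^sub>R q (W 0 \<omega>))"
    if [measurable]: "u \<in> borel_measurable N" "v \<in> borel_measurable N"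
      and "integrable M (\<lambda>\<omega>. (u (W 0 \<omega>))\<^sup>2 * norm (q (W 0 \<omega>)))"
      and "integrable M (\<lambda>\<omega>. (v (W 0 \<omega>))\<^sup>2 * norm (q (W 0 \<omega>)))" for u v :: "'b \<Rightarrow> real"
  proof (rule Bochner_Integration.integrable_bound)
    show "integrable M (\<lambda>\<omega>. (u (W 0 \<omega>))\<^sup>2 * norm (q (W 0 \<omega>)) + (v (W 0 \<omega>))\<^sup>2 * norm (q (W 0 \<omega>)))"
      using that by (intro Bochner_Integration.integrable_add)
    have "\<bar>u w * v w\<bar> * norm (q w) \<le> ((u w)\<^sup>2 + (v w)\<^sup>2) * norm (q w)" for w
      by (intro mult_right_mono abs_mult_le_sum_squares) simp
    then show "AE \<omega> in M. norm ((u (W 0 \<omega>) * v (W 0 \<omega>)) *\<^sub>R q (W 0 \<omega>))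
        \<le> norm ((u (W 0 \<omega>))\<^sup>2 * norm (q (W 0 \<omega>)) + (v (W 0 \<omega>))\<^sup>2 * norm (q (W 0 \<omega>)))"
      by (intro AE_I2) (simp add: distrib_right)
  qed measurable
  define k where "k w = (\<bar>f w\<bar> + \<bar>g w\<bar>) * h w * norm (q w)" for w
  define l where "l w = (h w)\<^sup>2 * norm (q w)" for w
  have [measurable]: "k \<in> borel_measurable N" "l \<in> borel_measurable N"
    unfolding k_def[abs_def] l_def[abs_def] by measurable
  have k_int: "integrable M (\<lambda>\<omega>. k (W 0 \<omega>))"
    using integrable_norm[OF prod_int[of f h]] integrable_norm[OF prod_int[of g h]] f2 g2 h2 h
    by (simp add: k_def distrib_right abs_mult)
  have l_int: "integrable M (\<lambda>\<omega>. l (W 0 \<omega>))" using h2 by (simp add: l_def)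
  have pw: "norm ((a' * b') *\<^sub>R q w - (f w * g w) *\<^sub>R q w) \<le> T * k w + T\<^sup>2 * l w"
    if A: "\<bar>a' - f w\<bar> \<le> T * h w" and B: "\<bar>b' - g w\<bar> \<le> T * h w" for a' b' T w
  proof -
    \<comment> \<open>A product is expanded around both factors: the terms linear in
      \<open>T\<close> are collected in \<open>k\<close>, the quadratic one in
      \<open>l\<close>.\<close>
    have "a' * b' - f w * g w = (a' - f w) * g w + f w * (b' - g w) + (a' - f w) * (b' - g w)"
      by (simp add: algebra_simps)
    then have "\<bar>a' * b' - f w * g w\<bar> \<le> \<bar>a' - f w\<bar> * \<bar>g w\<bar> + \<bar>f w\<bar> * \<bar>b' - g w\<bar> + \<bar>a' - f w\<bar> * \<bar>b' - g w\<bar>"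
      unfolding abs_mult[symmetric] by linarith
    also have "\<dots> \<le> T * h w * \<bar>g w\<bar> + \<bar>f w\<bar> * (T * h w) + (T * h w) * (T * h w)"
      using A B by (intro add_mono mult_mono) auto
    finally have "\<bar>a' * b' - f w * g w\<bar> * norm (q w)
        \<le> (T * h w * \<bar>g w\<bar> + \<bar>f w\<bar> * (T * h w) + (T * h w) * (T * h w)) * norm (q w)"
      by (rule mult_right_mono) simp
    also have "\<dots> = T * k w + T\<^sup>2 * l w"
      by (simp add: k_def l_def power2_eq_square algebra_simps)
    finally show ?thesis by (metis norm_scaleR scaleR_diff_left)
  qed
  have lim0: "((\<lambda>t. \<tau> t * avg k t + (\<tau> t)\<^sup>2 * avg l t) \<longlongrightarrow>
      0 * (\<integral>\<omega>. k (W 0 \<omega>) \<partial>M) + 0\<^sup>2 * (\<integral>\<omega>. l (W 0 \<omega>) \<partial>M)) (in_prob M)"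
    by (intro tendsto_add tendsto_mult tendsto_power \<tau> tendsto_avg k_int l_int) measurable
  have "\<forall>\<^sub>F t in in_prob M. norm ((\<Sum>i<fst t. (a t i * b t i) *\<^sub>R q (W i (snd t))) /\<^sub>R real (fst t)
      - avg (\<lambda>w. (f w * g w) *\<^sub>R q w) t) \<le> \<tau> t * avg k t + (\<tau> t)\<^sup>2 * avg l t"
    using a b
  proof eventually_elim
    case (elim t)
    have "norm ((\<Sum>i<fst t. (a t i * b t i) *\<^sub>R q (W i (snd t))) - (\<Sum>i<fst t. (f (W i (snd t)) * g (W i (snd t))) *\<^sub>R q (W i (snd t))))
        \<le> (\<Sum>i<fst t. \<tau> t * k (W i (snd t)) + (\<tau> t)\<^sup>2 * l (W i (snd t)))"
      unfolding sum_subtractf[symmetric] using elim by (intro sum_norm_le pw) auto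
    then have "norm ((\<Sum>i<fst t. (a t i * b t i) *\<^sub>R q (W i (snd t))) - (\<Sum>i<fst t. (f (W i (snd t)) * g (W i (snd t))) *\<^sub>R q (W i (snd t)))) / real (fst t)
        \<le> (\<Sum>i<fst t. \<tau> t * k (W i (snd t)) + (\<tau> t)\<^sup>2 * l (W i (snd t))) / real (fst t)"
      by (rule divide_right_mono) simp
    also have "\<dots> = \<tau> t * avg k t + (\<tau> t)\<^sup>2 * avg l t"
      by (simp add: avg_def sum.distrib sum_distrib_left sum_distrib_right divide_inverse distrib_left mult_ac)
    finally show ?case
      unfolding avg_def[of "\<lambda>w. (f w * g w) *\<^sub>R q w"] scaleR_diff_right[symmetric] norm_scaleR
      by (simp add: divide_inverse mult.commute)
  qed
  from Lim_null_comparison[OF this] lim0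
  have "((\<lambda>t. (\<Sum>i<fst t. (a t i * b t i) *\<^sub>R q (W i (snd t))) /\<^sub>R real (fst t)
      - avg (\<lambda>w. (f w * g w) *\<^sub>R q w) t) \<longlongrightarrow> 0) (in_prob M)" by simp
  from tendsto_add[OF this tendsto_avg[OF _ prod_int[of f g]]] f2 g2 show ?thesis by simp
qed

end

lemma integrable_norm_from_square:
  fixes f :: "'a \<Rightarrow> 'b :: {banach, second_countable_topology}"
  assumes "finite_measure M" "f \<in> borel_measurable M" "integrable M (\<lambda>\<omega>. (norm (f \<omega>))\<^sup>2)"
  shows "integrable M f"
proof -
  interpret finite_measure M by fact
  have "integrable M (\<lambda>\<omega>. norm (f \<omega>))"
    by (rule square_integrable_imp_integrable) (use assms in measurable)
  then show ?thesis using integrable_norm_iff[OF assms(2)] by simp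
qed

text \<open>A bilinear form is a bounded linear function of its matrix and commutes with the
  integral. This converts moments of scalar scores into forms in moment matrices.\<close>

lemma integral_outer_form:
  fixes z :: "'a \<Rightarrow> real^'l"
  assumes "integrable M (\<lambda>\<omega>. f \<omega> *\<^sub>R outer (z \<omega>))"
  shows "integrable M (\<lambda>\<omega>. f \<omega> * (z \<omega> \<bullet> a) * (z \<omega> \<bullet> b))"
    and "(\<integral>\<omega>. f \<omega> * (z \<omega> \<bullet> a) * (z \<omega> \<bullet> b) \<partial>M) = a \<bullet> ((\<integral>\<omega>. f \<omega> *\<^sub>R outer (z \<omega>) \<partial>M) *v b)"
proof -
  have lin: "bounded_linear (\<lambda>A :: real^'l^'l. a \<bullet> (A *v b))"
    by (intro bounded_linear_compose[OF bounded_linear_inner_right]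
        bounded_bilinear.bounded_linear_left[OF bounded_bilinear_matrix_vector_mult])
  have eq: "a \<bullet> ((f \<omega> *\<^sub>R outer (z \<omega>)) *v b) = f \<omega> * (z \<omega> \<bullet> a) * (z \<omega> \<bullet> b)" for \<omega>
    by (simp add: scaleR_matrix_vector_mult outer_mult_vector inner_commute)
  show "integrable M (\<lambda>\<omega>. f \<omega> * (z \<omega> \<bullet> a) * (z \<omega> \<bullet> b))"
    using integrable_bounded_linear[OF lin assms] by (simp add: eq)
  show "(\<integral>\<omega>. f \<omega> * (z \<omega> \<bullet> a) * (z \<omega> \<bullet> b) \<partial>M) = a \<bullet> ((\<integral>\<omega>. f \<omega> *\<^sub>R outer (z \<omega>) \<partial>M) *v b)"
    using integral_bounded_linear[OF lin assms] by (simp add: eq)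
qed

lemma transpose_integral_outer:
  fixes z :: "'a \<Rightarrow> real^'l"
  assumes "integrable M (\<lambda>\<omega>. f \<omega> *\<^sub>R outer (z \<omega>))"
  shows "transpose (\<integral>\<omega>. f \<omega> *\<^sub>R outer (z \<omega>) \<partial>M) = (\<integral>\<omega>. f \<omega> *\<^sub>R outer (z \<omega>) \<partial>M)"
proof -
  have "bounded_linear (transpose :: real^'l^'l \<Rightarrow> _)"
    by (subst linear_conv_bounded_linear[symmetric])
      (auto simp: linear_iff transpose_def vec_eq_iff)
  from integral_bounded_linear[OF this assms] show ?thesis
    by (simp add: transpose_scaleR transpose_outer)
qed

subsection \<open>Asymptotics of the estimators\<close>

type_synonym 'l obs = "(real \<times> real \<times> (real^'l)) \<times> bool"

abbreviation (input) obs_y :: "'l obs \<Rightarrow> real" where "obs_y w \<equiv> fst (fst w)"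
abbreviation (input) obs_x :: "'l obs \<Rightarrow> real" where "obs_x w \<equiv> fst (snd (fst w))"
abbreviation (input) obs_Z :: "'l obs \<Rightarrow> real^'l" where "obs_Z w \<equiv> snd (snd (fst w))"

abbreviation (input) obs_space :: "'l::finite obs measure"
  where "obs_space \<equiv> borel \<Otimes>\<^sub>M count_space UNIV"

lemma measurable_obs [measurable]:
  "obs_y \<in> borel_measurable obs_space" "obs_x \<in> borel_measurable obs_space"
  "obs_Z \<in> borel_measurable obs_space" "snd \<in> measurable obs_space (count_space UNIV)"
proof -
  have *: "fst \<in> measurable (obs_space :: 'l::finite obs measure) borel" by (rule measurable_fst)
  show "obs_y \<in> borel_measurable (obs_space :: 'l::finite obs measure)"
    by (rule measurable_compose[OF *]) (auto intro!: borel_measurable_continuous_onI continuous_intros)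
  show "obs_x \<in> borel_measurable (obs_space :: 'l::finite obs measure)"
    by (rule measurable_compose[OF *]) (auto intro!: borel_measurable_continuous_onI continuous_intros)
  show "obs_Z \<in> borel_measurable (obs_space :: 'l::finite obs measure)"
    by (rule measurable_compose[OF *]) (auto intro!: borel_measurable_continuous_onI continuous_intros)
qed (rule measurable_snd)

text \<open>With \<open>u = y - x \<beta>\<close> and \<open>v = x - Z \<bullet> \<pi>\<close>, the error \<open>err_r\<close> is \<open>u + \<beta> v\<close> on the incomplete
  and \<open>u\<close> on the complete observations.\<close>

definition fit_x :: "real^'l \<Rightarrow> 'l obs \<Rightarrow> real"
  where "fit_x \<pi> w = (if snd w then obs_Z w \<bullet> \<pi> else obs_x w)"

definition err_r :: "real \<Rightarrow> real^'l \<Rightarrow> 'l obs \<Rightarrow> real"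
  where "err_r \<beta> \<pi> w = obs_y w - fit_x \<pi> w * \<beta>"

definition err_s :: "real^'l \<Rightarrow> 'l obs \<Rightarrow> real"
  where "err_s \<pi> w = of_bool (\<not> snd w) * (obs_x w - obs_Z w \<bullet> \<pi>)"

lemma measurable_obs_errors [measurable]:
  "fit_x \<pi> \<in> borel_measurable obs_space" "err_r \<beta> \<pi> \<in> borel_measurable obs_space"
  "err_s \<pi> \<in> borel_measurable obs_space"
  unfolding fit_x_def[abs_def] err_r_def[abs_def] err_s_def[abs_def] by measurable

locale iv_sample = iid_sample M obs_space W
  for M :: "'a measure" and W :: "nat \<Rightarrow> 'a \<Rightarrow> 'l::finite obs" +
  fixes \<beta> :: real and \<pi> :: "real^'l"
begin

abbreviation "E f \<equiv> (\<integral>\<omega>. f (W 0 \<omega>) \<partial>M)"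

abbreviation "r \<equiv> err_r \<beta> \<pi>"
abbreviation "s \<equiv> err_s \<pi>"

definition "Qx = E (\<lambda>w. fit_x \<pi> w *\<^sub>R obs_Z w)"
definition "Qz = E (\<lambda>w. outer (obs_Z w))"
text \<open>With the indicator inside the expectation the class probability is part of the matrix,
  so no division by p or 1 - p occurs until \<Omega> is compared with
  \<open>Omega_RI\<close>.\<close>

definition "P0 = E (\<lambda>w. of_bool (\<not> snd w) *\<^sub>R outer (obs_Z w))"
definition "P1 = E (\<lambda>w. of_bool (snd w) *\<^sub>R outer (obs_Z w))"
definition "Err = E (\<lambda>w. (r w * r w) *\<^sub>R outer (obs_Z w))"
definition "Ers = E (\<lambda>w. (r w * s w) *\<^sub>R outer (obs_Z w))"
definition "Ess = E (\<lambda>w. (s w * s w) *\<^sub>R outer (obs_Z w))"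

text \<open>The second-moment matrix of r Z - \<beta> P1 P0^-1 s Z has a cross term and its
  transpose; here twice one of them stands for both. The matrix need not be symmetric, but its
  quadratic form is the same, and only that form enters \<open>V_RI\<close>.\<close>

definition "\<Omega> = Err - (2 * \<beta>) *\<^sub>R (Ers ** matrix_inv P0 ** P1)
   + \<beta>\<^sup>2 *\<^sub>R (P1 ** matrix_inv P0 ** Ess ** matrix_inv P0 ** P1)"

abbreviation "yt t i \<equiv> obs_y (W i (snd t))"
abbreviation "xt t i \<equiv> obs_x (W i (snd t))"
abbreviation "Zt t i \<equiv> obs_Z (W i (snd t))"
abbreviation "mt t i \<equiv> snd (W i (snd t))"

definition "b t = beta_RI (fst t) (yt t) (xt t) (Zt t) (mt t)"

end

text \<open>The common ground of the two missingness mechanisms: conditions on \<open>r\<close> and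
  \<open>s\<close> free of conditional expectations, from which the asymptotics follow.\<close>

locale regular_iv_sample = iv_sample M W \<beta> \<pi>
  for M :: "'a measure" and W :: "nat \<Rightarrow> 'a \<Rightarrow> 'l::finite obs" and \<beta> :: real and \<pi> :: "real^'l" +
  assumes Z4: "integrable M (\<lambda>\<omega>. norm (obs_Z (W 0 \<omega>)) ^ 4)"
    and x2: "integrable M (\<lambda>\<omega>. (fit_x \<pi> (W 0 \<omega>))\<^sup>2 * (norm (obs_Z (W 0 \<omega>)))\<^sup>2)"
    and r2: "integrable M (\<lambda>\<omega>. (r (W 0 \<omega>))\<^sup>2 * (norm (obs_Z (W 0 \<omega>)))\<^sup>2)"
    and s2: "integrable M (\<lambda>\<omega>. (s (W 0 \<omega>))\<^sup>2 * (norm (obs_Z (W 0 \<omega>)))\<^sup>2)"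
    and r_mean: "E (\<lambda>w. r w *\<^sub>R obs_Z w) = 0"
    and s_mean: "E (\<lambda>w. s w *\<^sub>R obs_Z w) = 0"
    and Qx_nonzero: "Qx \<noteq> 0" and Qz_inv: "invertible Qz" and P0_inv: "invertible P0"
begin

sublocale S: imputed_sample "fst t" "yt t" "xt t" "Zt t" "mt t" \<beta> \<pi> for t .

lemma Z2: "integrable M (\<lambda>\<omega>. (norm (obs_Z (W 0 \<omega>)))\<^sup>2)"
  by (rule square_integrable_imp_integrable) (use Z4 in \<open>simp_all add: power_mult[symmetric]\<close>)

lemma outer_integrable: "integrable M (\<lambda>\<omega>. outer (obs_Z (W 0 \<omega>)))"
  by (rule Bochner_Integration.integrable_bound[OF Z2]) (simp_all add: norm_outer)

lemma weighted_outer_integrable: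
  "integrable M (\<lambda>\<omega>. of_bool (snd (W 0 \<omega>)) *\<^sub>R outer (obs_Z (W 0 \<omega>)))"
  "integrable M (\<lambda>\<omega>. of_bool (\<not> snd (W 0 \<omega>)) *\<^sub>R outer (obs_Z (W 0 \<omega>)))"
  by (auto intro!: Bochner_Integration.integrable_bound[OF outer_integrable])

lemma
  assumes [measurable]: "f \<in> borel_measurable obs_space"
    and "integrable M (\<lambda>\<omega>. (f (W 0 \<omega>))\<^sup>2 * (norm (obs_Z (W 0 \<omega>)))\<^sup>2)"
  shows scaled_Z_square_integrable: "integrable M (\<lambda>\<omega>. (norm (f (W 0 \<omega>) *\<^sub>R obs_Z (W 0 \<omega>)))\<^sup>2)"
    and scaled_Z_integrable: "integrable M (\<lambda>\<omega>. f (W 0 \<omega>) *\<^sub>R obs_Z (W 0 \<omega>))"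
proof -
  show *: "integrable M (\<lambda>\<omega>. (norm (f (W 0 \<omega>) *\<^sub>R obs_Z (W 0 \<omega>)))\<^sup>2)"
    using assms(2) by (simp add: power_mult_distrib)
  show "integrable M (\<lambda>\<omega>. f (W 0 \<omega>) *\<^sub>R obs_Z (W 0 \<omega>))"
    by (rule integrable_norm_from_square[OF finite_measure_axioms _ *]) measurable
qed

lemma scaled_outer_integrable:
  assumes [measurable]: "f \<in> borel_measurable obs_space" "g \<in> borel_measurable obs_space"
    and f: "integrable M (\<lambda>\<omega>. (f (W 0 \<omega>))\<^sup>2 * (norm (obs_Z (W 0 \<omega>)))\<^sup>2)"
    and g: "integrable M (\<lambda>\<omega>. (g (W 0 \<omega>))\<^sup>2 * (norm (obs_Z (W 0 \<omega>)))\<^sup>2)"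
  shows "integrable M (\<lambda>\<omega>. (f (W 0 \<omega>) * g (W 0 \<omega>)) *\<^sub>R outer (obs_Z (W 0 \<omega>)))"
proof (rule Bochner_Integration.integrable_bound[OF Bochner_Integration.integrable_add[OF f g]])
  have "\<bar>f w * g w\<bar> * (norm (obs_Z w))\<^sup>2 \<le> ((f w)\<^sup>2 + (g w)\<^sup>2) * (norm (obs_Z w))\<^sup>2" for w
    by (intro mult_right_mono abs_mult_le_sum_squares) simp
  then show "AE \<omega> in M. norm ((f (W 0 \<omega>) * g (W 0 \<omega>)) *\<^sub>R outer (obs_Z (W 0 \<omega>)))
      \<le> norm ((f (W 0 \<omega>))\<^sup>2 * (norm (obs_Z (W 0 \<omega>)))\<^sup>2 + (g (W 0 \<omega>))\<^sup>2 * (norm (obs_Z (W 0 \<omega>)))\<^sup>2)"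
    by (intro AE_I2) (simp add: norm_outer distrib_right)
qed measurable

lemma transpose_moments: "transpose Qz = Qz" "transpose P0 = P0" "transpose P1 = P1"
  using transpose_integral_outer[of M "\<lambda>_. 1" "\<lambda>\<omega>. obs_Z (W 0 \<omega>)"] outer_integrable
    transpose_integral_outer[OF weighted_outer_integrable(1)]
    transpose_integral_outer[OF weighted_outer_integrable(2)]
  by (simp_all add: Qz_def P0_def P1_def)

definition "D = Qx \<bullet> (matrix_inv Qz *v Qx)"

text \<open>Definiteness comes from \<open>Qz\<close> being a second-moment matrix. With w = Qz^-1
  Qx, a vanishing \<open>D\<close> says that Z \<bullet> w has second moment 0. Then Z \<bullet> w =
  0 almost surely, and Qx = Qz w = 0.\<close>

lemma D_nonzero: "D \<noteq> 0"
proof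
  assume "D = 0"
  define w where "w = matrix_inv Qz *v Qx"
  have Qw: "Qz *v w = Qx" using Qz_inv by (simp add: w_def matrix_inv_cancel)
  have sq: "integrable M (\<lambda>\<omega>. (obs_Z (W 0 \<omega>) \<bullet> w) * (obs_Z (W 0 \<omega>) \<bullet> w))"
    "(\<integral>\<omega>. (obs_Z (W 0 \<omega>) \<bullet> w) * (obs_Z (W 0 \<omega>) \<bullet> w) \<partial>M) = w \<bullet> (Qz *v w)"
    using integral_outer_form[of M "\<lambda>_. 1" "\<lambda>\<omega>. obs_Z (W 0 \<omega>)" w w] outer_integrable
    by (simp_all add: Qz_def)
  have "w \<bullet> (Qz *v w) = 0" using \<open>D = 0\<close> 
    unfolding Qw by (simp add: D_def w_def inner_commute)
  then have "AE \<omega> in M. obs_Z (W 0 \<omega>) \<bullet> w = 0"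
    using integral_nonneg_eq_0_iff_AE[OF sq(1)] sq(2) by simp
  then have "E (\<lambda>z. obs_Z z \<bullet> a * (obs_Z z \<bullet> w)) = 0" for a
    by (subst integral_eq_zero_AE) (auto elim: eventually_mono)
  then have "a \<bullet> Qx = 0" for a
    using integral_outer_form[of M "\<lambda>_. 1" "\<lambda>\<omega>. obs_Z (W 0 \<omega>)" a w] outer_integrable Qw
    by (simp add: Qz_def)
  from this[of Qx] Qx_nonzero show False by simp
qed

section \<open>Probability limits of the sample moments and consistency\<close>

lemma sample_moments:
  "S.G t = avg (\<lambda>w. outer (obs_Z w)) t"
  "S.A0 t = avg (\<lambda>w. of_bool (\<not> snd w) *\<^sub>R outer (obs_Z w)) t"
  "S.A1 t = avg (\<lambda>w. of_bool (snd w) *\<^sub>R outer (obs_Z w)) t"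
  by (simp_all add: S.G_def S.A0_def S.A1_def avg_def gram_def sum_obs_complete sum_obs_incomplete)

lemma sample_errors:
  "S.xp t i = fit_x \<pi> (W i (snd t))" "S.r t i = r (W i (snd t))" "S.s t i = s (W i (snd t))"
  by (simp_all add: S.xp_def S.r_def S.s_def fit_x_def err_r_def err_s_def impute_def)

lemma sample_cross:
  "cross {..<fst t} (Zt t) (S.xp t) /\<^sub>R real (fst t) = avg (\<lambda>w. fit_x \<pi> w *\<^sub>R obs_Z w) t"
  "cross {..<fst t} (Zt t) (S.r t) /\<^sub>R real (fst t) = avg (\<lambda>w. r w *\<^sub>R obs_Z w) t"
  "cross {..<fst t} (Zt t) (S.s t) /\<^sub>R real (fst t) = avg (\<lambda>w. s w *\<^sub>R obs_Z w) t"
  "cross {..<fst t} (Zt t) (S.r t) /\<^sub>R sqrt (real (fst t)) = root_sum (\<lambda>w. r w *\<^sub>R obs_Z w) t"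
  "cross {..<fst t} (Zt t) (S.s t) /\<^sub>R sqrt (real (fst t)) = root_sum (\<lambda>w. s w *\<^sub>R obs_Z w) t"
  by (simp_all add: cross_def avg_def root_sum_def sample_errors)

lemma tendsto_G: "(S.G \<longlongrightarrow> Qz) (in_prob M)"
  and tendsto_A0: "(S.A0 \<longlongrightarrow> P0) (in_prob M)"
  and tendsto_A1: "(S.A1 \<longlongrightarrow> P1) (in_prob M)"
  using outer_integrable weighted_outer_integrable
  by (auto simp: sample_moments[abs_def] Qz_def P0_def P1_def intro!: tendsto_avg)

lemma tendsto_r: "(avg (\<lambda>w. r w *\<^sub>R obs_Z w) \<longlongrightarrow> 0) (in_prob M)"
  using tendsto_avg[of "\<lambda>w. r w *\<^sub>R obs_Z w", OF _ scaled_Z_integrable[OF _ r2]] by (simp add: r_mean)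

lemma tendsto_s: "(avg (\<lambda>w. s w *\<^sub>R obs_Z w) \<longlongrightarrow> 0) (in_prob M)"
  using tendsto_avg[of "\<lambda>w. s w *\<^sub>R obs_Z w", OF _ scaled_Z_integrable[OF _ s2]] by (simp add: s_mean)

lemma tendsto_delta: "(S.\<delta> \<longlongrightarrow> 0) (in_prob M)"
proof -
  have "((\<lambda>t. matrix_inv (S.A0 t) *v avg (\<lambda>w. s w *\<^sub>R obs_Z w) t) \<longlongrightarrow> matrix_inv P0 *v 0) (in_prob M)"
    by (intro tendsto_matrix_vector_mult tendsto_matrix_inv tendsto_A0 P0_inv tendsto_s)
  then show ?thesis by (simp add: S.\<delta>_def[abs_def] sample_cross)
qed

lemma tendsto_xz: "(S.xz \<longlongrightarrow> Qx) (in_prob M)"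
proof -
  have "((\<lambda>t. avg (\<lambda>w. fit_x \<pi> w *\<^sub>R obs_Z w) t + S.A1 t *v S.\<delta> t) \<longlongrightarrow> Qx + P1 *v 0) (in_prob M)"
    unfolding Qx_def
    by (intro tendsto_add tendsto_matrix_vector_mult tendsto_A1 tendsto_delta tendsto_avg
        scaled_Z_integrable x2) measurable
  then show ?thesis by (simp add: S.xz_def[abs_def] sample_cross)
qed

lemma tendsto_D: "(S.D \<longlongrightarrow> D) (in_prob M)"
  unfolding S.D_def[abs_def] D_def
  by (intro tendsto_inner tendsto_matrix_vector_mult tendsto_matrix_inv tendsto_G Qz_inv tendsto_xz)

text \<open>The event on which the sample inverses are genuine, so that the exact identities
  hold.\<close>

definition regular :: "nat \<times> 'a \<Rightarrow> bool" where
  "regular t \<longleftrightarrow> 0 < fst t \<and> invertible (S.G t) \<and> invertible (S.A0 t) \<and> S.D t \<noteq> 0"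

lemma eventually_regular: "eventually regular (in_prob M)"
proof -
  have "\<forall>\<^sub>F t in in_prob M. 0 < fst t"
    by (rule eventually_in_prob_fst) (rule eventually_gt_at_top)
  with eventually_invertible[OF tendsto_G Qz_inv] eventually_invertible[OF tendsto_A0 P0_inv]
    tendsto_imp_eventually_ne[OF tendsto_D D_nonzero]
  show ?thesis unfolding regular_def by eventually_elim blast
qed

text \<open>The exact error formula is continuous in averages that tend to zero. Consistency is also
  an input to the rate at which the residuals approach the errors.\<close>

lemma tendsto_b: "(b \<longlongrightarrow> \<beta>) (in_prob M)"
proof -
  have "((\<lambda>t. (S.xz t \<bullet> (matrix_inv (S.G t) *v (avg (\<lambda>w. r w *\<^sub>R obs_Z w) t - \<beta> *\<^sub>R (S.A1 t *v S.\<delta> t)))) / S.D t)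
     \<longlongrightarrow> (Qx \<bullet> (matrix_inv Qz *v (0 - \<beta> *\<^sub>R (P1 *v 0)))) / D) (in_prob M)"
    by (intro tendsto_divide tendsto_inner tendsto_matrix_vector_mult tendsto_matrix_inv tendsto_diff
        tendsto_scaleR tendsto_const tendsto_G Qz_inv tendsto_xz tendsto_r tendsto_A1 tendsto_delta
        tendsto_D D_nonzero)
  then have lim: "((\<lambda>t. (S.xz t \<bullet> (matrix_inv (S.G t) *v (avg (\<lambda>w. r w *\<^sub>R obs_Z w) t - \<beta> *\<^sub>R (S.A1 t *v S.\<delta> t)))) / S.D t)
     \<longlongrightarrow> 0) (in_prob M)" by simp
  have "((\<lambda>t. b t - \<beta>) \<longlongrightarrow> 0) (in_prob M)"
  proof (rule Lim_transform_eventually[OF lim])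
    show "\<forall>\<^sub>F t in in_prob M. (S.xz t \<bullet> (matrix_inv (S.G t) *v (avg (\<lambda>w. r w *\<^sub>R obs_Z w) t
        - \<beta> *\<^sub>R (S.A1 t *v S.\<delta> t)))) / S.D t = b t - \<beta>"
      using eventually_regular
      by eventually_elim (simp add: regular_def b_def S.beta_RI_eq sample_cross[symmetric])
  qed
  then show ?thesis by (simp add: LIM_zero_iff)
qed

section \<open>Influence function and limiting variance\<close>

definition "infl = (1 / D) *\<^sub>R (matrix_inv Qz *v Qx)"
definition "infl0 = matrix_inv P0 *v (P1 *v infl)"

text \<open>The influence function of the estimator. Its second term is the price of the estimated
  first stage: an error committed on the incomplete observations is expressed by
  \<open>infl0\<close> through the complete ones.\<close>

definition score :: "'l obs \<Rightarrow> real"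
  where "score w = r w * (obs_Z w \<bullet> infl) - \<beta> * (s w * (obs_Z w \<bullet> infl0))"

lemma measurable_score [measurable]: "score \<in> borel_measurable obs_space"
  unfolding score_def[abs_def] by measurable

lemma score_mean: "E score = 0"
proof -
  have "E (\<lambda>w. r w * (obs_Z w \<bullet> infl)) = 0" "integrable M (\<lambda>\<omega>. r (W 0 \<omega>) * (obs_Z (W 0 \<omega>) \<bullet> infl))"
    using integral_inner_left[OF scaled_Z_integrable[OF _ r2], of infl]
      integrable_inner_left[OF scaled_Z_integrable[OF _ r2], of infl] r_mean by simp_all
  moreover have "E (\<lambda>w. s w * (obs_Z w \<bullet> infl0)) = 0" "integrable M (\<lambda>\<omega>. s (W 0 \<omega>) * (obs_Z (W 0 \<omega>) \<bullet> infl0))"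
    using integral_inner_left[OF scaled_Z_integrable[OF _ s2], of infl0]
      integrable_inner_left[OF scaled_Z_integrable[OF _ s2], of infl0] s_mean by simp_all
  ultimately show ?thesis by (simp add: score_def)
qed

text \<open>Symmetry of \<open>P1\<close> and of the inverses of \<open>Qz\<close> and
  \<open>P0\<close> lets the outer factors act on \<open>infl\<close>; the sandwich becomes three
  scalar terms that match the expanded square of the score.\<close>

lemma V_RI_eq: "V_RI Qx Qz \<Omega> = infl \<bullet> (Err *v infl) - 2 * \<beta> * (infl \<bullet> (Ers *v infl0))
    + \<beta>\<^sup>2 * (infl0 \<bullet> (Ess *v infl0))"
proof -
  have sym: "transpose (matrix_inv Qz) = matrix_inv Qz" "transpose (matrix_inv P0) = matrix_inv P0"
    using transpose_matrix_inv transpose_moments Qz_inv P0_inv by blast+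
  have "V_RI Qx Qz \<Omega> = infl \<bullet> (\<Omega> *v infl)"
    unfolding V_RI_def Let_def D_def[symmetric] infl_def
    by (simp add: matrix_vector_mult_scaleR divide_inverse inner_matrix_vector_symmetric[OF sym(1), symmetric])
  also have "\<Omega> *v infl = Err *v infl - (2 * \<beta>) *\<^sub>R (Ers *v infl0)
      + \<beta>\<^sup>2 *\<^sub>R (P1 *v (matrix_inv P0 *v (Ess *v infl0)))"
    by (simp add: \<Omega>_def infl0_def matrix_vector_mult_add_rdistrib matrix_vector_mult_diff_rdistrib
        scaleR_matrix_vector_mult matrix_vector_mul_assoc matrix_mul_assoc)
  also have "infl \<bullet> \<dots> = infl \<bullet> (Err *v infl) - 2 * \<beta> * (infl \<bullet> (Ers *v infl0))
      + \<beta>\<^sup>2 * (infl \<bullet> (P1 *v (matrix_inv P0 *v (Ess *v infl0))))"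
    by (simp add: inner_add_right inner_diff_right)
  also have "infl \<bullet> (P1 *v (matrix_inv P0 *v (Ess *v infl0))) = infl0 \<bullet> (Ess *v infl0)"
    unfolding inner_matrix_vector_symmetric[OF transpose_moments(3), symmetric]
      inner_matrix_vector_symmetric[OF sym(2), symmetric] infl0_def[symmetric] by simp
  finally show ?thesis .
qed

lemma score_variance:
  "integrable M (\<lambda>\<omega>. (score (W 0 \<omega>))\<^sup>2)" "E (\<lambda>w. (score w)\<^sup>2) = V_RI Qx Qz \<Omega>"
proof -
  note rr = integral_outer_form[OF scaled_outer_integrable[of r r, OF _ _ r2 r2], of infl infl]
  note rs = integral_outer_form[OF scaled_outer_integrable[of r s, OF _ _ r2 s2], of infl infl0]
  note ss = integral_outer_form[OF scaled_outer_integrable[of s s, OF _ _ s2 s2], of infl0 infl0]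
  have eq: "(score w)\<^sup>2 = r w * r w * (obs_Z w \<bullet> infl) * (obs_Z w \<bullet> infl)
      - 2 * \<beta> * (r w * s w * (obs_Z w \<bullet> infl) * (obs_Z w \<bullet> infl0))
      + \<beta>\<^sup>2 * (s w * s w * (obs_Z w \<bullet> infl0) * (obs_Z w \<bullet> infl0))" for w
    by (simp add: score_def power2_eq_square algebra_simps)
  have i: "integrable M (\<lambda>\<omega>. r (W 0 \<omega>) * r (W 0 \<omega>) * (obs_Z (W 0 \<omega>) \<bullet> infl) * (obs_Z (W 0 \<omega>) \<bullet> infl))"
    "integrable M (\<lambda>\<omega>. 2 * \<beta> * (r (W 0 \<omega>) * s (W 0 \<omega>) * (obs_Z (W 0 \<omega>) \<bullet> infl) * (obs_Z (W 0 \<omega>) \<bullet> infl0)))"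
    "integrable M (\<lambda>\<omega>. \<beta>\<^sup>2 * (s (W 0 \<omega>) * s (W 0 \<omega>) * (obs_Z (W 0 \<omega>) \<bullet> infl0) * (obs_Z (W 0 \<omega>) \<bullet> infl0)))"
    using rr(1) rs(1) ss(1) by (auto intro!: integrable_mult_right)
  show "integrable M (\<lambda>\<omega>. (score (W 0 \<omega>))\<^sup>2)"
    unfolding eq by (intro Bochner_Integration.integrable_add Bochner_Integration.integrable_diff i)
  have "E (\<lambda>w. (score w)\<^sup>2) = infl \<bullet> (Err *v infl) - 2 * \<beta> * (infl \<bullet> (Ers *v infl0))
    + \<beta>\<^sup>2 * (infl0 \<bullet> (Ess *v infl0))"
    unfolding eq
    by (simp only: Bochner_Integration.integral_add[OF Bochner_Integration.integrable_diff[OF i(1,2)] i(3)]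
        Bochner_Integration.integral_diff[OF i(1,2)] integral_mult_right_zero)
      (use rr(2) rs(2) ss(2) in \<open>simp add: Err_def Ers_def Ess_def\<close>)
  then show "E (\<lambda>w. (score w)\<^sup>2) = V_RI Qx Qz \<Omega>" by (simp add: V_RI_eq)
qed

lemma asymptotically_linear:
  "((\<lambda>t. sqrt (real (fst t)) * (b t - \<beta>) - root_sum score t) \<longlongrightarrow> 0) (in_prob M)"
proof -
  define a where "a t = (1 / S.D t) *\<^sub>R (matrix_inv (S.G t) *v S.xz t)" for t
  define a0 where "a0 t = matrix_inv (S.A0 t) *v (S.A1 t *v a t)" for t
  have a: "(a \<longlongrightarrow> infl) (in_prob M)"
    unfolding a_def[abs_def] infl_def
    by (intro tendsto_scaleR tendsto_divide tendsto_const tendsto_matrix_vector_mult tendsto_matrix_inv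
        tendsto_G Qz_inv tendsto_xz tendsto_D D_nonzero)
  have a0: "(a0 \<longlongrightarrow> infl0) (in_prob M)"
    unfolding a0_def[abs_def] infl0_def
    by (intro tendsto_matrix_vector_mult tendsto_matrix_inv tendsto_A0 P0_inv tendsto_A1 a)
  have "((\<lambda>t. (a t - infl) \<bullet> root_sum (\<lambda>w. r w *\<^sub>R obs_Z w) t
      - \<beta> * ((a0 t - infl0) \<bullet> root_sum (\<lambda>w. s w *\<^sub>R obs_Z w) t)) \<longlongrightarrow> 0 - \<beta> * 0) (in_prob M)"
    using a a0 r_mean s_mean
    by (intro tendsto_diff tendsto_mult tendsto_const tendsto_inner_root_sum scaled_Z_square_integrable r2 s2)
      (simp_all add: LIM_zero)
  then have lim: "((\<lambda>t. (a t - infl) \<bullet> root_sum (\<lambda>w. r w *\<^sub>R obs_Z w) t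
      - \<beta> * ((a0 t - infl0) \<bullet> root_sum (\<lambda>w. s w *\<^sub>R obs_Z w) t)) \<longlongrightarrow> 0) (in_prob M)" by simp
  have score: "root_sum score t = infl \<bullet> root_sum (\<lambda>w. r w *\<^sub>R obs_Z w) t
      - \<beta> * (infl0 \<bullet> root_sum (\<lambda>w. s w *\<^sub>R obs_Z w) t)" for t
    by (simp add: root_sum_def score_def[abs_def] inner_sum_right sum_subtractf sum_distrib_left
        right_diff_distrib inner_commute mult_ac)
  show ?thesis
  proof (rule Lim_transform_eventually[OF lim])
    show "\<forall>\<^sub>F t in in_prob M. (a t - infl) \<bullet> root_sum (\<lambda>w. r w *\<^sub>R obs_Z w) t
      - \<beta> * ((a0 t - infl0) \<bullet> root_sum (\<lambda>w. s w *\<^sub>R obs_Z w) t)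
      = sqrt (real (fst t)) * (b t - \<beta>) - root_sum score t"
      using eventually_regular
    proof eventually_elim
      case (elim t)
      have "sqrt (real (fst t)) * (b t - \<beta>) = a t \<bullet> root_sum (\<lambda>w. r w *\<^sub>R obs_Z w) t
        - \<beta> * (a0 t \<bullet> root_sum (\<lambda>w. s w *\<^sub>R obs_Z w) t)"
        unfolding b_def a0_def sample_cross[symmetric]
        by (rule S.beta_RI_linear) (use elim in \<open>simp_all add: regular_def a_def\<close>)
      then show ?case by (simp add: score inner_diff_left right_diff_distrib)
    qed
  qed
qed

section \<open>Residuals, their moments and the variance estimator\<close>

definition "rate t = \<bar>b t - \<beta>\<bar> + norm (S.\<delta> t) * (1 + \<bar>b t\<bar>)"

lemma tendsto_rate: "(rate \<longlongrightarrow> 0) (in_prob M)"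
proof -
  have "((\<lambda>t. \<bar>b t - \<beta>\<bar> + norm (S.\<delta> t) * (1 + \<bar>b t\<bar>))
      \<longlongrightarrow> \<bar>\<beta> - \<beta>\<bar> + norm (0 :: real^'l) * (1 + \<bar>\<beta>\<bar>)) (in_prob M)"
    by (intro tendsto_add tendsto_mult tendsto_rabs tendsto_diff tendsto_norm tendsto_const tendsto_b tendsto_delta)
  then show ?thesis by (simp add: rate_def[abs_def])
qed

text \<open>One product of \<open>rate\<close> and \<open>envelope\<close> has to bound the errors
  of both residuals. The error in \<open>b\<close> multiplies the fitted regressor, and \<delta>
  multiplies Z. In the factor 1 + |b| of \<open>rate\<close>, the 1 serves the first-stage residual
  and |b| the imputed part of the second-stage residual.\<close>

definition envelope :: "'l obs \<Rightarrow> real" where "envelope w = \<bar>fit_x \<pi> w\<bar> + norm (obs_Z w)"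

lemma measurable_envelope [measurable]: "envelope \<in> borel_measurable obs_space"
  unfolding envelope_def[abs_def] by measurable

lemma envelope_integrable:
  "integrable M (\<lambda>\<omega>. (envelope (W 0 \<omega>))\<^sup>2 * (norm (obs_Z (W 0 \<omega>)))\<^sup>2)"
proof (rule Bochner_Integration.integrable_bound)
  show "integrable M (\<lambda>\<omega>. 2 * ((fit_x \<pi> (W 0 \<omega>))\<^sup>2 * (norm (obs_Z (W 0 \<omega>)))\<^sup>2) + 2 * norm (obs_Z (W 0 \<omega>)) ^ 4)"
    using x2 Z4 by simp
  have "(envelope w)\<^sup>2 * (norm (obs_Z w))\<^sup>2 \<le> 2 * ((fit_x \<pi> w)\<^sup>2 * (norm (obs_Z w))\<^sup>2) + 2 * norm (obs_Z w) ^ 4" for w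
  proof -
    have "(envelope w)\<^sup>2 \<le> 2 * (fit_x \<pi> w)\<^sup>2 + 2 * (norm (obs_Z w))\<^sup>2"
      using sum_squares_bound[of "\<bar>fit_x \<pi> w\<bar>" "norm (obs_Z w)"] by (simp add: envelope_def power2_sum)
    then have "(envelope w)\<^sup>2 * (norm (obs_Z w))\<^sup>2 \<le> (2 * (fit_x \<pi> w)\<^sup>2 + 2 * (norm (obs_Z w))\<^sup>2) * (norm (obs_Z w))\<^sup>2"
      by (rule mult_right_mono) simp
    then show ?thesis by (simp add: algebra_simps power4_eq_xxxx power2_eq_square)
  qed
  then show "AE \<omega> in M. norm ((envelope (W 0 \<omega>))\<^sup>2 * (norm (obs_Z (W 0 \<omega>)))\<^sup>2)
      \<le> norm (2 * ((fit_x \<pi> (W 0 \<omega>))\<^sup>2 * (norm (obs_Z (W 0 \<omega>)))\<^sup>2) + 2 * norm (obs_Z (W 0 \<omega>)) ^ 4)"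
    by (intro AE_I2) simp
qed measurable

abbreviation "ut t i \<equiv> u_hat (fst t) (yt t) (xt t) (Zt t) (mt t) i"
abbreviation "vt t i \<equiv> v_hat (fst t) (xt t) (Zt t) (mt t) i"

lemma u_hat_close:
  "\<forall>\<^sub>F t in in_prob M. \<forall>i<fst t. \<bar>ut t i - r (W i (snd t))\<bar> \<le> rate t * envelope (W i (snd t))"
  using eventually_regular
proof eventually_elim
  case (elim t)
  show ?case
  proof (intro allI impI)
    fix i
    let ?x = "fit_x \<pi> (W i (snd t))" and ?z = "Zt t i" and ?m = "of_bool (mt t i) :: real"
    have "ut t i - r (W i (snd t)) = - (?x * (b t - \<beta>)) - ?m * (?z \<bullet> S.\<delta> t) * b t"
      using elim S.u_hat_eq[of t i] by (simp add: regular_def b_def sample_errors)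
    also have "\<bar>\<dots>\<bar> \<le> \<bar>?x\<bar> * \<bar>b t - \<beta>\<bar> + ?m * \<bar>?z \<bullet> S.\<delta> t\<bar> * \<bar>b t\<bar>"
      by (rule order_trans[OF abs_triangle_ineq4]) (simp add: abs_mult)
    also have "\<dots> \<le> \<bar>?x\<bar> * \<bar>b t - \<beta>\<bar> + 1 * (norm ?z * norm (S.\<delta> t)) * \<bar>b t\<bar>"
      by (intro add_left_mono mult_right_mono mult_mono Cauchy_Schwarz_ineq2) auto
    also have "\<dots> = \<bar>?x\<bar> * \<bar>b t - \<beta>\<bar> + norm ?z * (norm (S.\<delta> t) * \<bar>b t\<bar>)" by simp
    also have "\<dots> \<le> \<bar>?x\<bar> * rate t + norm ?z * rate t"
      by (intro add_mono mult_left_mono) (auto simp: rate_def distrib_left)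
    finally show "\<bar>ut t i - r (W i (snd t))\<bar> \<le> rate t * envelope (W i (snd t))"
      by (simp add: envelope_def algebra_simps)
  qed
qed

lemma v_hat_close:
  "\<forall>\<^sub>F t in in_prob M. \<forall>i<fst t. \<bar>vt t i - s (W i (snd t))\<bar> \<le> rate t * envelope (W i (snd t))"
  using eventually_regular
proof eventually_elim
  case (elim t)
  show ?case
  proof (intro allI impI)
    fix i
    let ?z = "Zt t i" and ?c = "of_bool (\<not> mt t i) :: real"
    have "vt t i - s (W i (snd t)) = - (?c * (?z \<bullet> S.\<delta> t))"
      using elim S.v_hat_eq[of t i] by (simp add: regular_def err_s_def)
    also have "\<bar>\<dots>\<bar> = ?c * \<bar>?z \<bullet> S.\<delta> t\<bar>" by (simp add: abs_mult)
    also have "\<dots> \<le> 1 * (norm ?z * norm (S.\<delta> t))"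
      by (intro mult_mono Cauchy_Schwarz_ineq2) auto
    also have "\<dots> \<le> envelope (W i (snd t)) * rate t"
      unfolding mult_1 by (intro mult_mono) (auto simp: rate_def envelope_def distrib_left)
    finally show "\<bar>vt t i - s (W i (snd t))\<bar> \<le> rate t * envelope (W i (snd t))"
      by (simp add: mult.commute)
  qed
qed

lemma tendsto_residual_moments:
  "(S.uu_hat \<longlongrightarrow> Err) (in_prob M)" "(S.uv_hat \<longlongrightarrow> Ers) (in_prob M)" "(S.vv_hat \<longlongrightarrow> Ess) (in_prob M)"
proof -
  have env: "0 \<le> envelope w" for w by (simp add: envelope_def)
  note lim = tendsto_avg_products[where h=envelope and q="\<lambda>w. outer (obs_Z w)" and \<tau>=rate,
      unfolded norm_outer, OF _ _ _ _ _ _ envelope_integrable env tendsto_rate]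
  show "(S.uu_hat \<longlongrightarrow> Err) (in_prob M)"
    using lim[of r r, OF _ _ _ _ r2 r2 u_hat_close u_hat_close] by (simp add: S.uu_hat_def[abs_def] Err_def)
  show "(S.uv_hat \<longlongrightarrow> Ers) (in_prob M)"
    using lim[of r s, OF _ _ _ _ r2 s2 u_hat_close v_hat_close] by (simp add: S.uv_hat_def[abs_def] Ers_def)
  show "(S.vv_hat \<longlongrightarrow> Ess) (in_prob M)"
    using lim[of s s, OF _ _ _ _ s2 s2 v_hat_close v_hat_close] by (simp add: S.vv_hat_def[abs_def] Ess_def)
qed

text \<open>The summands are bounded by the fourth power of the norm of Z times a convergent matrix
  norm. Their average thus has a convergent bound, and one factor 1/n is left over.\<close>

lemma tendsto_remainder: "((\<lambda>t. S.rem_hat t /\<^sub>R real (fst t)) \<longlongrightarrow> 0) (in_prob M)"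
proof -
  define C where "C t = matrix_inv (S.A0 t) ** S.vv_hat t ** matrix_inv (S.A0 t)" for t
  obtain K where K: "\<And>(A :: real^'l^'l) (B :: real^'l^'l). norm (A ** B) \<le> norm A * norm B * K" "0 \<le> K"
    using bounded_bilinear.nonneg_bounded[OF bounded_bilinear_matrix_matrix_mult] by blast
  have sandwich: "norm (outer z ** B ** outer z) \<le> norm (z :: real^'l) ^ 4 * (norm B * K\<^sup>2)" for z B
  proof -
    have "norm (outer z ** B ** outer z) \<le> norm (outer z ** B) * norm (outer z) * K" by (rule K)
    also have "\<dots> \<le> (norm (outer z) * norm B * K) * norm (outer z) * K"
      by (intro mult_right_mono K) auto
    finally show ?thesis by (simp add: norm_outer power2_eq_square power4_eq_xxxx mult_ac)
  qed
  have "((\<lambda>t. 1 / real (fst t) * avg (\<lambda>w. norm (obs_Z w) ^ 4) t * (norm (C t) * K\<^sup>2))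
      \<longlongrightarrow> 0 * E (\<lambda>w. norm (obs_Z w) ^ 4) * (norm (matrix_inv P0 ** Ess ** matrix_inv P0) * K\<^sup>2)) (in_prob M)"
    unfolding C_def
    by (intro tendsto_mult tendsto_norm tendsto_const tendsto_avg Z4 tendsto_matrix_matrix_mult
        tendsto_matrix_inv tendsto_A0 P0_inv tendsto_residual_moments tendsto_in_prob_fst lim_1_over_n)
      measurable
  then have lim: "((\<lambda>t. 1 / real (fst t) * avg (\<lambda>w. norm (obs_Z w) ^ 4) t * (norm (C t) * K\<^sup>2)) \<longlongrightarrow> 0) (in_prob M)"
    by simp
  show ?thesis
  proof (rule Lim_null_comparison[OF always_eventually lim], rule allI)
    fix t
    have "norm (\<Sum>i<fst t. of_bool (mt t i) *\<^sub>R (outer (Zt t i) ** C t ** outer (Zt t i)))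
       \<le> (\<Sum>i<fst t. norm (Zt t i) ^ 4 * (norm (C t) * K\<^sup>2))"
    proof (rule sum_norm_le)
      fix i
      have "norm (of_bool (mt t i) *\<^sub>R (outer (Zt t i) ** C t ** outer (Zt t i)))
          \<le> norm (outer (Zt t i) ** C t ** outer (Zt t i))"
        by simp
      then show "norm (of_bool (mt t i) *\<^sub>R (outer (Zt t i) ** C t ** outer (Zt t i)))
          \<le> norm (Zt t i) ^ 4 * (norm (C t) * K\<^sup>2)"
        using sandwich[of "Zt t i" "C t"] by linarith
    qed
    then have "norm (S.rem_hat t) \<le> avg (\<lambda>w. norm (obs_Z w) ^ 4) t * (norm (C t) * K\<^sup>2)"
      unfolding S.rem_hat_def C_def[symmetric] avg_def
      by (simp add: sum_distrib_right[symmetric] mult_left_mono mult.assoc del: scaleR_sum_right)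
    then show "norm (S.rem_hat t /\<^sub>R real (fst t))
        \<le> 1 / real (fst t) * avg (\<lambda>w. norm (obs_Z w) ^ 4) t * (norm (C t) * K\<^sup>2)"
      by (simp add: divide_inverse mult_left_mono mult.assoc)
  qed
qed

abbreviation "Wt t \<equiv> W_RI (fst t) (yt t) (xt t) (Zt t) (mt t)"

lemma tendsto_W_RI: "((\<lambda>t. Wt t /\<^sub>R real (fst t)) \<longlongrightarrow> \<Omega>) (in_prob M)"
proof -
  have "((\<lambda>t. S.uu_hat t - (2 * b t) *\<^sub>R (S.uv_hat t ** matrix_inv (S.A0 t) ** S.A1 t)
      + (b t)\<^sup>2 *\<^sub>R (S.A1 t ** matrix_inv (S.A0 t) ** S.vv_hat t ** matrix_inv (S.A0 t) ** S.A1 t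
          - S.rem_hat t /\<^sub>R real (fst t)))
    \<longlongrightarrow> Err - (2 * \<beta>) *\<^sub>R (Ers ** matrix_inv P0 ** P1)
      + \<beta>\<^sup>2 *\<^sub>R (P1 ** matrix_inv P0 ** Ess ** matrix_inv P0 ** P1 - 0)) (in_prob M)"
    by (intro tendsto_add tendsto_diff tendsto_scaleR tendsto_power tendsto_mult tendsto_const tendsto_b
        tendsto_matrix_matrix_mult tendsto_matrix_inv tendsto_A0 P0_inv tendsto_A1
        tendsto_residual_moments tendsto_remainder)
  then have lim: "((\<lambda>t. S.uu_hat t - (2 * b t) *\<^sub>R (S.uv_hat t ** matrix_inv (S.A0 t) ** S.A1 t)
      + (b t)\<^sup>2 *\<^sub>R (S.A1 t ** matrix_inv (S.A0 t) ** S.vv_hat t ** matrix_inv (S.A0 t) ** S.A1 t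
          - S.rem_hat t /\<^sub>R real (fst t))) \<longlongrightarrow> \<Omega>) (in_prob M)" by (simp add: \<Omega>_def)
  show ?thesis
  proof (rule Lim_transform_eventually[OF lim])
    show "\<forall>\<^sub>F t in in_prob M. S.uu_hat t - (2 * b t) *\<^sub>R (S.uv_hat t ** matrix_inv (S.A0 t) ** S.A1 t)
      + (b t)\<^sup>2 *\<^sub>R (S.A1 t ** matrix_inv (S.A0 t) ** S.vv_hat t ** matrix_inv (S.A0 t) ** S.A1 t
          - S.rem_hat t /\<^sub>R real (fst t)) = Wt t /\<^sub>R real (fst t)"
      using eventually_regular
      by eventually_elim (rule S.W_RI_eq[symmetric], simp_all add: regular_def b_def)
  qed
qed

theorem asymptotic_variance_beta_RI:
  "asymptotic_variance M (\<lambda>n \<omega>. beta_RI n (\<lambda>i. obs_y (W i \<omega>)) (\<lambda>i. obs_x (W i \<omega>)) (\<lambda>i. obs_Z (W i \<omega>))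
     (\<lambda>i. snd (W i \<omega>))) \<beta> (V_RI Qx Qz \<Omega>)"
proof (rule asymptotic_varianceI[OF measurable_score score_variance(1) score_mean score_variance(2)])
  show "((\<lambda>t. sqrt (real (fst t)) * (beta_RI (fst t) (yt t) (xt t) (Zt t) (mt t) - \<beta>)
      - (\<Sum>i<fst t. score (W i (snd t))) / sqrt (real (fst t))) \<longlongrightarrow> 0) (in_prob M)"
    using asymptotically_linear by (simp add: b_def root_sum_def divide_inverse mult.commute)
qed (rule borel_measurable_beta_RI; measurable)

theorem plim_V_RI_hat:
  "plim M (\<lambda>n \<omega>. real n * V_RI_hat n (\<lambda>i. obs_y (W i \<omega>)) (\<lambda>i. obs_x (W i \<omega>)) (\<lambda>i. obs_Z (W i \<omega>))
     (\<lambda>i. snd (W i \<omega>))) (V_RI Qx Qz \<Omega>)"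
  unfolding plim_iff_tendsto
proof
  show "\<forall>n. (\<lambda>\<omega>. real n * V_RI_hat n (\<lambda>i. obs_y (W i \<omega>)) (\<lambda>i. obs_x (W i \<omega>)) (\<lambda>i. obs_Z (W i \<omega>))
     (\<lambda>i. snd (W i \<omega>))) \<in> borel_measurable M"
    by (intro allI borel_measurable_times borel_measurable_const borel_measurable_V_RI_hat) measurable
  have lim: "((\<lambda>t. V_RI (S.xz t) (S.G t) (Wt t /\<^sub>R real (fst t))) \<longlongrightarrow> V_RI Qx Qz \<Omega>) (in_prob M)"
    by (intro tendsto_V_RI tendsto_xz tendsto_G tendsto_W_RI Qz_inv D_nonzero[unfolded D_def])
  show "((\<lambda>t. real (fst t) * V_RI_hat (fst t) (yt t) (xt t) (Zt t) (mt t)) \<longlongrightarrow> V_RI Qx Qz \<Omega>) (in_prob M)"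
  proof (rule Lim_transform_eventually[OF lim])
    show "\<forall>\<^sub>F t in in_prob M. V_RI (S.xz t) (S.G t) (Wt t /\<^sub>R real (fst t))
      = real (fst t) * V_RI_hat (fst t) (yt t) (xt t) (Zt t) (mt t)"
      using eventually_regular
      by eventually_elim (rule S.V_RI_hat_eq[symmetric], simp_all add: regular_def)
  qed
qed

end

subsection \<open>Missingness\<close>

context prob_space
begin

text \<open>\<open>mcar\<close> concerns the full generated \<sigma>-algebras. Functions of the
  missingness indicator and of the data generate smaller ones, so independence is inherited.\<close>

lemma mcar_indep_var:
  fixes Z :: "'a \<Rightarrow> real^'l" and f :: "real \<times> real \<times> (real^'l) \<Rightarrow> 'c :: topological_space"
  assumes mcar: "mcar M y x Z miss"
    and [measurable]: "y \<in> borel_measurable M" "x \<in> borel_measurable M" "Z \<in> borel_measurable M"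
      "miss \<in> measurable M (count_space UNIV)" "f \<in> borel_measurable borel"
  shows "indep_var borel (\<lambda>\<omega>. g (miss \<omega>)) borel (\<lambda>\<omega>. f (y \<omega>, x \<omega>, Z \<omega>))"
proof -
  let ?A = "vimage_algebra (space M) miss (count_space UNIV)"
  let ?B = "vimage_algebra (space M) (\<lambda>\<omega>. (y \<omega>, x \<omega>, Z \<omega>)) borel"
  have sub: "sigma_sets (space M) {h -` S \<inter> space M |S. S \<in> sets borel} \<subseteq> sets N"
    if "h \<in> borel_measurable N" and [simp]: "space N = space M" for h :: "'a \<Rightarrow> 'c" and N
    using measurable_sets[OF that(1)] by (intro sets.sigma_sets_subset[of _ N, unfolded that(2)]) auto
  have A: "sigma_sets (space M) {(\<lambda>\<omega>. g (miss \<omega>)) -` S \<inter> space M |S. S \<in> sets borel} \<subseteq> sets ?A"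
    by (intro sub measurable_compose[OF measurable_vimage_algebra1]) auto
  have B: "sigma_sets (space M) {(\<lambda>\<omega>. f (y \<omega>, x \<omega>, Z \<omega>)) -` S \<inter> space M |S. S \<in> sets borel} \<subseteq> sets ?B"
    by (intro sub measurable_compose[OF measurable_vimage_algebra1]) auto
  show ?thesis
    unfolding indep_var_eq
  proof (intro conjI)
    show "indep_set (sigma_sets (space M) {(\<lambda>\<omega>. g (miss \<omega>)) -` S \<inter> space M |S. S \<in> sets borel})
      (sigma_sets (space M) {(\<lambda>\<omega>. f (y \<omega>, x \<omega>, Z \<omega>)) -` S \<inter> space M |S. S \<in> sets borel})"
      using mcar A B unfolding mcar_def indep_sets2_eq by blast
  qed measurable
qed

lemma mcar_integral:
  fixes Z :: "'a \<Rightarrow> real^'l" and f :: "real \<times> real \<times> (real^'l) \<Rightarrow> 'c :: euclidean_space"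
  assumes mcar: "mcar M y x Z miss"
    and [measurable]: "y \<in> borel_measurable M" "x \<in> borel_measurable M" "Z \<in> borel_measurable M"
      "miss \<in> measurable M (count_space UNIV)" "f \<in> borel_measurable borel" and int: "integrable M (\<lambda>\<omega>. f (y \<omega>, x \<omega>, Z \<omega>))"
  shows "(\<integral>\<omega>. of_bool (\<not> miss \<omega>) *\<^sub>R f (y \<omega>, x \<omega>, Z \<omega>) \<partial>M)
    = (\<integral>\<omega>. of_bool (\<not> miss \<omega>) \<partial>M) *\<^sub>R (\<integral>\<omega>. f (y \<omega>, x \<omega>, Z \<omega>) \<partial>M)"
proof (rule euclidean_eqI)
  fix b :: 'c
  have i: "indep_var borel (\<lambda>\<omega>. of_bool (\<not> miss \<omega>) :: real) borel (\<lambda>\<omega>. f (y \<omega>, x \<omega>, Z \<omega>) \<bullet> b)"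
    by (rule mcar_indep_var[OF mcar, where g="\<lambda>m. of_bool (\<not> m)" and f="\<lambda>d. f d \<bullet> b"]) measurable
  have m: "integrable M (\<lambda>\<omega>. of_bool (\<not> miss \<omega>) :: real)"
    by (rule integrable_const_bound[where B=1]) auto
  have w: "integrable M (\<lambda>\<omega>. of_bool (\<not> miss \<omega>) *\<^sub>R f (y \<omega>, x \<omega>, Z \<omega>))"
    by (rule Bochner_Integration.integrable_bound[OF int]) auto
  have "(\<integral>\<omega>. of_bool (\<not> miss \<omega>) *\<^sub>R f (y \<omega>, x \<omega>, Z \<omega>) \<partial>M) \<bullet> b = (\<integral>\<omega>. of_bool (\<not> miss \<omega>) * (f (y \<omega>, x \<omega>, Z \<omega>) \<bullet> b) \<partial>M)"
    using integral_inner_left[OF w, of b] by simp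
  also have "\<dots> = (\<integral>\<omega>. of_bool (\<not> miss \<omega>) \<partial>M) * (\<integral>\<omega>. f (y \<omega>, x \<omega>, Z \<omega>) \<bullet> b \<partial>M)"
    using int by (intro indep_var_lebesgue_integral[OF i m]) simp
  finally show "(\<integral>\<omega>. of_bool (\<not> miss \<omega>) *\<^sub>R f (y \<omega>, x \<omega>, Z \<omega>) \<partial>M) \<bullet> b
    = ((\<integral>\<omega>. of_bool (\<not> miss \<omega>) \<partial>M) *\<^sub>R (\<integral>\<omega>. f (y \<omega>, x \<omega>, Z \<omega>) \<partial>M)) \<bullet> b"
    using int by simp
qed

text \<open>The moment condition on the imputed regressor controls x only where it is observed. By
  independence the nonnegative integral of the product factors, and a positive probability of being
  complete forces the other factor to be finite.\<close>

lemma mcar_integrable: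
  fixes Z :: "'a \<Rightarrow> real^'l" and f :: "real \<times> real \<times> (real^'l) \<Rightarrow> real"
  assumes mcar: "mcar M y x Z miss"
    and [measurable]: "y \<in> borel_measurable M" "x \<in> borel_measurable M" "Z \<in> borel_measurable M"
      "miss \<in> measurable M (count_space UNIV)" "f \<in> borel_measurable borel" and nonneg: "\<And>d. 0 \<le> f d"
    and int: "integrable M (\<lambda>\<omega>. of_bool (\<not> miss \<omega>) * f (y \<omega>, x \<omega>, Z \<omega>))"
    and pos: "(\<integral>\<omega>. of_bool (\<not> miss \<omega>) \<partial>M) \<noteq> (0 :: real)"
  shows "integrable M (\<lambda>\<omega>. f (y \<omega>, x \<omega>, Z \<omega>))"
proof (rule integrableI_nonneg)
  let ?m = "\<lambda>\<omega>. ennreal (of_bool (\<not> miss \<omega>))" and ?f = "\<lambda>\<omega>. ennreal (f (y \<omega>, x \<omega>, Z \<omega>))"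
  have "indep_var borel ?m borel ?f"
    by (rule mcar_indep_var[OF mcar, where g="\<lambda>m. ennreal (of_bool (\<not> m))" and f="\<lambda>d. ennreal (f d)"]) measurable
  moreover have "case_bool borel borel = (\<lambda>_. borel :: ennreal measure)" by (auto split: bool.split)
  ultimately have "indep_vars (\<lambda>_. borel) (case_bool ?m ?f) UNIV"
    unfolding indep_var_def by simp
  from indep_vars_nn_integral[OF _ this]
  have "(\<integral>\<^sup>+\<omega>. ?m \<omega> * ?f \<omega> \<partial>M) = (\<integral>\<^sup>+\<omega>. ?m \<omega> \<partial>M) * (\<integral>\<^sup>+\<omega>. ?f \<omega> \<partial>M)"
    by (simp add: UNIV_bool mult.commute)
  moreover have "(\<integral>\<^sup>+\<omega>. ?m \<omega> * ?f \<omega> \<partial>M) < \<infinity>"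
    using int by (simp add: integrable_iff_bounded ennreal_mult[symmetric] nonneg)
  moreover have "(\<integral>\<^sup>+\<omega>. ?m \<omega> \<partial>M) \<noteq> 0"
  proof -
    have "0 < (\<integral>\<omega>. of_bool (\<not> miss \<omega>) \<partial>M :: real)"
      by (rule order_neq_le_trans[OF pos[symmetric]]) (rule Bochner_Integration.integral_nonneg, simp)
    moreover have "(\<integral>\<^sup>+\<omega>. ?m \<omega> \<partial>M) = ennreal (\<integral>\<omega>. of_bool (\<not> miss \<omega>) \<partial>M)"
      by (rule nn_integral_eq_integral) (auto intro!: integrable_const_bound[where B=1])
    ultimately show ?thesis using pos by (simp add: ennreal_eq_0_iff)
  qed
  ultimately show "(\<integral>\<^sup>+\<omega>. ?f \<omega> \<partial>M) < \<infinity>"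
    unfolding infinity_ennreal_def less_top[symmetric] by (metis ennreal_mult_eq_top_iff)
qed (use nonneg in \<open>auto\<close>)

text \<open>Multiplying by the probability keeps the identity valid for a null event, where both
  sides are 0; the case p = 0 is thereby included.\<close>

lemma measure_scaleR_expect_given:
  fixes f :: "'a \<Rightarrow> 'b :: {banach, second_countable_topology}"
  assumes [measurable]: "Measurable.pred M P"
  shows "measure M {\<omega> \<in> space M. P \<omega>} *\<^sub>R expect_given M P f = (\<integral>\<omega>. of_bool (P \<omega>) *\<^sub>R f \<omega> \<partial>M)"
proof -
  have eq: "(\<integral>\<omega>. indicator {\<omega> \<in> space M. P \<omega>} \<omega> *\<^sub>R f \<omega> \<partial>M) = (\<integral>\<omega>. of_bool (P \<omega>) *\<^sub>R f \<omega> \<partial>M)"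
    by (intro Bochner_Integration.integral_cong) (auto simp: indicator_def)
  show ?thesis
  proof (cases "measure M {\<omega> \<in> space M. P \<omega>} = 0")
    case True
    then have "AE \<omega> in M. \<not> P \<omega>"
      by (subst AE_iff_measurable[OF _ refl]) (auto simp: emeasure_eq_measure)
    then have "(\<integral>\<omega>. of_bool (P \<omega>) *\<^sub>R f \<omega> \<partial>M) = 0"
      by (intro integral_eq_zero_AE) (auto elim: eventually_mono)
    then show ?thesis using True by simp
  qed (simp add: expect_given_def eq)
qed

lemma expectation_of_bool:
  assumes [measurable]: "Measurable.pred M P"
  shows "(\<integral>\<omega>. of_bool (P \<omega>) \<partial>M) = measure M {\<omega> \<in> space M. P \<omega>}"
proof -
  have "(\<integral>\<omega>. of_bool (P \<omega>) \<partial>M) = (\<integral>\<omega>. indicat_real {\<omega> \<in> space M. P \<omega>} \<omega> \<partial>M)"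
    by (intro Bochner_Integration.integral_cong) (auto simp: indicator_def)
  then show ?thesis by simp
qed

end

lemma invertible_full_rank:
  fixes A :: "real^'n^'n"
  assumes "rank A = CARD('n)" shows "invertible A"
  using assms unfolding invertible_left_inverse matrix_left_invertible_injective full_rank_injective .

lemma integrable_square_products:
  fixes f :: "'a \<Rightarrow> real" and z :: "'a \<Rightarrow> 'b :: euclidean_space"
  assumes [measurable]: "f \<in> borel_measurable M" "z \<in> borel_measurable M"
    and f: "integrable M (\<lambda>\<omega>. f \<omega> ^ 4)" and z: "integrable M (\<lambda>\<omega>. norm (z \<omega>) ^ 4)"
  shows "integrable M (\<lambda>\<omega>. (f \<omega>)\<^sup>2 * (norm (z \<omega>))\<^sup>2)"
proof (rule Bochner_Integration.integrable_bound[OF Bochner_Integration.integrable_add[OF f z]])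
  have "a\<^sup>2 * b\<^sup>2 \<le> a ^ 4 + b ^ 4" for a b :: real
    using abs_mult_le_sum_squares[of "a\<^sup>2" "b\<^sup>2"] by (simp add: power_mult[symmetric])
  then show "AE \<omega> in M. norm ((f \<omega>)\<^sup>2 * (norm (z \<omega>))\<^sup>2) \<le> norm (f \<omega> ^ 4 + norm (z \<omega>) ^ 4)"
    by (intro AE_I2) simp
qed measurable

lemma integrable_square_sum:
  fixes f g h :: "'a \<Rightarrow> real"
  assumes [measurable]: "f \<in> borel_measurable M" "g \<in> borel_measurable M" "h \<in> borel_measurable M"
    and f: "integrable M (\<lambda>\<omega>. (f \<omega>)\<^sup>2 * (h \<omega>)\<^sup>2)" and g: "integrable M (\<lambda>\<omega>. (g \<omega>)\<^sup>2 * (h \<omega>)\<^sup>2)"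
  shows "integrable M (\<lambda>\<omega>. (f \<omega> + g \<omega>)\<^sup>2 * (h \<omega>)\<^sup>2)"
proof (rule Bochner_Integration.integrable_bound)
  show "integrable M (\<lambda>\<omega>. 2 * ((f \<omega>)\<^sup>2 * (h \<omega>)\<^sup>2) + 2 * ((g \<omega>)\<^sup>2 * (h \<omega>)\<^sup>2))"
    using f g by simp
  have "(a + b)\<^sup>2 * c\<^sup>2 \<le> 2 * (a\<^sup>2 * c\<^sup>2) + 2 * (b\<^sup>2 * c\<^sup>2)" for a b c :: real
  proof -
    have "(a + b)\<^sup>2 \<le> 2 * a\<^sup>2 + 2 * b\<^sup>2"
      using sum_squares_bound[of a b] by (simp add: power2_sum)
    then have "(a + b)\<^sup>2 * c\<^sup>2 \<le> (2 * a\<^sup>2 + 2 * b\<^sup>2) * c\<^sup>2" by (rule mult_right_mono) simp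
    then show ?thesis by (simp add: algebra_simps)
  qed
  then show "AE \<omega> in M. norm ((f \<omega> + g \<omega>)\<^sup>2 * (h \<omega>)\<^sup>2)
      \<le> norm (2 * ((f \<omega>)\<^sup>2 * (h \<omega>)\<^sup>2) + 2 * ((g \<omega>)\<^sup>2 * (h \<omega>)\<^sup>2))"
    by (intro AE_I2) simp
qed measurable

theorem proposition2:
  fixes M :: "'a measure"
    and y x u v :: "nat \<Rightarrow> 'a \<Rightarrow> real"
    and Z :: "nat \<Rightarrow> 'a \<Rightarrow> real^'l"
    and miss :: "nat \<Rightarrow> 'a \<Rightarrow> bool"
    and \<beta> p :: real
    and \<pi> Qzx :: "real^'l"
    and Qzz Q0 Q1 :: "real^'l^'l"
  assumes prob: "prob_space M"
    \<comment> \<open>the model\<close>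
    and model_y: "\<And>i \<omega>. \<omega> \<in> space M \<Longrightarrow> y i \<omega> = x i \<omega> * \<beta> + u i \<omega>"
    and model_x: "\<And>i \<omega>. \<omega> \<in> space M \<Longrightarrow> x i \<omega> = Z i \<omega> \<bullet> \<pi> + v i \<omega>"
    \<comment> \<open>(1)\<close>
    and Zu_integrable: "\<And>i. integrable M (\<lambda>\<omega>. u i \<omega> *\<^sub>R Z i \<omega>)"
    and Zu_mean: "\<And>i. (\<integral>\<omega>. u i \<omega> *\<^sub>R Z i \<omega> \<partial>M) = 0"
    and Zu_plim: "plim M (\<lambda>n \<omega>. cross {..<n} (\<lambda>i. Z i \<omega>) (\<lambda>i. u i \<omega>) /\<^sub>R real n) 0"
    and Zv_integrable: "\<And>i. integrable M (\<lambda>\<omega>. v i \<omega> *\<^sub>R Z i \<omega>)"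
    and Zv_mean: "\<And>i. (\<integral>\<omega>. v i \<omega> *\<^sub>R Z i \<omega> \<partial>M) = 0"
    and Zv_plim: "plim M (\<lambda>n \<omega>. cross {..<n} (\<lambda>i. Z i \<omega>) (\<lambda>i. v i \<omega>) /\<^sub>R real n) 0"
    \<comment> \<open>(2)\<close>
    and Zx_integrable: "\<And>i. integrable M (\<lambda>\<omega>. x i \<omega> *\<^sub>R Z i \<omega>)"
    and Zx_mean: "\<And>i. (\<integral>\<omega>. x i \<omega> *\<^sub>R Z i \<omega> \<partial>M) = Qzx"
    and Zx_plim: "plim M (\<lambda>n \<omega>. cross {..<n} (\<lambda>i. Z i \<omega>) (\<lambda>i. x i \<omega>) /\<^sub>R real n) Qzx"
    and Qzx_nonzero: "Qzx \<noteq> 0"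
    \<comment> \<open>(3)\<close>
    and ZZ_integrable: "\<And>i. integrable M (\<lambda>\<omega>. outer (Z i \<omega>))"
    and ZZ_mean: "\<And>i. (\<integral>\<omega>. outer (Z i \<omega>) \<partial>M) = Qzz"
    and ZZ_plim: "plim M (\<lambda>n \<omega>. gram {..<n} (\<lambda>i. Z i \<omega>) /\<^sub>R real n) Qzz"
    and Qzz_rank: "rank Qzz = CARD('l)"
    \<comment> \<open>(4)\<close>
    and indep: "prob_space.indep_vars M (\<lambda>_. borel \<Otimes>\<^sub>M count_space UNIV)
                  (\<lambda>i \<omega>. ((y i \<omega>, x i \<omega>, Z i \<omega>), miss i \<omega>)) UNIV"
    and ident: "\<And>i. distr M (borel \<Otimes>\<^sub>M count_space UNIV)
                       (\<lambda>\<omega>. ((y i \<omega>, x i \<omega>, Z i \<omega>), miss i \<omega>)) =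
                     distr M (borel \<Otimes>\<^sub>M count_space UNIV)
                       (\<lambda>\<omega>. ((y 0 \<omega>, x 0 \<omega>, Z 0 \<omega>), miss 0 \<omega>))"
    \<comment> \<open>(5)\<close>
    and p_plim: "plim M (\<lambda>n \<omega>. real (card (obs_incomplete n (\<lambda>i. miss i \<omega>))) / real n) p"
    and p_less_1: "p < 1"
    \<comment> \<open>definition of \<open>Q\<^sub>Z\<^sub>j\<^sub>Z\<^sub>j\<close> for \<open>j = 0, 1\<close>\<close>
    and Q0: "plim M (\<lambda>n \<omega>. gram (obs_complete n (\<lambda>i. miss i \<omega>)) (\<lambda>i. Z i \<omega>)
                           /\<^sub>R real (card (obs_complete n (\<lambda>i. miss i \<omega>)))) Q0"
    and Q1: "plim M (\<lambda>n \<omega>. gram (obs_incomplete n (\<lambda>i. miss i \<omega>)) (\<lambda>i. Z i \<omega>)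
                           /\<^sub>R real (card (obs_incomplete n (\<lambda>i. miss i \<omega>)))) Q1"
    \<comment> \<open>(6); in the second case: the complete observations identify the first stage, and the
        expectations in the limiting variance exist\<close>
    and ignorable:
      "(\<forall>i. mcar M (y i) (x i) (Z i) (miss i)) \<or>
       (\<forall>i. mar M (y i) (x i) (Z i) (miss i) \<and>
            expect_given M (\<lambda>\<omega>. \<not> miss i \<omega>) (\<lambda>\<omega>. v i \<omega> *\<^sub>R Z i \<omega>) = 0 \<and>
            rank Q0 = CARD('l) \<and>
            integrable M (\<lambda>\<omega>. (u i \<omega>)\<^sup>2 *\<^sub>R outer (Z i \<omega>)) \<and>
            integrable M (\<lambda>\<omega>. (u i \<omega> * v i \<omega>) *\<^sub>R outer (Z i \<omega>)) \<and>
            integrable M (\<lambda>\<omega>. (v i \<omega>)\<^sup>2 *\<^sub>R outer (Z i \<omega>)))"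
    \<comment> \<open>(7); the moment condition on the imputed regressor is imposed at the first-stage
        parameter \<open>\<pi>\<close>, which is weaker than imposing it at the estimate\<close>
    and y_moment: "\<And>i. integrable M (\<lambda>\<omega>. (y i \<omega>) ^ 4)"
    and x_moment: "\<And>i. integrable M
                     (\<lambda>\<omega>. (impute \<pi> (\<lambda>i. x i \<omega>) (\<lambda>i. Z i \<omega>) (\<lambda>i. miss i \<omega>) i) ^ 4)"
    and Z_moment: "\<And>i. integrable M (\<lambda>\<omega>. norm (Z i \<omega>) ^ 4)"
  shows
    "let V = V_RI Qzx Qzz (Omega_RI M (u 0) (v 0) (Z 0) (miss 0) p \<beta> Q0 Q1)
     in asymptotic_variance M
          (\<lambda>n \<omega>. beta_RI n (\<lambda>i. y i \<omega>) (\<lambda>i. x i \<omega>) (\<lambda>i. Z i \<omega>) (\<lambda>i. miss i \<omega>)) \<beta> V \<and>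
        plim M
          (\<lambda>n \<omega>. real n *
             V_RI_hat n (\<lambda>i. y i \<omega>) (\<lambda>i. x i \<omega>) (\<lambda>i. Z i \<omega>) (\<lambda>i. miss i \<omega>)) V"

proof -
  interpret prob_space M by (rule prob)
  define W where "W i \<omega> = ((y i \<omega>, x i \<omega>, Z i \<omega>), miss i \<omega>)" for i \<omega>
  have W [simp]: "obs_y (W i \<omega>) = y i \<omega>" "obs_x (W i \<omega>) = x i \<omega>" "obs_Z (W i \<omega>) = Z i \<omega>"
    "snd (W i \<omega>) = miss i \<omega>" for i \<omega> by (simp_all add: W_def)
  interpret iv_sample M W \<beta> \<pi>
  proof
    show "indep_vars (\<lambda>_. obs_space) W UNIV" using indep by (simp add: W_def[abs_def])
    show "distr M obs_space (W i) = distr M obs_space (W 0)" for i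
      using ident[of i] by (simp add: W_def[abs_def])
  qed
  have obs_meas [measurable]: "y i \<in> borel_measurable M" "x i \<in> borel_measurable M" "Z i \<in> borel_measurable M"
    "miss i \<in> measurable M (count_space UNIV)" for i
    using measurable_compose[OF measurable_W measurable_obs(1), of i]
      measurable_compose[OF measurable_W measurable_obs(2), of i]
      measurable_compose[OF measurable_W measurable_obs(3), of i]
      measurable_compose[OF measurable_W measurable_obs(4), of i] by simp_all

  \<comment> \<open>The errors of the model satisfy these equations only on \<open>space M\<close>.
    The primed versions are defined everywhere from measurable data and replace them in all
    integrals.\<close>
  define u' where "u' \<omega> = y 0 \<omega> - x 0 \<omega> * \<beta>" for \<omega>
  define v' where "v' \<omega> = x 0 \<omega> - Z 0 \<omega> \<bullet> \<pi>" for \<omega>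
  define m where "m \<omega> = (of_bool (miss 0 \<omega>) :: real)" for \<omega>
  define c where "c \<omega> = (of_bool (\<not> miss 0 \<omega>) :: real)" for \<omega>
  have u': "u 0 \<omega> = u' \<omega>" and v': "v 0 \<omega> = v' \<omega>" if "\<omega> \<in> space M" for \<omega>
    using model_y[OF that, of 0] model_x[OF that, of 0] by (simp_all add: u'_def v'_def)
  have [measurable]: "u' \<in> borel_measurable M" "v' \<in> borel_measurable M" "m \<in> borel_measurable M" "c \<in> borel_measurable M"
    unfolding u'_def[abs_def] v'_def[abs_def] m_def[abs_def] c_def[abs_def] by measurable
  have r_eq: "r (W 0 \<omega>) = u' \<omega> + \<beta> * (m \<omega> * v' \<omega>)" and s_eq: "s (W 0 \<omega>) = c \<omega> * v' \<omega>"
    and x_eq: "fit_x \<pi> (W 0 \<omega>) = x 0 \<omega> - m \<omega> * v' \<omega>" for \<omega>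
    by (simp_all add: err_r_def err_s_def fit_x_def u'_def v'_def m_def c_def algebra_simps)
  have c_eq: "c \<omega> = 1 - m \<omega>" for \<omega> by (simp add: m_def c_def)

  \<comment> \<open>The weak law makes the expected indicator the limit of the missing fraction;
    uniqueness of limits identifies it with p.\<close>
  have m_mean: "(\<integral>\<omega>. m \<omega> \<partial>M) = p"
  proof -
    have "(avg (\<lambda>w. of_bool (snd w) :: real) \<longlongrightarrow> E (\<lambda>w. of_bool (snd w))) (in_prob M)"
      by (intro tendsto_avg integrable_const_bound[where B=1]) auto
    moreover have "avg (\<lambda>w. of_bool (snd w) :: real)
        = (\<lambda>t. real (card (obs_incomplete (fst t) (\<lambda>i. miss i (snd t)))) / real (fst t))"
      using sum_obs_incomplete[of "\<lambda>_. 1 :: real"]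
      by (simp add: fun_eq_iff avg_def divide_inverse mult.commute)
    moreover have "E (\<lambda>w. of_bool (snd w)) = (\<integral>\<omega>. m \<omega> \<partial>M)" by (simp add: m_def)
    ultimately have "((\<lambda>t. real (card (obs_incomplete (fst t) (\<lambda>i. miss i (snd t)))) / real (fst t))
        \<longlongrightarrow> (\<integral>\<omega>. m \<omega> \<partial>M)) (in_prob M)" by simp
    then show ?thesis using p_plim unfolding plim_iff_tendsto
      by (intro tendsto_unique[OF in_prob_neq_bot]) auto
  qed
  have m_int: "integrable M m" unfolding m_def[abs_def] by (intro integrable_const_bound[where B=1]) auto
  have c_mean: "(\<integral>\<omega>. c \<omega> \<partial>M) = 1 - p"
    using m_mean m_int prob_space by (simp add: c_eq)
  have pm: "measure M {\<omega> \<in> space M. miss 0 \<omega>} = p" "measure M {\<omega> \<in> space M. \<not> miss 0 \<omega>} = 1 - p"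
    using expectation_of_bool[of "miss 0"] expectation_of_bool[of "\<lambda>\<omega>. \<not> miss 0 \<omega>"] m_mean c_mean
    by (simp_all add: m_def[abs_def] c_def[abs_def])
  have p1: "1 - p \<noteq> 0" using p_less_1 by simp

  have Z2: "integrable M (\<lambda>\<omega>. outer (Z 0 \<omega>))" by (rule ZZ_integrable)
  have mZ2: "integrable M (\<lambda>\<omega>. m \<omega> *\<^sub>R outer (Z 0 \<omega>))" "integrable M (\<lambda>\<omega>. c \<omega> *\<^sub>R outer (Z 0 \<omega>))"
    by (rule Bochner_Integration.integrable_bound[OF Z2]; simp add: m_def c_def)+
  have frac: "((\<lambda>t. real (card (obs_incomplete (fst t) (\<lambda>i. miss i (snd t)))) / real (fst t)) \<longlongrightarrow> p) (in_prob M)"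
    using p_plim unfolding plim_iff_tendsto by simp
  have frac0: "((\<lambda>t. real (card (obs_complete (fst t) (\<lambda>i. miss i (snd t)))) / real (fst t)) \<longlongrightarrow> 1 - p) (in_prob M)"
  proof (rule Lim_transform_eventually[OF tendsto_diff[OF tendsto_const frac]])
    show "\<forall>\<^sub>F t in in_prob M. 1 - real (card (obs_incomplete (fst t) (\<lambda>i. miss i (snd t)))) / real (fst t)
        = real (card (obs_complete (fst t) (\<lambda>i. miss i (snd t)))) / real (fst t)"
      using eventually_in_prob_fst[OF eventually_gt_at_top[of 0]]
    proof eventually_elim
      case (elim t)
      have "{..<fst t} = obs_complete (fst t) (\<lambda>i. miss i (snd t)) \<union> obs_incomplete (fst t) (\<lambda>i. miss i (snd t))"
        by (auto simp: obs_complete_def obs_incomplete_def)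
      then have "card {..<fst t}
          = card (obs_complete (fst t) (\<lambda>i. miss i (snd t))) + card (obs_incomplete (fst t) (\<lambda>i. miss i (snd t)))"
        by (simp only:) (rule card_Un_disjoint; auto simp: obs_complete_def obs_incomplete_def)
      then have "real (card (obs_complete (fst t) (\<lambda>i. miss i (snd t))))
          + real (card (obs_incomplete (fst t) (\<lambda>i. miss i (snd t)))) = real (fst t)"
        by (metis card_lessThan of_nat_add)
      then show ?case using elim by (simp add: field_simps)
    qed
  qed
  \<comment> \<open>The limits \<open>Q0\<close> and \<open>Q1\<close> are normalized by class
    sizes, the sample moments by n. For an empty class both sides are 0 by convention.\<close>
  have gram_lim: "((\<lambda>t. (real (card (I t)) / real (fst t)) *\<^sub>R (gram (I t) (\<lambda>i. Z i (snd t)) /\<^sub>R real (card (I t))))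
      \<longlongrightarrow> L) (in_prob M) \<Longrightarrow> ((\<lambda>t. gram (I t) (\<lambda>i. Z i (snd t)) /\<^sub>R real (fst t)) \<longlongrightarrow> L) (in_prob M)"
    if "\<And>t. finite (I t)" for I :: "nat \<times> 'a \<Rightarrow> nat set" and L
  proof -
    have "(real (card (I t)) / real (fst t)) *\<^sub>R (gram (I t) (\<lambda>i. Z i (snd t)) /\<^sub>R real (card (I t)))
        = gram (I t) (\<lambda>i. Z i (snd t)) /\<^sub>R real (fst t)" for t
      using that[of t] by (cases "I t = {}") (auto simp: gram_def divide_inverse)
    then show "((\<lambda>t. (real (card (I t)) / real (fst t)) *\<^sub>R (gram (I t) (\<lambda>i. Z i (snd t)) /\<^sub>R real (card (I t))))
      \<longlongrightarrow> L) (in_prob M) \<Longrightarrow> ((\<lambda>t. gram (I t) (\<lambda>i. Z i (snd t)) /\<^sub>R real (fst t)) \<longlongrightarrow> L) (in_prob M)"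
      by (simp only:)
  qed
  have P0_eq: "P0 = (1 - p) *\<^sub>R Q0"
  proof (rule tendsto_unique[OF in_prob_neq_bot])
    show "((\<lambda>t. gram (obs_complete (fst t) (\<lambda>i. miss i (snd t))) (\<lambda>i. Z i (snd t)) /\<^sub>R real (fst t))
        \<longlongrightarrow> (1 - p) *\<^sub>R Q0) (in_prob M)"
      by (rule gram_lim[OF _ tendsto_scaleR[OF frac0 Q0[unfolded plim_iff_tendsto, THEN conjunct2]]])
        (simp add: obs_complete_def)
    have "(avg (\<lambda>w. of_bool (\<not> snd w) *\<^sub>R outer (obs_Z w)) \<longlongrightarrow> P0) (in_prob M)"
      unfolding P0_def using mZ2(2) by (intro tendsto_avg) (simp_all add: c_def)
    then show "((\<lambda>t. gram (obs_complete (fst t) (\<lambda>i. miss i (snd t))) (\<lambda>i. Z i (snd t)) /\<^sub>R real (fst t))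
        \<longlongrightarrow> P0) (in_prob M)"
      by (simp add: avg_def[abs_def] gram_def sum_obs_complete)
  qed
  have P1_eq: "P1 = p *\<^sub>R Q1"
  proof (rule tendsto_unique[OF in_prob_neq_bot])
    show "((\<lambda>t. gram (obs_incomplete (fst t) (\<lambda>i. miss i (snd t))) (\<lambda>i. Z i (snd t)) /\<^sub>R real (fst t))
        \<longlongrightarrow> p *\<^sub>R Q1) (in_prob M)"
      by (rule gram_lim[OF _ tendsto_scaleR[OF frac Q1[unfolded plim_iff_tendsto, THEN conjunct2]]])
        (simp add: obs_incomplete_def)
    have "(avg (\<lambda>w. of_bool (snd w) *\<^sub>R outer (obs_Z w)) \<longlongrightarrow> P1) (in_prob M)"
      unfolding P1_def using mZ2(1) by (intro tendsto_avg) (simp_all add: m_def)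
    then show "((\<lambda>t. gram (obs_incomplete (fst t) (\<lambda>i. miss i (snd t))) (\<lambda>i. Z i (snd t)) /\<^sub>R real (fst t))
        \<longlongrightarrow> P1) (in_prob M)"
      by (simp add: avg_def[abs_def] gram_def sum_obs_incomplete)
  qed

  have cong: "integrable M (\<lambda>\<omega>. f (u 0 \<omega>) (v 0 \<omega>) \<omega>) = integrable M (\<lambda>\<omega>. f (u' \<omega>) (v' \<omega>) \<omega>)"
    "(\<integral>\<omega>. f (u 0 \<omega>) (v 0 \<omega>) \<omega> \<partial>M) = (\<integral>\<omega>. f (u' \<omega>) (v' \<omega>) \<omega> \<partial>M)"
    for f :: "real \<Rightarrow> real \<Rightarrow> 'a \<Rightarrow> 'c :: {banach, second_countable_topology}"
    by (intro Bochner_Integration.integrable_cong Bochner_Integration.integral_cong refl; simp add: u' v')+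
  have uZ: "integrable M (\<lambda>\<omega>. u' \<omega> *\<^sub>R Z 0 \<omega>)" "(\<integral>\<omega>. u' \<omega> *\<^sub>R Z 0 \<omega> \<partial>M) = 0"
    using Zu_integrable[of 0] Zu_mean[of 0] cong[of "\<lambda>a b \<omega>. a *\<^sub>R Z 0 \<omega>"] by simp_all
  have vZ: "integrable M (\<lambda>\<omega>. v' \<omega> *\<^sub>R Z 0 \<omega>)" "(\<integral>\<omega>. v' \<omega> *\<^sub>R Z 0 \<omega> \<partial>M) = 0"
    using Zv_integrable[of 0] Zv_mean[of 0] cong[of "\<lambda>a b \<omega>. b *\<^sub>R Z 0 \<omega>"] by simp_all

  have x2: "integrable M (\<lambda>\<omega>. (fit_x \<pi> (W 0 \<omega>))\<^sup>2 * (norm (Z 0 \<omega>))\<^sup>2)"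
  proof (rule integrable_square_products)
    show "integrable M (\<lambda>\<omega>. fit_x \<pi> (W 0 \<omega>) ^ 4)"
      using x_moment[of 0] by (simp add: fit_x_def impute_def cong: if_cong)
  qed (use Z_moment in auto)

  \<comment> \<open>Both mechanisms are reduced to the same four facts: by independence in the first
    case, from the conditions stated along with \<open>mar\<close> in the second.\<close>
  have regular: "integrable M (\<lambda>\<omega>. (u' \<omega>)\<^sup>2 * (norm (Z 0 \<omega>))\<^sup>2) \<and> integrable M (\<lambda>\<omega>. (v' \<omega>)\<^sup>2 * (norm (Z 0 \<omega>))\<^sup>2)
      \<and> (\<integral>\<omega>. c \<omega> *\<^sub>R (v' \<omega> *\<^sub>R Z 0 \<omega>) \<partial>M) = 0 \<and> invertible P0"
    using ignorable
  proof
    assume "\<forall>i. mcar M (y i) (x i) (Z i) (miss i)"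
    then have mcar: "mcar M (y 0) (x 0) (Z 0) (miss 0)" by blast
    have [measurable]: "(\<lambda>d :: real \<times> real \<times> (real^'l). fst (snd d)) \<in> borel_measurable borel"
      "(\<lambda>d :: real \<times> real \<times> (real^'l). snd (snd d)) \<in> borel_measurable borel"
      by (auto intro!: borel_measurable_continuous_onI continuous_intros)
    \<comment> \<open>On complete observations \<open>fit_x\<close> is x itself; independence then
      removes the indicator.\<close>
    have cx2: "integrable M (\<lambda>\<omega>. c \<omega> * ((x 0 \<omega>)\<^sup>2 * (norm (Z 0 \<omega>))\<^sup>2))"
      by (rule Bochner_Integration.integrable_bound[OF x2]) (auto simp: c_def fit_x_def)
    have X2: "integrable M (\<lambda>\<omega>. (x 0 \<omega>)\<^sup>2 * (norm (Z 0 \<omega>))\<^sup>2)"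
      using mcar_integrable[OF mcar obs_meas, of "\<lambda>d. (fst (snd d))\<^sup>2 * (norm (snd (snd d)))\<^sup>2"] cx2 c_mean p1
      by (simp add: c_def)
    have Y2: "integrable M (\<lambda>\<omega>. (y 0 \<omega>)\<^sup>2 * (norm (Z 0 \<omega>))\<^sup>2)"
      using y_moment Z_moment by (intro integrable_square_products) auto
    have Zpi: "integrable M (\<lambda>\<omega>. (Z 0 \<omega> \<bullet> \<pi>)\<^sup>2 * (norm (Z 0 \<omega>))\<^sup>2)"
    proof (rule Bochner_Integration.integrable_bound)
      show "integrable M (\<lambda>\<omega>. (norm \<pi>)\<^sup>2 * norm (Z 0 \<omega>) ^ 4)" using Z_moment by simp
      have "(Z 0 \<omega> \<bullet> \<pi>)\<^sup>2 * (norm (Z 0 \<omega>))\<^sup>2 \<le> (norm (Z 0 \<omega>) * norm \<pi>)\<^sup>2 * (norm (Z 0 \<omega>))\<^sup>2" for \<omega>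
        using Cauchy_Schwarz_ineq2[of "Z 0 \<omega>" \<pi>]
        by (intro mult_right_mono) (auto simp: abs_le_square_iff[symmetric])
      then show "AE \<omega> in M. norm ((Z 0 \<omega> \<bullet> \<pi>)\<^sup>2 * (norm (Z 0 \<omega>))\<^sup>2) \<le> norm ((norm \<pi>)\<^sup>2 * norm (Z 0 \<omega>) ^ 4)"
        by (intro AE_I2) (simp add: power_mult_distrib power2_eq_square power4_eq_xxxx mult_ac)
    qed measurable
    have "integrable M (\<lambda>\<omega>. (y 0 \<omega> + (- \<beta>) * x 0 \<omega>)\<^sup>2 * (norm (Z 0 \<omega>))\<^sup>2)"
      using Y2 X2 by (intro integrable_square_sum) (simp_all add: power_mult_distrib mult.assoc)
    moreover have "integrable M (\<lambda>\<omega>. (x 0 \<omega> + - (Z 0 \<omega> \<bullet> \<pi>))\<^sup>2 * (norm (Z 0 \<omega>))\<^sup>2)"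
      using X2 Zpi by (intro integrable_square_sum) simp_all
    \<comment> \<open>Independence factors this into the probability of being complete times E[vZ] =
      0.\<close>
    moreover have "(\<integral>\<omega>. c \<omega> *\<^sub>R (v' \<omega> *\<^sub>R Z 0 \<omega>) \<partial>M) = 0"
      using mcar_integral[OF mcar obs_meas, of "\<lambda>d. (fst (snd d) - snd (snd d) \<bullet> \<pi>) *\<^sub>R snd (snd d)"] vZ
      by (simp add: c_def v'_def)
    moreover have "P0 = (1 - p) *\<^sub>R Qzz"
      using mcar_integral[OF mcar obs_meas, of "\<lambda>d. outer (snd (snd d))"] Z2 c_mean ZZ_mean[of 0]
      by (simp add: P0_def c_def)
    then have "invertible P0" using invertible_scaleR[OF invertible_full_rank[OF Qzz_rank] p1] by simp
    ultimately show ?thesis by (simp add: u'_def v'_def mult.commute)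
  next
    assume "\<forall>i. mar M (y i) (x i) (Z i) (miss i) \<and>
            expect_given M (\<lambda>\<omega>. \<not> miss i \<omega>) (\<lambda>\<omega>. v i \<omega> *\<^sub>R Z i \<omega>) = 0 \<and>
            rank Q0 = CARD('l) \<and>
            integrable M (\<lambda>\<omega>. (u i \<omega>)\<^sup>2 *\<^sub>R outer (Z i \<omega>)) \<and>
            integrable M (\<lambda>\<omega>. (u i \<omega> * v i \<omega>) *\<^sub>R outer (Z i \<omega>)) \<and>
            integrable M (\<lambda>\<omega>. (v i \<omega>)\<^sup>2 *\<^sub>R outer (Z i \<omega>))"
    then have mar: "expect_given M (\<lambda>\<omega>. \<not> miss 0 \<omega>) (\<lambda>\<omega>. v 0 \<omega> *\<^sub>R Z 0 \<omega>) = 0"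
      "rank Q0 = CARD('l)" "integrable M (\<lambda>\<omega>. (u 0 \<omega>)\<^sup>2 *\<^sub>R outer (Z 0 \<omega>))"
      "integrable M (\<lambda>\<omega>. (v 0 \<omega>)\<^sup>2 *\<^sub>R outer (Z 0 \<omega>))" by blast+
    have "integrable M (\<lambda>\<omega>. (u' \<omega>)\<^sup>2 *\<^sub>R outer (Z 0 \<omega>))"
      using mar(3) cong(1)[of "\<lambda>a b \<omega>. a\<^sup>2 *\<^sub>R outer (Z 0 \<omega>)"] by simp
    from integrable_norm[OF this]
    have "integrable M (\<lambda>\<omega>. (u' \<omega>)\<^sup>2 * (norm (Z 0 \<omega>))\<^sup>2)" by (simp add: norm_outer)
    moreover have "integrable M (\<lambda>\<omega>. (v' \<omega>)\<^sup>2 *\<^sub>R outer (Z 0 \<omega>))"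
      using mar(4) cong(1)[of "\<lambda>a b \<omega>. b\<^sup>2 *\<^sub>R outer (Z 0 \<omega>)"] by simp
    from integrable_norm[OF this]
    have "integrable M (\<lambda>\<omega>. (v' \<omega>)\<^sup>2 * (norm (Z 0 \<omega>))\<^sup>2)" by (simp add: norm_outer)
    moreover have "(\<integral>\<omega>. c \<omega> *\<^sub>R (v' \<omega> *\<^sub>R Z 0 \<omega>) \<partial>M) = 0"
      using measure_scaleR_expect_given[of "\<lambda>\<omega>. \<not> miss 0 \<omega>" "\<lambda>\<omega>. v 0 \<omega> *\<^sub>R Z 0 \<omega>"] mar(1)
        cong(2)[of "\<lambda>a b \<omega>. c \<omega> *\<^sub>R (b *\<^sub>R Z 0 \<omega>)"] by (simp add: c_def)
    moreover have "invertible P0"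
      unfolding P0_eq by (intro invertible_scaleR invertible_full_rank mar p1)
    ultimately show ?thesis by blast
  qed
  then have u2: "integrable M (\<lambda>\<omega>. (u' \<omega>)\<^sup>2 * (norm (Z 0 \<omega>))\<^sup>2)"
    and v2: "integrable M (\<lambda>\<omega>. (v' \<omega>)\<^sup>2 * (norm (Z 0 \<omega>))\<^sup>2)"
    and cvZ: "(\<integral>\<omega>. c \<omega> *\<^sub>R (v' \<omega> *\<^sub>R Z 0 \<omega>) \<partial>M) = 0" and P0_inv: "invertible P0" by blast+

  have mvZ_int: "integrable M (\<lambda>\<omega>. m \<omega> *\<^sub>R (v' \<omega> *\<^sub>R Z 0 \<omega>))" "integrable M (\<lambda>\<omega>. c \<omega> *\<^sub>R (v' \<omega> *\<^sub>R Z 0 \<omega>))"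
    by (rule Bochner_Integration.integrable_bound[OF vZ(1)]; simp add: m_def c_def)+
  \<comment> \<open>The two indicators add up to 1, so orthogonality overall and on the complete
    observations gives it on the incomplete ones.\<close>
  have mvZ: "(\<integral>\<omega>. m \<omega> *\<^sub>R (v' \<omega> *\<^sub>R Z 0 \<omega>) \<partial>M) = 0"
  proof -
    have "(\<integral>\<omega>. m \<omega> *\<^sub>R (v' \<omega> *\<^sub>R Z 0 \<omega>) + c \<omega> *\<^sub>R (v' \<omega> *\<^sub>R Z 0 \<omega>) \<partial>M) = (\<integral>\<omega>. v' \<omega> *\<^sub>R Z 0 \<omega> \<partial>M)"
      by (intro Bochner_Integration.integral_cong refl) (simp add: m_def c_def)
    then show ?thesis using mvZ_int cvZ vZ by simp
  qed
  have Qz_eq: "Qz = Qzz" using ZZ_mean[of 0] by (simp add: Qz_def)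
  \<comment> \<open>Replacing x by its true fit where it is missing subtracts m v, which is
    orthogonal to Z; the instrument moment is unchanged.\<close>
  have Qx_eq: "Qx = Qzx"
  proof -
    have "Qx = (\<integral>\<omega>. x 0 \<omega> *\<^sub>R Z 0 \<omega> - m \<omega> *\<^sub>R (v' \<omega> *\<^sub>R Z 0 \<omega>) \<partial>M)"
      unfolding Qx_def by (simp add: x_eq scaleR_diff_left)
    then show ?thesis using Zx_integrable[of 0] Zx_mean[of 0] mvZ_int(1) mvZ by simp
  qed
  interpret regular_iv_sample M W \<beta> \<pi>
  proof
    show "integrable M (\<lambda>\<omega>. norm (obs_Z (W 0 \<omega>)) ^ 4)" using Z_moment by simp
    show "integrable M (\<lambda>\<omega>. (fit_x \<pi> (W 0 \<omega>))\<^sup>2 * (norm (obs_Z (W 0 \<omega>)))\<^sup>2)" using x2 by simp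
    have mv2: "integrable M (\<lambda>\<omega>. (m \<omega> * v' \<omega>)\<^sup>2 * (norm (Z 0 \<omega>))\<^sup>2)"
      "integrable M (\<lambda>\<omega>. (c \<omega> * v' \<omega>)\<^sup>2 * (norm (Z 0 \<omega>))\<^sup>2)"
      by (rule Bochner_Integration.integrable_bound[OF v2]; simp add: m_def c_def)+
    then have "integrable M (\<lambda>\<omega>. (\<beta> * (m \<omega> * v' \<omega>))\<^sup>2 * (norm (Z 0 \<omega>))\<^sup>2)"
      by (simp add: power_mult_distrib[of \<beta>] mult.assoc)
    then show "integrable M (\<lambda>\<omega>. (r (W 0 \<omega>))\<^sup>2 * (norm (obs_Z (W 0 \<omega>)))\<^sup>2)"
      unfolding r_eq W by (intro integrable_square_sum u2) auto
    show "integrable M (\<lambda>\<omega>. (s (W 0 \<omega>))\<^sup>2 * (norm (obs_Z (W 0 \<omega>)))\<^sup>2)"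
      unfolding s_eq W by (rule mv2)
    have "E (\<lambda>w. r w *\<^sub>R obs_Z w) = (\<integral>\<omega>. u' \<omega> *\<^sub>R Z 0 \<omega> + \<beta> *\<^sub>R (m \<omega> *\<^sub>R (v' \<omega> *\<^sub>R Z 0 \<omega>)) \<partial>M)"
      by (simp add: r_eq scaleR_add_left)
    then show "E (\<lambda>w. r w *\<^sub>R obs_Z w) = 0"
      using uZ mvZ_int(1) mvZ by (simp del: scaleR_scaleR)
    show "E (\<lambda>w. s w *\<^sub>R obs_Z w) = 0" using cvZ by (simp add: s_eq)
    show "Qx \<noteq> 0" using Qx_eq Qzx_nonzero by simp
    show "invertible Qz" unfolding Qz_eq by (rule invertible_full_rank[OF Qzz_rank])
    show "invertible P0" by (rule P0_inv)
  qed

  have outer_int: "integrable M (\<lambda>\<omega>. f \<omega> *\<^sub>R outer (Z 0 \<omega>))"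
    if [measurable]: "f \<in> borel_measurable M" and "\<And>\<omega>. \<bar>f \<omega>\<bar> \<le> (u' \<omega>)\<^sup>2 + (v' \<omega>)\<^sup>2" for f
  proof (rule Bochner_Integration.integrable_bound[OF Bochner_Integration.integrable_add[OF u2 v2]])
    have "\<bar>f \<omega>\<bar> * (norm (Z 0 \<omega>))\<^sup>2 \<le> ((u' \<omega>)\<^sup>2 + (v' \<omega>)\<^sup>2) * (norm (Z 0 \<omega>))\<^sup>2" for \<omega>
      by (rule mult_right_mono[OF that(2)]) simp
    then show "AE \<omega> in M. norm (f \<omega> *\<^sub>R outer (Z 0 \<omega>)) \<le> norm ((u' \<omega>)\<^sup>2 * (norm (Z 0 \<omega>))\<^sup>2 + (v' \<omega>)\<^sup>2 * (norm (Z 0 \<omega>))\<^sup>2)"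
      by (intro AE_I2) (simp add: norm_outer distrib_right)
  qed measurable
  let ?E0 = "expect_given M (\<lambda>\<omega>. \<not> miss 0 \<omega>)" and ?E1 = "expect_given M (miss 0)"
  let ?uv = "\<lambda>\<omega>. (u 0 \<omega> * v 0 \<omega>) *\<^sub>R outer (Z 0 \<omega>)" and ?vv = "\<lambda>\<omega>. (v 0 \<omega>)\<^sup>2 *\<^sub>R outer (Z 0 \<omega>)"
  have E1: "p *\<^sub>R ?E1 ?uv = (\<integral>\<omega>. (m \<omega> * (u' \<omega> * v' \<omega>)) *\<^sub>R outer (Z 0 \<omega>) \<partial>M)"
    "p *\<^sub>R ?E1 ?vv = (\<integral>\<omega>. (m \<omega> * (v' \<omega>)\<^sup>2) *\<^sub>R outer (Z 0 \<omega>) \<partial>M)"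
    using measure_scaleR_expect_given[of "miss 0" ?uv] measure_scaleR_expect_given[of "miss 0" ?vv]
      cong(2)[of "\<lambda>a b \<omega>. (m \<omega> * (a * b)) *\<^sub>R outer (Z 0 \<omega>)"] cong(2)[of "\<lambda>a b \<omega>. (m \<omega> * b\<^sup>2) *\<^sub>R outer (Z 0 \<omega>)"]
    by (simp_all add: pm m_def)
  have E0: "(1 - p) *\<^sub>R ?E0 ?uv = (\<integral>\<omega>. (c \<omega> * (u' \<omega> * v' \<omega>)) *\<^sub>R outer (Z 0 \<omega>) \<partial>M)"
    "(1 - p) *\<^sub>R ?E0 ?vv = (\<integral>\<omega>. (c \<omega> * (v' \<omega>)\<^sup>2) *\<^sub>R outer (Z 0 \<omega>) \<partial>M)"
    using measure_scaleR_expect_given[of "\<lambda>\<omega>. \<not> miss 0 \<omega>" ?uv] measure_scaleR_expect_given[of "\<lambda>\<omega>. \<not> miss 0 \<omega>" ?vv]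
      cong(2)[of "\<lambda>a b \<omega>. (c \<omega> * (a * b)) *\<^sub>R outer (Z 0 \<omega>)"] cong(2)[of "\<lambda>a b \<omega>. (c \<omega> * b\<^sup>2) *\<^sub>R outer (Z 0 \<omega>)"]
    by (simp_all add: pm c_def)
  have i: "integrable M (\<lambda>\<omega>. (u' \<omega>)\<^sup>2 *\<^sub>R outer (Z 0 \<omega>))"
    "integrable M (\<lambda>\<omega>. (m \<omega> * (u' \<omega> * v' \<omega>)) *\<^sub>R outer (Z 0 \<omega>))"
    "integrable M (\<lambda>\<omega>. (m \<omega> * (v' \<omega>)\<^sup>2) *\<^sub>R outer (Z 0 \<omega>))"
    using abs_mult_le_sum_squares by (auto intro!: outer_int simp: m_def)
  \<comment> \<open>The product of \<open>m\<close> and \<open>c\<close> is 0, so the \<beta> v part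
    of \<open>r\<close> never meets \<open>s\<close>.\<close>
  have Ers_eq: "Ers = (1 - p) *\<^sub>R ?E0 ?uv"
  proof -
    have "r (W 0 \<omega>) * s (W 0 \<omega>) = c \<omega> * (u' \<omega> * v' \<omega>)" for \<omega>
      by (simp add: r_eq s_eq m_def c_def)
    then show ?thesis by (simp add: Ers_def E0)
  qed
  have Ess_eq: "Ess = (1 - p) *\<^sub>R ?E0 ?vv"
  proof -
    have "s (W 0 \<omega>) * s (W 0 \<omega>) = c \<omega> * (v' \<omega>)\<^sup>2" for \<omega>
      by (cases "miss 0 \<omega>") (simp_all add: s_eq c_def power2_eq_square)
    then show ?thesis by (simp add: Ess_def E0)
  qed
  have Err_eq: "Err = (\<integral>\<omega>. (u 0 \<omega>)\<^sup>2 *\<^sub>R outer (Z 0 \<omega>) \<partial>M) + (2 * \<beta>) *\<^sub>R (p *\<^sub>R ?E1 ?uv) + \<beta>\<^sup>2 *\<^sub>R (p *\<^sub>R ?E1 ?vv)"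
  proof -
    \<comment> \<open>The indicator \<open>m\<close> is idempotent, so the square yields exactly the
      two incomplete-class terms of the limiting matrix.\<close>
    have rr: "(r (W 0 \<omega>) * r (W 0 \<omega>)) *\<^sub>R outer (Z 0 \<omega>) = (u' \<omega>)\<^sup>2 *\<^sub>R outer (Z 0 \<omega>)
      + (2 * \<beta>) *\<^sub>R ((m \<omega> * (u' \<omega> * v' \<omega>)) *\<^sub>R outer (Z 0 \<omega>)) + \<beta>\<^sup>2 *\<^sub>R ((m \<omega> * (v' \<omega>)\<^sup>2) *\<^sub>R outer (Z 0 \<omega>))" for \<omega>
      unfolding scaleR_scaleR scaleR_add_left[symmetric]
      by (intro arg_cong2[where f=scaleR] refl) (simp add: r_eq m_def power2_eq_square algebra_simps)
    have "Err = (\<integral>\<omega>. (u' \<omega>)\<^sup>2 *\<^sub>R outer (Z 0 \<omega>) \<partial>M)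
      + (2 * \<beta>) *\<^sub>R (\<integral>\<omega>. (m \<omega> * (u' \<omega> * v' \<omega>)) *\<^sub>R outer (Z 0 \<omega>) \<partial>M)
      + \<beta>\<^sup>2 *\<^sub>R (\<integral>\<omega>. (m \<omega> * (v' \<omega>)\<^sup>2) *\<^sub>R outer (Z 0 \<omega>) \<partial>M)"
      unfolding Err_def W rr using i by (simp del: scaleR_scaleR)
    then show ?thesis using cong(2)[of "\<lambda>a b \<omega>. a\<^sup>2 *\<^sub>R outer (Z 0 \<omega>)"] by (simp add: E1 del: scaleR_scaleR)
  qed
  \<comment> \<open>Invertibility of \<open>P0\<close> is what the two mechanisms share; rescaling
    transfers it to \<open>Q0\<close>.\<close>
  have Q0_inv: "invertible Q0"
    using invertible_scaleR[OF P0_inv, of "1 / (1 - p)"] p1 by (simp add: P0_eq)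
  have P0_inv_eq: "matrix_inv P0 = (1 / (1 - p)) *\<^sub>R matrix_inv Q0"
    unfolding P0_eq by (rule matrix_inv_scaleR[OF Q0_inv p1])
  have "Omega_RI M (u 0) (v 0) (Z 0) (miss 0) p \<beta> Q0 Q1 = \<Omega>"
  proof -
    have "Ers ** matrix_inv P0 ** P1 = p *\<^sub>R (?E0 ?uv ** matrix_inv Q0 ** Q1)"
      unfolding Ers_eq P0_inv_eq P1_eq using p1 by (simp add: scaleR_matrix_mult matrix_mult_scaleR)
    \<comment> \<open>\<open>P1\<close> twice gives p^2, the two inverses give (1 - p)^-2 and
      \<open>Ess\<close> one factor 1 - p; hence p^2 / (1 - p).\<close>
    moreover have "P1 ** matrix_inv P0 ** Ess ** matrix_inv P0 ** P1
        = (p\<^sup>2 / (1 - p)) *\<^sub>R (Q1 ** matrix_inv Q0 ** ?E0 ?vv ** matrix_inv Q0 ** Q1)"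
      unfolding Ess_eq P0_inv_eq P1_eq using p1
      by (simp add: scaleR_matrix_mult matrix_mult_scaleR power2_eq_square)
    ultimately show ?thesis
      unfolding Omega_RI_def Let_def \<Omega>_def Err_eq
      by (simp add: algebra_simps)
  qed
  then show ?thesis
    using asymptotic_variance_beta_RI plim_V_RI_hat by (simp add: Let_def Qx_eq Qz_eq)
qed

end
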